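(* Let $\mathbb{H}$ be a definite quaternion division algebra over $\mathbb{Q}$ with maximal order $\mathcal{O}_{\mathbb{H}}$ and let $g\geq1$. Then the map $M\mapsto \gamma(M)=M\mathcal{O}_{\hat{\mathbb{H}}}^g\cap\mathbb{H}^g$ induces a one-to-one correspondence between $\mathrm{GU}_g(\hat{\mathbb{H}})/\mathrm{GU}_g(\mathcal{O}_{\hat{\mathbb{H}}})$ and the set of principally polarized right $\mathcal{O}_{\mathbb{H}}$-modules $L\subseteq\mathbb{H}^g$.
   Context: $\mathcal{O}_{\hat{\mathbb{H}}}=\mathcal{O}_{\mathbb{H}}\otimes\hat{\mathbb{Z}}$ and $\hat{\mathbb{H}}=\mathcal{O}_{\hat{\mathbb{H}}}\otimes\mathbb{Q}$, with the involution induced by the main involution $x\mapsto\bar x$ of $\mathbb{H}$; for a matrix $M$ put $M^\dagger=\bar M^t$. For an algebra $B$ with anti-involution with fixed ring $R$, $\mathrm{GU}_g(B)=\{M\in\mathrm{Mat}_{g\times g}(B):M^\dagger M=\mu\,\mathrm{Id}\text{ for some }\mu\in R^\times\}$. Let $H_0$ be the hermitian form on $\mathbb{H}^g$ given by the identity matrix ($H_0(x,y)=x^\dagger y$). A finitely generated right $\mathcal{O}_{\mathbb{H}}$-submodule $L\subseteq\mathbb{H}^g$ with $L\otimes\mathbb{Q}=\mathbb{H}^g$ is principally polarized if there exists $c\in\mathbb{Q}^\times$ such that $cH_0|_L$ is $\mathcal{O}_{\mathbb{H}}$-valued and unimodular. *)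

theory Defs
  imports
    "HOL-Analysis.Finite_Cartesian_Product"
    "HOL-Library.Poly_Mapping"
    "HOL-Computational_Algebra.Group_Closure"
    "HOL-Algebra.Left_Coset"
begin

section \<open>The profinite integers\<close>

text \<open>The inverse limit of the rings \<open>\<int>/n\<int>\<close>, \<open>n \<ge> 1\<close>, ordered by divisibility. A compatible
  family is represented by its least non-negative residues; the index \<open>0\<close> carries no information.\<close>

typedef zhat = "{f :: nat \<Rightarrow> int. f 0 = 0 \<and> (\<forall>m n. 0 < n \<longrightarrow> m dvd n \<longrightarrow> f n mod int m = f m)}"
  morphisms residue Abs_zhat
  by (rule exI [of _ "\<lambda>_. 0"]) simp

setup_lifting type_definition_zhat

instantiation zhat :: comm_ring_1
begin

lift_definition zero_zhat :: zhat is "\<lambda>_. 0" by simp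

lift_definition one_zhat :: zhat is "\<lambda>n. if n = 0 then 0 else 1 mod int n"
  by (auto simp: mod_mod_cancel)

lift_definition plus_zhat :: "zhat \<Rightarrow> zhat \<Rightarrow> zhat" is "\<lambda>f g n. (f n + g n) mod int n"
proof -
  fix f g :: "nat \<Rightarrow> int"
  assume f: "f 0 = 0 \<and> (\<forall>m n. 0 < n \<longrightarrow> m dvd n \<longrightarrow> f n mod int m = f m)"
    and g: "g 0 = 0 \<and> (\<forall>m n. 0 < n \<longrightarrow> m dvd n \<longrightarrow> g n mod int m = g m)"
  have "(f n + g n) mod int n mod int m = (f m + g m) mod int m" if "0 < n" "m dvd n" for m n
  proof -
    have "(f n + g n) mod int n mod int m = (f n mod int m + g n mod int m) mod int m"
      using that by (simp add: mod_mod_cancel mod_simps)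
    then show ?thesis using f g that by simp
  qed
  then show "(f 0 + g 0) mod int 0 = 0 \<and> (\<forall>m n. 0 < n \<longrightarrow> m dvd n \<longrightarrow>
      (f n + g n) mod int n mod int m = (f m + g m) mod int m)"
    using f g by simp
qed

lift_definition uminus_zhat :: "zhat \<Rightarrow> zhat" is "\<lambda>f n. (- f n) mod int n"
proof -
  fix f :: "nat \<Rightarrow> int"
  assume f: "f 0 = 0 \<and> (\<forall>m n. 0 < n \<longrightarrow> m dvd n \<longrightarrow> f n mod int m = f m)"
  have "(- f n) mod int n mod int m = (- f m) mod int m" if "0 < n" "m dvd n" for m n
  proof -
    have "(- f n) mod int n mod int m = (- (f n mod int m)) mod int m"
      using that by (simp add: mod_mod_cancel mod_simps)
    then show ?thesis using f that by simp
  qed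
  then show "(- f 0) mod int 0 = 0 \<and> (\<forall>m n. 0 < n \<longrightarrow> m dvd n \<longrightarrow>
      (- f n) mod int n mod int m = (- f m) mod int m)"
    using f by simp
qed

definition minus_zhat :: "zhat \<Rightarrow> zhat \<Rightarrow> zhat"
  where "minus_zhat x y = x + - y"

lift_definition times_zhat :: "zhat \<Rightarrow> zhat \<Rightarrow> zhat" is "\<lambda>f g n. (f n * g n) mod int n"
proof -
  fix f g :: "nat \<Rightarrow> int"
  assume f: "f 0 = 0 \<and> (\<forall>m n. 0 < n \<longrightarrow> m dvd n \<longrightarrow> f n mod int m = f m)"
    and g: "g 0 = 0 \<and> (\<forall>m n. 0 < n \<longrightarrow> m dvd n \<longrightarrow> g n mod int m = g m)"
  have "(f n * g n) mod int n mod int m = (f m * g m) mod int m" if "0 < n" "m dvd n" for m n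
  proof -
    have "(f n * g n) mod int n mod int m = ((f n mod int m) * (g n mod int m)) mod int m"
      using that by (simp add: mod_mod_cancel mod_simps)
    then show ?thesis using f g that by simp
  qed
  then show "(f 0 * g 0) mod int 0 = 0 \<and> (\<forall>m n. 0 < n \<longrightarrow> m dvd n \<longrightarrow>
      (f n * g n) mod int n mod int m = (f m * g m) mod int m)"
    using f g by simp
qed

instance
proof
  fix a b c :: zhat
  have self: "f n mod int n = f n"
    if "f 0 = 0 \<and> (\<forall>m n. 0 < n \<longrightarrow> m dvd n \<longrightarrow> f n mod int m = f m)" for f :: "nat \<Rightarrow> int" and n
    using that by (cases "n = 0") auto
  show "a + b + c = a + (b + c)"
    by transfer (auto simp: fun_eq_iff mod_simps algebra_simps)
  show "a + b = b + a"
    by transfer (auto simp: fun_eq_iff algebra_simps)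
  show "0 + a = a"
    by transfer (simp add: fun_eq_iff self)
  show "- a + a = 0"
    by transfer (auto simp: fun_eq_iff mod_simps)
  show "a - b = a + - b"
    by (simp add: minus_zhat_def)
  show "a * b * c = a * (b * c)"
    by transfer (auto simp: fun_eq_iff mod_simps algebra_simps)
  show "a * b = b * a"
    by transfer (auto simp: fun_eq_iff algebra_simps)
  show "1 * a = a"
    by transfer (auto simp: fun_eq_iff mod_simps self)
  show "(a + b) * c = a * c + b * c"
    by transfer (auto simp: fun_eq_iff mod_simps algebra_simps)
  show "(0::zhat) \<noteq> 1"
    by transfer (auto simp: fun_eq_iff intro!: exI [of _ 2])
qed

end

lemma residue_of_nat: "0 < n \<Longrightarrow> residue (of_nat k) n = int k mod int n"
  by (induction k) (simp_all add: zero_zhat.rep_eq one_zhat.rep_eq plus_zhat.rep_eq mod_simps)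

instance zhat :: ring_char_0
proof
  show "inj (of_nat :: nat \<Rightarrow> zhat)"
  proof (rule injI)
    fix a b :: nat
    assume "(of_nat a :: zhat) = of_nat b"
    then have "int a mod int (Suc (a + b)) = int b mod int (Suc (a + b))"
      by (metis residue_of_nat zero_less_Suc)
    then show "a = b"
      by (simp add: mod_pos_pos_trivial)
  qed
qed


section \<open>Rational scalars in division rings of characteristic zero\<close>

text \<open>A division ring of characteristic \<open>0\<close> carries exactly one \<open>\<rat>\<close>-algebra structure.
  (The library's \<open>of_rat\<close> is only available for commutative fields.)\<close>

definition of_Q :: "rat \<Rightarrow> 'a::{division_ring, ring_char_0}"
  where "of_Q q = of_int (fst (quotient_of q)) / of_int (snd (quotient_of q))"

definition scaleQ :: "rat \<Rightarrow> 'a::{division_ring, ring_char_0} \<Rightarrow> 'a"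
  where "scaleQ q x = of_Q q * x"

definition vscaleQ :: "rat \<Rightarrow> ('a::{division_ring, ring_char_0}) ^ 'n \<Rightarrow> 'a ^ 'n"
  where "vscaleQ q v = (\<chi> k. scaleQ q (v $ k))"

lemma of_int_commute_inverse:
  fixes x :: "'a::{division_ring, ring_char_0}"
  shows "inverse (of_int n) * x = x * inverse (of_int n)"
proof (cases "n = 0")
  case False
  have "of_int n * x = x * of_int n"
    by (simp add: mult_of_int_commute)
  then have "inverse (of_int n) * (of_int n * x) * inverse (of_int n)
      = inverse (of_int n) * (x * of_int n) * inverse (of_int n)"
    by simp
  moreover have "inverse (of_int n) * (of_int n * x) * inverse (of_int n) = x * inverse (of_int n)"
    using False by (simp add: mult.assoc [symmetric])
  moreover have "inverse (of_int n) * (x * of_int n) * inverse (of_int n) = inverse (of_int n) * x"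
    using False by (simp add: mult.assoc)
  ultimately show ?thesis by simp
qed simp

lemma of_Q_eq:
  assumes "d \<noteq> 0" and "q = of_int n / of_int d"
  shows "(of_Q q :: 'a::{division_ring, ring_char_0}) = of_int n / of_int d"
proof -
  obtain n' d' where q: "quotient_of q = (n', d')"
    by (cases "quotient_of q")
  then have d': "d' \<noteq> 0" and "q = of_int n' / of_int d'"
    using quotient_of_denom_pos [of q] quotient_of_div [of q] by auto
  with assms have "(of_int (n' * d) :: rat) = of_int (n * d')"
    by (simp add: field_simps)
  then have eq: "n' * d = n * d'"
    by (simp only: of_int_eq_iff)
  have "(of_int n' / of_int d' :: 'a) = of_int (n' * d) * (inverse (of_int d) * inverse (of_int d'))"
    using assms(1) by (simp add: divide_inverse mult.assoc flip: mult.assoc [of "of_int d"])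
  also have "\<dots> = of_int n * (of_int d' * (inverse (of_int d) * inverse (of_int d')))"
    by (simp add: eq mult.assoc)
  also have "inverse (of_int d) * inverse (of_int d') = inverse (of_int d') * inverse (of_int d :: 'a)"
    by (rule of_int_commute_inverse)
  also have "of_int d' * (inverse (of_int d') * inverse (of_int d :: 'a)) = inverse (of_int d)"
    using d' by (simp add: mult.assoc [symmetric])
  also have "of_int n * inverse (of_int d :: 'a) = of_int n / of_int d"
    by (simp add: divide_inverse)
  finally show ?thesis
    by (simp add: of_Q_def q)
qed

lemma of_Q_commute: "of_Q q * x = x * of_Q q"
proof -
  have "of_Q q * x = of_int (fst (quotient_of q)) * (x * inverse (of_int (snd (quotient_of q))))"
    unfolding of_Q_def divide_inverse by (metis mult.assoc of_int_commute_inverse)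
  also have "\<dots> = x * of_Q q"
    unfolding of_Q_def divide_inverse by (metis mult.assoc mult_of_int_commute)
  finally show ?thesis .
qed

lemma of_Q_0 [simp]: "of_Q 0 = 0" and of_Q_1 [simp]: "of_Q 1 = 1"
  by (simp_all add: of_Q_def)

lemma of_Q_mult: "of_Q (p * q) = of_Q p * (of_Q q :: 'a::{division_ring, ring_char_0})"
proof -
  obtain a b c d where p: "quotient_of p = (a, b)" and q: "quotient_of q = (c, d)"
    by (cases "quotient_of p", cases "quotient_of q")
  have nz: "b \<noteq> 0" "d \<noteq> 0" and "p = of_int a / of_int b" "q = of_int c / of_int d"
    using p q quotient_of_denom_pos quotient_of_div by force+
  then have "(of_Q (p * q) :: 'a) = of_int (a * c) / of_int (d * b)"
    by (intro of_Q_eq) (simp_all add: mult.commute)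
  also have "\<dots> = of_int a * (of_int c * (inverse (of_int b) * inverse (of_int d)))"
    using nz by (simp add: divide_inverse mult.assoc nonzero_inverse_mult_distrib)
  also have "of_int c * (inverse (of_int b) * inverse (of_int d)) =
      inverse (of_int b) * (of_int c * inverse (of_int d) :: 'a)"
    using of_int_commute_inverse [of b "of_int c :: 'a"] by (simp add: mult.assoc [symmetric])
  also have "of_int a * (inverse (of_int b) * (of_int c * inverse (of_int d) :: 'a)) =
      of_int a * inverse (of_int b) * (of_int c * inverse (of_int d))"
    by (simp add: mult.assoc)
  finally show ?thesis
    by (simp add: of_Q_def p q divide_inverse)
qed

lemma of_Q_add: "of_Q (p + q) = of_Q p + (of_Q q :: 'a::{division_ring, ring_char_0})"
proof -
  obtain a b c d where p: "quotient_of p = (a, b)" and q: "quotient_of q = (c, d)"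
    by (cases "quotient_of p", cases "quotient_of q")
  have nz: "b \<noteq> 0" "d \<noteq> 0" and pq: "p = of_int a / of_int b" "q = of_int c / of_int d"
    using p q quotient_of_denom_pos quotient_of_div by force+
  have "(of_Q (p + q) :: 'a) = of_int (a * d + c * b) / of_int (b * d)"
    using nz pq by (intro of_Q_eq) (simp_all add: field_simps)
  also have "\<dots> = of_int (a * d) / of_int (b * d) + of_int (c * b) / of_int (b * d)"
    by (simp add: add_divide_distrib)
  also have "(of_int (a * d) / of_int (b * d) :: 'a) = of_Q p"
    using nz pq by (intro of_Q_eq [symmetric]) simp_all
  also have "(of_int (c * b) / of_int (b * d) :: 'a) = of_Q q"
    using nz pq by (intro of_Q_eq [symmetric]) simp_all
  finally show ?thesis .
qed

global_interpretation rat_vs: vector_space "scaleQ :: rat \<Rightarrow> 'a::{division_ring, ring_char_0} \<Rightarrow> 'a"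
  by unfold_locales (simp_all add: scaleQ_def of_Q_add of_Q_mult algebra_simps)

global_interpretation rat_vec:
  vector_space "vscaleQ :: rat \<Rightarrow> ('a::{division_ring, ring_char_0}) ^ 'n \<Rightarrow> 'a ^ 'n"
  by unfold_locales
    (simp_all add: vec_eq_iff vscaleQ_def rat_vs.scale_right_distrib rat_vs.scale_left_distrib)


section \<open>Tensor products over the integers\<close>

inductive_set tensor_relations :: "(('a::ab_group_add \<times> 'b::ab_group_add) \<Rightarrow>\<^sub>0 int) set"
  where
    left: "frag_of (x + x', y) - frag_of (x, y) - frag_of (x', y) \<in> tensor_relations"
  | right: "frag_of (x, y + y') - frag_of (x, y) - frag_of (x, y') \<in> tensor_relations"

quotient_type (overloaded) ('a, 'b) tensor = "('a::ab_group_add \<times> 'b::ab_group_add) \<Rightarrow>\<^sub>0 int"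
  / "\<lambda>u v. u - v \<in> group_closure tensor_relations"
proof (rule equivpI)
  show "reflp (\<lambda>u v :: ('a \<times> 'b) \<Rightarrow>\<^sub>0 int. u - v \<in> group_closure tensor_relations)"
    by (rule reflpI) simp
  show "symp (\<lambda>u v :: ('a \<times> 'b) \<Rightarrow>\<^sub>0 int. u - v \<in> group_closure tensor_relations)"
    by (rule sympI) (metis group_closure_minus_iff minus_diff_eq)
  show "transp (\<lambda>u v :: ('a \<times> 'b) \<Rightarrow>\<^sub>0 int. u - v \<in> group_closure tensor_relations)"
  proof (rule transpI)
    fix u v w :: "('a \<times> 'b) \<Rightarrow>\<^sub>0 int"
    assume "u - v \<in> group_closure tensor_relations" "v - w \<in> group_closure tensor_relations"
    from group_closure_add [OF this] show "u - w \<in> group_closure tensor_relations"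
      by simp
  qed
qed

lift_definition tens :: "'a::ab_group_add \<Rightarrow> 'b::ab_group_add \<Rightarrow> ('a, 'b) tensor"
  is "\<lambda>x y. frag_of (x, y)" .

instantiation tensor :: (ab_group_add, ab_group_add) ab_group_add
begin

lift_definition zero_tensor :: "('a, 'b) tensor" is 0 .

lift_definition plus_tensor :: "('a, 'b) tensor \<Rightarrow> ('a, 'b) tensor \<Rightarrow> ('a, 'b) tensor" is "(+)"
  by (metis (no_types, lifting) add_diff_add group_closure_add)

lift_definition uminus_tensor :: "('a, 'b) tensor \<Rightarrow> ('a, 'b) tensor" is uminus
  by (metis (no_types, lifting) group_closure_minus_iff minus_diff_minus)

lift_definition minus_tensor :: "('a, 'b) tensor \<Rightarrow> ('a, 'b) tensor \<Rightarrow> ('a, 'b) tensor" is "(-)"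
proof -
  fix u u' v v' :: "('a \<times> 'b) \<Rightarrow>\<^sub>0 int"
  assume "u - u' \<in> group_closure tensor_relations" "v - v' \<in> group_closure tensor_relations"
  from group_closure.diff [OF this] show "u - v - (u' - v') \<in> group_closure tensor_relations"
    by (simp add: algebra_simps)
qed

instance
  by standard (transfer; simp add: algebra_simps)+

end

lemma tens_add_left: "tens (x + x') y = tens x y + tens x' y"
  by transfer (metis diff_diff_eq group_closure.base insertCI tensor_relations.left)

lemma tens_add_right: "tens x (y + y') = tens x y + tens x y'"
  by transfer (metis diff_diff_eq group_closure.base insertCI tensor_relations.right)

lemma frag_extend_group_closure:
  assumes "u \<in> group_closure S" and "\<And>s. s \<in> S \<Longrightarrow> frag_extend f s \<in> group_closure T"
  shows "frag_extend f u \<in> group_closure T"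
  using assms(1)
proof induction
  case (base s)
  then show ?case using assms(2) by auto
next
  case (diff s t)
  then show ?case by (simp add: frag_extend_diff group_closure.diff)
qed

definition frag_mult ::
    "(('a::ring \<times> 'b::ring) \<Rightarrow>\<^sub>0 int) \<Rightarrow> (('a \<times> 'b) \<Rightarrow>\<^sub>0 int) \<Rightarrow> (('a \<times> 'b) \<Rightarrow>\<^sub>0 int)"
  where "frag_mult u v =
    frag_extend (\<lambda>(x, y). frag_extend (\<lambda>(x', y'). frag_of (x * x', y * y')) v) u"

lemma frag_mult_of [simp]: "frag_mult (frag_of (x, y)) (frag_of (x', y')) = frag_of (x * x', y * y')"
  by (simp add: frag_mult_def)

lemma frag_extend_add_fun:
  "frag_extend (\<lambda>i. f i + g i) u = frag_extend f u + frag_extend g u"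
  by (simp add: frag_extend_def frag_cmul_distrib2 sum.distrib)

lemma frag_extend_diff_fun:
  "frag_extend (\<lambda>i. f i - g i) u = frag_extend f u - frag_extend g u"
  using frag_extend_add_fun [of "\<lambda>i. f i - g i" g u] by (simp add: algebra_simps)

lemma frag_mult_add_left: "frag_mult (u + u') v = frag_mult u v + frag_mult u' v"
  by (simp add: frag_mult_def frag_extend_add)

lemma frag_mult_diff_left: "frag_mult (u - u') v = frag_mult u v - frag_mult u' v"
  by (simp add: frag_mult_def frag_extend_diff)

lemma frag_mult_add_right: "frag_mult u (v + v') = frag_mult u v + frag_mult u v'"
  by (simp add: frag_mult_def frag_extend_add case_prod_unfold frag_extend_add_fun)

lemma frag_mult_diff_right: "frag_mult u (v - v') = frag_mult u v - frag_mult u v'"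
  by (simp add: frag_mult_def frag_extend_diff case_prod_unfold frag_extend_diff_fun)

lemma frag_mult_0 [simp]: "frag_mult 0 v = 0" "frag_mult u 0 = 0"
  using frag_mult_diff_left [of 0 0 v] frag_mult_diff_right [of u 0 0] by simp_all

lemma frag_induct_of:
  assumes "P 0" and "\<And>x y. P (frag_of (x, y))" and "\<And>u v. P u \<Longrightarrow> P v \<Longrightarrow> P (u - v)"
  shows "P (u :: ('a \<times> 'b) \<Rightarrow>\<^sub>0 int)"
proof (rule frag_induction [of u UNIV P])
  show "P (frag_of z)" for z using assms(2) by (cases z) simp
qed (use assms in auto)

lemma frag_mult_relations_left:
  assumes "u \<in> tensor_relations"
  shows "frag_mult u v \<in> group_closure tensor_relations"
proof (induction v rule: frag_induct_of)
  case (2 a b)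
  from assms show ?case
  proof cases
    case (left x x' y)
    then have "frag_mult u (frag_of (a, b)) =
        frag_of (x * a + x' * a, y * b) - frag_of (x * a, y * b) - frag_of (x' * a, y * b)"
      by (simp add: frag_mult_diff_left distrib_right)
    then show ?thesis by (simp add: group_closure.base tensor_relations.left)
  next
    case (right x y y')
    then have "frag_mult u (frag_of (a, b)) =
        frag_of (x * a, y * b + y' * b) - frag_of (x * a, y * b) - frag_of (x * a, y' * b)"
      by (simp add: frag_mult_diff_left distrib_right)
    then show ?thesis by (simp add: group_closure.base tensor_relations.right)
  qed
qed (simp_all add: frag_mult_diff_right group_closure.diff)

lemma frag_mult_relations_right:
  assumes "v \<in> tensor_relations"
  shows "frag_mult u v \<in> group_closure tensor_relations"
proof (induction u rule: frag_induct_of)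
  case (2 a b)
  from assms show ?case
  proof cases
    case (left x x' y)
    then have "frag_mult (frag_of (a, b)) v =
        frag_of (a * x + a * x', b * y) - frag_of (a * x, b * y) - frag_of (a * x', b * y)"
      by (simp add: frag_mult_diff_right distrib_left)
    then show ?thesis by (simp add: group_closure.base tensor_relations.left)
  next
    case (right x y y')
    then have "frag_mult (frag_of (a, b)) v =
        frag_of (a * x, b * y + b * y') - frag_of (a * x, b * y) - frag_of (a * x, b * y')"
      by (simp add: frag_mult_diff_right distrib_left)
    then show ?thesis by (simp add: group_closure.base tensor_relations.right)
  qed
qed (simp_all add: frag_mult_diff_left group_closure.diff)

lemma frag_mult_closure:
  assumes "w \<in> group_closure tensor_relations"
  shows frag_mult_closure_left: "frag_mult w v \<in> group_closure tensor_relations"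
    and frag_mult_closure_right: "frag_mult v w \<in> group_closure tensor_relations"
  using assms
  by (induction; auto simp: frag_mult_relations_left frag_mult_relations_right
      frag_mult_diff_left frag_mult_diff_right intro: group_closure.diff)+

lemma frag_mult_assoc: "frag_mult (frag_mult u v) w = frag_mult u (frag_mult v w)"
proof (induction u rule: frag_induct_of)
  case (2 a b)
  show ?case
  proof (induction v rule: frag_induct_of)
    case (2 c d)
    show ?case
      by (induction w rule: frag_induct_of) (simp_all add: frag_mult_diff_right mult.assoc)
  qed (simp_all add: frag_mult_diff_left frag_mult_diff_right)
qed (simp_all add: frag_mult_diff_left)

instantiation tensor :: (ring, ring) ring
begin

lift_definition times_tensor :: "('a, 'b) tensor \<Rightarrow> ('a, 'b) tensor \<Rightarrow> ('a, 'b) tensor"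
  is frag_mult
proof -
  fix u u' v v' :: "('a \<times> 'b) \<Rightarrow>\<^sub>0 int"
  assume "u - u' \<in> group_closure tensor_relations" "v - v' \<in> group_closure tensor_relations"
  then have "frag_mult (u - u') v + frag_mult u' (v - v') \<in> group_closure tensor_relations"
    by (intro group_closure_add frag_mult_closure_left frag_mult_closure_right)
  then show "frag_mult u v - frag_mult u' v' \<in> group_closure tensor_relations"
    by (simp add: frag_mult_diff_left frag_mult_diff_right)
qed

instance
  by standard
    (transfer; simp add: frag_mult_assoc frag_mult_add_left frag_mult_add_right)+

end

lemma tens_mult: "tens x y * tens x' y' = tens (x * x') (y * y')"
  by transfer simp

text \<open>Used only to show \<open>1 \<otimes> 1 \<noteq> 0\<close>, with \<open>l\<close> a \<open>\<rat>\<close>-linear functional such that \<open>l 1 = 1\<close>: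
  \<open>tensor_value l N\<close> sends \<open>x \<otimes> b\<close> to \<open>N l(x) b\<close> when \<open>N l(x)\<close> is an integer.\<close>

definition tensor_value ::
    "('a \<Rightarrow> rat) \<Rightarrow> int \<Rightarrow> (('a \<times> 'b::ring_1) \<Rightarrow>\<^sub>0 int) \<Rightarrow> 'b"
  where "tensor_value l N u =
    (\<Sum>z\<in>Poly_Mapping.keys u. of_int (poly_mapping.lookup u z) * (of_int \<lfloor>of_int N * l (fst z)\<rfloor> * snd z))"

lemma tensor_value_superset:
  assumes "finite K" "Poly_Mapping.keys u \<subseteq> K"
  shows "tensor_value l N u =
    (\<Sum>z\<in>K. of_int (poly_mapping.lookup u z) * (of_int \<lfloor>of_int N * l (fst z)\<rfloor> * snd z))"
  unfolding tensor_value_def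
  by (rule sum.mono_neutral_left) (use assms in \<open>auto simp: in_keys_iff\<close>)

lemma tensor_value_diff: "tensor_value l N (u - v) = tensor_value l N u - tensor_value l N v"
proof -
  let ?K = "Poly_Mapping.keys u \<union> Poly_Mapping.keys v"
  have "Poly_Mapping.keys (u - v) \<subseteq> ?K"
    by (auto simp: in_keys_iff lookup_minus)
  then show ?thesis
    by (simp add: tensor_value_superset [of ?K] lookup_minus algebra_simps sum_subtractf)
qed

lemma tensor_value_of: "tensor_value l N (frag_of (x, y)) = of_int \<lfloor>of_int N * l x\<rfloor> * y"
  by (simp add: tensor_value_def)

lemma tensor_value_relation:
  fixes u :: "('a::{division_ring, ring_char_0} \<times> 'b::ring_1) \<Rightarrow>\<^sub>0 int"
  assumes "u \<in> group_closure tensor_relations" and l: "\<And>x y. l (x + y) = l x + l y"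
  shows "\<exists>D > 0. \<forall>N. D dvd N \<longrightarrow> tensor_value l N u = 0"
  using assms(1)
proof induction
  case (base u)
  then consider "u = 0" | "u \<in> tensor_relations" by blast
  then show ?case
  proof cases
    case 1
    then show ?thesis by (intro exI [of _ 1]) (simp add: tensor_value_def)
  next
    case 2
    then show ?thesis
    proof cases
      case (left x x' y)
      obtain n d where q: "quotient_of (l x) = (n, d)" by (cases "quotient_of (l x)")
      have d: "d > 0" and lx: "l x = of_int n / of_int d"
        using q quotient_of_denom_pos quotient_of_div by auto
      have "tensor_value l N u = 0" if "d dvd N" for N
      proof -
        from that obtain k where "N = d * k" ..
        then have Nl: "of_int N * l x = of_int (k * n)" using d lx by simp
        have "\<lfloor>of_int N * l (x + x')\<rfloor> = k * n + \<lfloor>of_int N * l x'\<rfloor>"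
          unfolding l distrib_left Nl by (simp add: add.commute [of "of_int (k * n)"] del: of_int_mult)
        moreover have "\<lfloor>of_int N * l x\<rfloor> = k * n"
          unfolding Nl by (rule floor_of_int)
        ultimately show ?thesis
          unfolding left(1) tensor_value_diff tensor_value_of by (simp add: distrib_right)
      qed
      with d show ?thesis by blast
    next
      case (right x y y')
      then show ?thesis
        unfolding right(1) tensor_value_diff tensor_value_of
        by (intro exI [of _ 1]) (simp add: distrib_left)
    qed
  qed
next
  case (diff s t)
  then obtain D E where "D > 0" "E > 0"
    and *: "\<And>N. D dvd N \<Longrightarrow> tensor_value l N s = 0" "\<And>N. E dvd N \<Longrightarrow> tensor_value l N t = 0"
    by blast
  have "tensor_value l N (s - t) = 0" if "D * E dvd N" for N
    using *(1) [OF dvd_mult_left [OF that]] *(2) [OF dvd_mult_right [OF that]]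
    by (simp add: tensor_value_diff)
  moreover have "D * E > 0"
    using \<open>D > 0\<close> \<open>E > 0\<close> by simp
  ultimately show ?case by blast
qed

instantiation tensor :: ("{division_ring, ring_char_0}", ring_char_0) ring_1
begin

definition one_tensor :: "('a, 'b) tensor"
  where "one_tensor = tens 1 1"

instance
proof
  fix a :: "('a, 'b) tensor"
  show "1 * a = a"
    unfolding one_tensor_def
  proof transfer
    fix u :: "('a \<times> 'b) \<Rightarrow>\<^sub>0 int"
    have "frag_mult (frag_of (1, 1)) u = u"
      by (induction u rule: frag_induct_of) (simp_all add: frag_mult_diff_right)
    then show "frag_mult (frag_of (1, 1)) u - u \<in> group_closure tensor_relations" by simp
  qed
  show "a * 1 = a"
    unfolding one_tensor_def
  proof transfer
    fix u :: "('a \<times> 'b) \<Rightarrow>\<^sub>0 int"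
    have "frag_mult u (frag_of (1, 1)) = u"
      by (induction u rule: frag_induct_of) (simp_all add: frag_mult_diff_left)
    then show "frag_mult u (frag_of (1, 1)) - u \<in> group_closure tensor_relations" by simp
  qed
  interpret Q: vector_space "(*) :: rat \<Rightarrow> rat \<Rightarrow> rat"
    by unfold_locales (simp_all add: algebra_simps)
  interpret P: vector_space_pair "scaleQ :: rat \<Rightarrow> 'a \<Rightarrow> 'a" "(*) :: rat \<Rightarrow> rat \<Rightarrow> rat"
    by unfold_locales
  have "rat_vs.independent {1 :: 'a}" by (simp add: rat_vs.dependent_single)
  from P.linear_independent_extend [OF this, of "\<lambda>_. 1"] obtain l :: "'a \<Rightarrow> rat"
    where "Vector_Spaces.linear scaleQ (*) l" and l1: "l 1 = 1"
    by auto
  then have l: "\<And>x y. l (x + y) = l x + l y"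
    by (simp add: Vector_Spaces.linear_iff)
  show "(0 :: ('a, 'b) tensor) \<noteq> 1"
  proof
    assume "(0 :: ('a, 'b) tensor) = 1"
    then have "abs_tensor (frag_of (1 :: 'a, 1 :: 'b)) = abs_tensor 0"
      unfolding one_tensor_def tens.abs_eq zero_tensor_def by (rule sym)
    then have "frag_of (1 :: 'a, 1 :: 'b) \<in> group_closure tensor_relations"
      unfolding tensor.abs_eq_iff diff_zero .
    then have "\<exists>D > 0. \<forall>N. D dvd N \<longrightarrow> tensor_value l N (frag_of (1 :: 'a, 1 :: 'b)) = 0"
      by (rule tensor_value_relation) (rule l)
    then obtain D :: int where D: "D > 0 \<and>
        (\<forall>N. D dvd N \<longrightarrow> tensor_value l N (frag_of (1 :: 'a, 1 :: 'b)) = 0)" ..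
    from D have "D > 0" ..
    from D have "tensor_value l D (frag_of (1 :: 'a, 1 :: 'b)) = 0"
      by simp
    with \<open>D > 0\<close> show False
      by (simp add: tensor_value_of l1)
  qed
qed

end

text \<open>For additive \<open>f\<close> this is \<open>f \<otimes> id\<close>; for other \<open>f\<close> the value is meaningless.\<close>

definition map_left ::
    "('a::ab_group_add \<Rightarrow> 'a) \<Rightarrow> ('a, 'b::ab_group_add) tensor \<Rightarrow> ('a, 'b) tensor"
  where "map_left f t = abs_tensor (frag_extend (\<lambda>(x, y). frag_of (f x, y)) (rep_tensor t))"

lemma map_left_abs:
  assumes f: "\<And>x y. f (x + y) = f x + f y"
  shows "map_left f (abs_tensor u) = abs_tensor (frag_extend (\<lambda>(x, y). frag_of (f x, y)) u)"
proof -
  let ?F = "frag_extend (\<lambda>(x, y). frag_of (f x, y))"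
  have "rep_tensor (abs_tensor u) - u \<in> group_closure tensor_relations"
    using rep_abs_rsp_left [OF Quotient3_tensor, of u u] by simp
  then have "?F (rep_tensor (abs_tensor u) - u) \<in> group_closure tensor_relations"
  proof (rule frag_extend_group_closure)
    fix s :: "('a \<times> 'b) \<Rightarrow>\<^sub>0 int"
    assume "s \<in> tensor_relations"
    then show "?F s \<in> group_closure tensor_relations"
      by cases (auto simp: frag_extend_diff f
          intro!: group_closure.base tensor_relations.left tensor_relations.right)
  qed
  then show ?thesis
    by (simp add: map_left_def tensor.abs_eq_iff frag_extend_diff)
qed

lemma map_left_add:
  assumes "\<And>x y. f (x + y) = f x + f y"
  shows "map_left f (s + t) = map_left f s + map_left f t"
proof -
  have "s = abs_tensor (rep_tensor s)" "t = abs_tensor (rep_tensor t)"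
    by (simp_all add: Quotient3_abs_rep [OF Quotient3_tensor])
  then obtain u v where "s = abs_tensor u" "t = abs_tensor v"
    by blast
  then show ?thesis
    by (simp add: map_left_abs [OF assms] plus_tensor.abs_eq frag_extend_add)
qed

lemma map_left_tens:
  assumes "\<And>x y. f (x + y) = f x + f y"
  shows "map_left f (tens x y) = tens (f x) y"
  by (simp add: tens.abs_eq map_left_abs [OF assms])


section \<open>Quaternion algebras\<close>

text \<open>\<open>H\<close> is the whole type \<open>'h\<close>; that it is a division algebra is the type class.\<close>

definition quaternion_basis :: "'h::{division_ring, ring_char_0} \<Rightarrow> 'h \<Rightarrow> bool"
  where "quaternion_basis i j \<longleftrightarrow>
    (\<exists>a b. a \<noteq> 0 \<and> b \<noteq> 0 \<and> i * i = of_Q a \<and> j * j = of_Q b) \<and> j * i = - (i * j) \<and>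
    distinct [1, i, j, i * j] \<and>
    rat_vs.independent {1, i, j, i * j} \<and> rat_vs.span {1, i, j, i * j} = UNIV"

text \<open>\<open>H\<close> is definite if \<open>H \<otimes>\<^bsub>\<rat>\<^esub> \<real>\<close> is a division algebra. As \<open>H\<close> and \<open>\<real>\<close> are
  \<open>\<rat>\<close>-vector spaces, \<open>H \<otimes>\<^bsub>\<rat>\<^esub> \<real> = H \<otimes>\<^bsub>\<int>\<^esub> \<real>\<close>.\<close>

definition definite_algebra :: "'h::{division_ring, ring_char_0} itself \<Rightarrow> bool"
  where "definite_algebra _ \<longleftrightarrow> (\<forall>t :: ('h, real) tensor. t \<noteq> 0 \<longrightarrow> (\<exists>s. t * s = 1 \<and> s * t = 1))"

text \<open>The main involution \<open>t + u i + v j + w i j \<mapsto> t - u i - v j - w i j\<close>.\<close>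

definition main_involution :: "'h::{division_ring, ring_char_0} \<Rightarrow> 'h \<Rightarrow> 'h \<Rightarrow> 'h"
  where "main_involution i j x = (let c = rat_vs.representation {1, i, j, i * j} x in
    of_Q (c 1) - scaleQ (c i) i - scaleQ (c j) j - scaleQ (c (i * j)) (i * j))"

lemma main_involution_add:
  assumes "quaternion_basis i j"
  shows "main_involution i j (x + y) = main_involution i j x + main_involution i j y"
  using assms
  by (simp add: quaternion_basis_def main_involution_def Let_def rat_vs.representation_add of_Q_add
      rat_vs.scale_left_distrib)

lemma main_involution_coords:
  fixes i j :: "'h::{division_ring, ring_char_0}"
  assumes "quaternion_basis i j"
  shows "main_involution i j (of_Q t + scaleQ u i + scaleQ v j + scaleQ w (i * j)) =
    of_Q t - scaleQ u i - scaleQ v j - scaleQ w (i * j)"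
proof -
  let ?B = "{1, i, j, i * j}"
  define R where "R = rat_vs.representation ?B"
  have B: "rat_vs.independent ?B" "rat_vs.span ?B = UNIV" and d: "distinct [1, i, j, i * j]"
    using assms by (simp_all add: quaternion_basis_def)
  have basis: "R b = (\<lambda>v. if v = b then 1 else 0)" if "b \<in> ?B" for b
    unfolding R_def using rat_vs.representation_basis [OF B(1) that] .
  have add: "R (x + y) = (\<lambda>b. R x b + R y b)" for x y
    unfolding R_def by (rule rat_vs.representation_add [OF B(1)]) (simp_all only: B(2) UNIV_I)
  have scale: "R (scaleQ q x) = (\<lambda>b. q * R x b)" for q x
    unfolding R_def by (rule rat_vs.representation_scale [OF B(1)]) (simp only: B(2) UNIV_I)
  have R: "R 1 = (\<lambda>v. if v = 1 then 1 else 0)" "R i = (\<lambda>v. if v = i then 1 else 0)"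
    "R j = (\<lambda>v. if v = j then 1 else 0)" "R (i * j) = (\<lambda>v. if v = i * j then 1 else 0)"
    by (rule basis, blast)+
  have "of_Q t = scaleQ t (1 :: 'h)" by (simp add: scaleQ_def)
  then have "R (of_Q t + scaleQ u i + scaleQ v j + scaleQ w (i * j)) =
     (\<lambda>b. t * (if b = 1 then 1 else 0) + u * (if b = i then 1 else 0)
        + v * (if b = j then 1 else 0) + w * (if b = i * j then 1 else 0))"
    by (simp only: add scale R)
  moreover have ne: "i \<noteq> 1" "j \<noteq> 1" "i * j \<noteq> 1" "j \<noteq> i" "i * j \<noteq> i" "i * j \<noteq> j"
    using d by auto
  ultimately show ?thesis
    unfolding main_involution_def Let_def R_def [symmetric]
    by (simp only: ne ne [symmetric] if_True if_False simp_thms mult_1_right mult_zero_right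
        add_0_left add_0_right)
qed

definition quaternion_order :: "'h::{division_ring, ring_char_0} set \<Rightarrow> bool"
  where "quaternion_order A \<longleftrightarrow>
    1 \<in> A \<and> (\<forall>x\<in>A. \<forall>y\<in>A. x * y \<in> A) \<and>
    (\<exists>S. finite S \<and> A = group_closure S) \<and> rat_vs.span A = UNIV"

definition maximal_order :: "'h::{division_ring, ring_char_0} set \<Rightarrow> bool"
  where "maximal_order A \<longleftrightarrow> quaternion_order A \<and> (\<forall>A'. quaternion_order A' \<longrightarrow> A \<subseteq> A' \<longrightarrow> A' = A)"


section \<open>Adelic points\<close>

text \<open>Write \<open>Z\<close> for the profinite integers. For an order \<open>A\<close> in \<open>H\<close>, the ring
  \<open>(A \<otimes> Z) \<otimes> \<rat>\<close> is \<open>(A \<otimes> \<rat>) \<otimes> Z = H \<otimes> Z\<close>, all tensor products being over \<open>\<int>\<close>. The subring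
  \<open>A \<otimes> Z\<close> is the image of \<open>A \<otimes> Z \<rightarrow> H \<otimes> Z\<close>, which is injective because the torsion-free
  group \<open>Z\<close> is flat.\<close>

type_synonym 'h hat = "('h, zhat) tensor"

definition hat_order :: "'h::ab_group_add set \<Rightarrow> 'h hat set"
  where "hat_order A = group_closure {tens x z | x z. x \<in> A}"

definition hat_conj :: "'h::{division_ring, ring_char_0} \<Rightarrow> 'h \<Rightarrow> 'h hat \<Rightarrow> 'h hat"
  where "hat_conj i j = map_left (main_involution i j)"

definition hat_vec :: "('h::{division_ring, ring_char_0}) ^ 'g \<Rightarrow> 'h hat ^ 'g"
  where "hat_vec v = (\<chi> k. tens (v $ k) 1)"


section \<open>Unitary similitudes\<close>

definition dagger :: "('b \<Rightarrow> 'b) \<Rightarrow> 'b ^ 'n ^ 'm \<Rightarrow> 'b ^ 'm ^ 'n"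
  where "dagger \<sigma> M = transpose (\<chi> k l. \<sigma> (M $ k $ l))"

definition fixed_ring :: "'b set \<Rightarrow> ('b \<Rightarrow> 'b) \<Rightarrow> 'b set"
  where "fixed_ring B \<sigma> = {x \<in> B. \<sigma> x = x}"

text \<open>The similitudes over a subring \<open>B\<close> of the ambient ring \<open>'b\<close>, stable under \<open>\<sigma>\<close>.\<close>

definition GU :: "'b::ring_1 set \<Rightarrow> ('b \<Rightarrow> 'b) \<Rightarrow> ('b ^ 'g ^ 'g) set"
  where "GU B \<sigma> = {M. (\<forall>k l. M $ k $ l \<in> B) \<and>
    (\<exists>\<mu> \<in> fixed_ring B \<sigma>. (\<exists>\<nu> \<in> fixed_ring B \<sigma>. \<mu> * \<nu> = 1 \<and> \<nu> * \<mu> = 1) \<and>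
      dagger \<sigma> M ** M = mat \<mu>)}"

definition GU_group :: "'b::ring_1 set \<Rightarrow> ('b \<Rightarrow> 'b) \<Rightarrow> ('b ^ 'g ^ 'g) monoid"
  where "GU_group B \<sigma> = \<lparr>carrier = GU B \<sigma>, mult = (**), one = mat 1\<rparr>"


section \<open>Principally polarized modules\<close>

definition right_submodule :: "'h::ring_1 set \<Rightarrow> ('h ^ 'g) set \<Rightarrow> bool"
  where "right_submodule A L \<longleftrightarrow>
    0 \<in> L \<and> (\<forall>v\<in>L. \<forall>w\<in>L. v + w \<in> L) \<and> (\<forall>v\<in>L. \<forall>a\<in>A. (\<chi> k. v $ k * a) \<in> L)"

definition right_linear_on :: "'h::ring_1 set \<Rightarrow> ('h ^ 'g) set \<Rightarrow> ('h ^ 'g \<Rightarrow> 'h) \<Rightarrow> bool"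
  where "right_linear_on A L f \<longleftrightarrow>
    (\<forall>v\<in>L. \<forall>w\<in>L. f (v + w) = f v + f w) \<and> (\<forall>v\<in>L. \<forall>a\<in>A. f (\<chi> k. v $ k * a) = f v * a)"

definition H0 :: "'h::{division_ring, ring_char_0} \<Rightarrow> 'h \<Rightarrow> 'h ^ 'g \<Rightarrow> 'h ^ 'g \<Rightarrow> 'h"
  where "H0 i j x y = (\<Sum>k\<in>UNIV. main_involution i j (x $ k) * y $ k)"

text \<open>Unimodularity of an \<open>A\<close>-valued form: the adjoint map \<open>L \<rightarrow> Hom\<^sub>A(L, A)\<close>, \<open>x \<mapsto> h(x, _)\<close>,
  is bijective.\<close>

definition unimodular_on :: "'h::ring_1 set \<Rightarrow> ('h ^ 'g) set \<Rightarrow> ('h ^ 'g \<Rightarrow> 'h ^ 'g \<Rightarrow> 'h) \<Rightarrow> bool"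
  where "unimodular_on A L h \<longleftrightarrow>
    (\<forall>f. right_linear_on A L f \<and> f ` L \<subseteq> A \<longrightarrow> (\<exists>!x. x \<in> L \<and> (\<forall>y\<in>L. f y = h x y)))"

definition principally_polarized ::
    "'h::{division_ring, ring_char_0} \<Rightarrow> 'h \<Rightarrow> 'h set \<Rightarrow> ('h ^ 'g) set \<Rightarrow> bool"
  where "principally_polarized i j A L \<longleftrightarrow>
    (\<exists>S. finite S \<and> L = right_submodule A hull S) \<and> rat_vec.span L = UNIV \<and>
    (\<exists>c::rat. c \<noteq> 0 \<and> (\<forall>x\<in>L. \<forall>y\<in>L. scaleQ c (H0 i j x y) \<in> A) \<and>
      unimodular_on A L (\<lambda>x y. scaleQ c (H0 i j x y)))"

definition gamma ::
    "'h::{division_ring, ring_char_0} set \<Rightarrow> 'h hat ^ 'g ^ 'g \<Rightarrow> ('h ^ 'g) set"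
  where "gamma A M = {v. \<exists>x. (\<forall>k. x $ k \<in> hat_order A) \<and> hat_vec v = M *v x}"

end

theory Submission
  imports Defs "HOL-Library.FuncSet" "HOL-Computational_Algebra.Primes"
begin

text \<open>If \<open>M\<close> is a similitude with multiplier \<open>\<mu>\<close>, then \<open>\<mu>\<close> is a rational times a unit of the profinite
  integers, and dividing \<open>H0\<close> by that rational makes \<open>gamma A M\<close> unimodular, because \<open>gamma A M\<close> is dense in
  the image of \<open>M\<close>. Density also shows that \<open>gamma A M\<close> determines \<open>M\<close> up to \<open>GU (hat_order A)\<close>.
  Conversely a polarized lattice has an orthonormal basis modulo every prime \<open>p\<close>: by maximality of the
  order, reduced trace and norm are onto modulo \<open>p\<close>, and a vector of unit length exists in the orthogonal
  complement of any orthonormal system with fewer than \<open>g\<close> members. Hensel's lemma and the Chinese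
  remainder theorem lift these bases to a compatible family modulo all \<open>n!\<close>, whose limit is the matrix \<open>M\<close>.\<close>

text \<open>A prime-by-prime argument would pass to completions of H and separate split from
  ramified primes. Here no completion is formed and no such distinction occurs: the whole arithmetic
  input at p is that A is strictly larger than Z + \<open>rad p\<close>, from which surjectivity of
  trace and norm modulo p is deduced. Maximality, as opposed to being an order, enters only through
  \<open>order_eqI\<close>, applied to rings of multipliers of an ideal or of a submodule. The
  moduli n! are used because they form a divisibility chain in which every positive integer occurs
  as a divisor. Two obstacles shape the adelic side. Elements of a tensor product have no evident
  normal form, so equalities are proved by showing that only 0 is divisible by every n within the
  integral adeles. And a similitude is given by the one-sided equation M^dagger M = \<mu>, so its
  right inverse has to come from a counting argument in finite quotients.\<close>

lemma of_Q_of_int [simp]: "of_Q (of_int n) = (of_int n :: 'a::{division_ring, ring_char_0})"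
  using of_Q_eq [of 1 "of_int n" n, where 'a = 'a] by simp

lemma of_Q_minus: "of_Q (- q) = - (of_Q q :: 'a::{division_ring, ring_char_0})"
  by (metis add.right_inverse add_eq_0_iff of_Q_0 of_Q_add)

lemma of_Q_eq_0_iff [simp]: "(of_Q q :: 'a::{division_ring, ring_char_0}) = 0 \<longleftrightarrow> q = 0"
proof
  assume "(of_Q q :: 'a) = 0"
  then have "(of_Q (q * inverse q) :: 'a) = 0"
    by (simp add: of_Q_mult)
  then show "q = 0"
    by (cases "q = 0") auto
qed simp

lemma of_Q_inject: "(of_Q p :: 'a::{division_ring, ring_char_0}) = of_Q q \<longleftrightarrow> p = q"
proof
  assume "(of_Q p :: 'a) = of_Q q"
  then have "(of_Q (p - q) :: 'a) = 0"
    using of_Q_add [of p "- q", where 'a = 'a] by (simp add: of_Q_minus)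
  then show "p = q"
    by simp
qed simp

lemma of_Q_eq_of_int_iff: "(of_Q p :: 'a::{division_ring, ring_char_0}) = of_int n \<longleftrightarrow> p = of_int n"
  by (metis of_Q_inject of_Q_of_int)

lemma of_Q_inverse_of_int: "of_Q (inverse (of_int n)) = inverse (of_int n :: 'a::{division_ring, ring_char_0})"
proof (cases "n = 0")
  case False
  then have "of_int n * of_Q (inverse (of_int n)) = (1 :: 'a)"
    by (metis of_Q_1 of_Q_mult of_Q_of_int of_int_eq_0_iff right_inverse)
  then show ?thesis
    by (metis inverse_unique)
qed simp

lemma inverse_of_int_mult:
  fixes x :: "'a::{division_ring, ring_char_0}"
  shows "n \<noteq> 0 \<Longrightarrow> of_int n * (inverse (of_int n) * x) = x" "n \<noteq> 0 \<Longrightarrow> inverse (of_int n) * (of_int n * x) = x"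
  by (simp_all flip: mult.assoc)

section \<open>Lattices\<close>

lemma group_closure_subset:
  assumes "S \<subseteq> L" "0 \<in> L" "\<And>x y. x \<in> L \<Longrightarrow> y \<in> L \<Longrightarrow> x - y \<in> L"
  shows "group_closure S \<subseteq> L"
proof
  fix x assume "x \<in> group_closure S"
  then show "x \<in> L" by induction (use assms in auto)
qed

lemma group_closure_sum_mem:
  "(\<And>a. a \<in> I \<Longrightarrow> f a \<in> group_closure S) \<Longrightarrow> sum f I \<in> group_closure S"
  by (induction I rule: infinite_finite_induct) (auto intro: group_closure_add)

context vector_space
begin

lemma subgroup_scale_of_int:
  assumes "0 \<in> L" "\<And>x y. x \<in> L \<Longrightarrow> y \<in> L \<Longrightarrow> x - y \<in> L" "x \<in> L"
  shows "scale (of_int n) x \<in> L"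
proof -
  have neg: "- y \<in> L" if "y \<in> L" for y
    using assms(2) [OF assms(1) that] by simp
  have add: "y + z \<in> L" if "y \<in> L" "z \<in> L" for y z
    using assms(2) [OF that(1) neg [OF that(2)]] by simp
  have nat: "scale (of_int (int m)) x \<in> L" for m
    by (induction m) (auto simp: scale_left_distrib assms add)
  show ?thesis
  proof (cases n rule: int_cases2)
    case (nonneg m)
    then show ?thesis using nat by simp
  next
    case (nonpos m)
    then show ?thesis using neg [OF nat [of m]] by simp
  qed
qed

lemma group_closure_scale_of_int: "x \<in> group_closure S \<Longrightarrow> scale (of_int n) x \<in> group_closure S"
  by (rule subgroup_scale_of_int) (auto intro: group_closure.diff)

lemma group_closure_insertE:
  assumes "x \<in> group_closure (insert s S)"
  obtains n y where "y \<in> group_closure S" "x = scale (of_int n) s + y"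
proof -
  have "\<exists>n. \<exists>y \<in> group_closure S. x = scale (of_int n) s + y"
    using assms
  proof induction
    case (base x)
    then consider "x = s" | "x \<in> insert 0 S" by auto
    then show ?case
    proof cases
      case 1
      then show ?thesis by (intro exI [of _ 1] bexI [of _ 0]) auto
    next
      case 2
      then show ?thesis
        by (intro exI [of _ 0] bexI [of _ x]) (auto intro: group_closure.base)
    qed
  next
    case (diff x x')
    then obtain n y n' y' where "y \<in> group_closure S" "x = scale (of_int n) s + y"
      "y' \<in> group_closure S" "x' = scale (of_int n') s + y'" by blast
    then show ?case
      by (intro exI [of _ "n - n'"] bexI [of _ "y - y'"])
        (auto simp: scale_left_diff_distrib intro: group_closure.diff)
  qed
  then show ?thesis using that by blast
qed

text \<open>Induction on the generators: dividing the coefficient of the new generator by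
  \<open>n\<close> with remainder leaves \<open>n\<close> possibilities for each old
  representative.\<close>

lemma group_closure_finite_index:
  assumes "finite S" "n > 0"
  shows "\<exists>F. finite F \<and> F \<subseteq> group_closure S \<and>
    (\<forall>x \<in> group_closure S. \<exists>f \<in> F. \<exists>y \<in> group_closure S. x = f + scale (of_int n) y)"
  using assms(1)
proof induction
  case empty
  then show ?case by (intro exI [of _ "{0}"]) simp
next
  case (insert s S)
  then obtain F where F: "finite F" "F \<subseteq> group_closure S"
    "\<And>x. x \<in> group_closure S \<Longrightarrow> \<exists>f \<in> F. \<exists>y \<in> group_closure S. x = f + scale (of_int n) y"
    by blast
  have mono: "x \<in> group_closure (insert s S)" if "x \<in> group_closure S" for x
    using that by induction (auto intro: group_closure.intros)
  have s: "scale (of_int k) s \<in> group_closure (insert s S)" for k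
    by (intro group_closure_scale_of_int group_closure.base) simp
  let ?F = "(\<lambda>(r, f). scale (of_int r) s + f) ` ({0..<n} \<times> F)"
  have "finite ?F" using F(1) by simp
  moreover have "?F \<subseteq> group_closure (insert s S)"
    using F(2) s mono by (auto intro!: group_closure_add)
  moreover have "\<exists>f \<in> ?F. \<exists>y \<in> group_closure (insert s S). x = f + scale (of_int n) y"
    if "x \<in> group_closure (insert s S)" for x
  proof -
    from that obtain k y where y: "y \<in> group_closure S" and x: "x = scale (of_int k) s + y"
      by (rule group_closure_insertE)
    from F(3) [OF y] obtain f z where f: "f \<in> F" and z: "z \<in> group_closure S"
      and yf: "y = f + scale (of_int n) z" by blast
    have "(of_int k :: 'a) = of_int (k mod n) + of_int n * of_int (k div n)"
      by (metis add.commute mult_div_mod_eq of_int_add of_int_mult)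
    then have "x = (scale (of_int (k mod n)) s + f) + scale (of_int n) (scale (of_int (k div n)) s + z)"
      by (simp add: x yf scale_left_distrib scale_right_distrib algebra_simps)
    moreover have "scale (of_int (k mod n)) s + f \<in> ?F"
      using f assms(2) by force
    moreover have "scale (of_int (k div n)) s + z \<in> group_closure (insert s S)"
      using s mono z by (intro group_closure_add)
    ultimately show ?thesis by (intro bexI)
  qed
  ultimately show ?case by (intro exI [of _ ?F] conjI ballI)
qed

text \<open>\<open>L\<close> lies between the group F generated by \<open>S\<close> and its multiple
  nF. It is generated by nF together with those coset representatives of F modulo nF that lie in
  \<open>L\<close>: if x = f + ny with x in \<open>L\<close>, then f is in \<open>L\<close>
  too.\<close>

lemma group_closure_sandwich:
  assumes "finite S" "n > 0" "0 \<in> L" and diff: "\<And>x y. x \<in> L \<Longrightarrow> y \<in> L \<Longrightarrow> x - y \<in> L"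
    and "L \<subseteq> group_closure S" and nL: "\<And>x. x \<in> S \<Longrightarrow> scale (of_int n) x \<in> L"
  shows "\<exists>T. finite T \<and> L = group_closure T"
proof -
  obtain F where F: "finite F" "F \<subseteq> group_closure S"
    "\<And>x. x \<in> group_closure S \<Longrightarrow> \<exists>f \<in> F. \<exists>y \<in> group_closure S. x = f + scale (of_int n) y"
    using group_closure_finite_index [OF assms(1,2)] by blast
  let ?T = "(F \<inter> L) \<union> scale (of_int n) ` S"
  have T: "scale (of_int n) y \<in> group_closure ?T" if "y \<in> group_closure S" for y
    using that
  proof induction
    case (base s)
    then show ?case by (auto intro: group_closure.base)
  next
    case (diff s t)
    then show ?case by (simp add: scale_right_diff_distrib group_closure.diff)
  qed
  have sub: "group_closure ?T \<subseteq> L"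
    by (rule group_closure_subset) (use assms nL in auto)
  moreover have "L \<subseteq> group_closure ?T"
  proof
    fix x assume x: "x \<in> L"
    then obtain f y where f: "f \<in> F" and y: "y \<in> group_closure S" and xf: "x = f + scale (of_int n) y"
      using F(3) assms(5) by blast
    have "scale (of_int n) y \<in> L"
      using T [OF y] sub by blast
    from diff [OF x this] have "f \<in> L"
      by (simp add: xf)
    then show "x \<in> group_closure ?T"
      unfolding xf using f T [OF y] by (intro group_closure_add) (auto intro: group_closure.base)
  qed
  moreover have "finite ?T" using F(1) assms(1) by simp
  ultimately show ?thesis by blast
qed

end

section \<open>The main involution\<close>

locale quaternion_algebra =
  fixes i j :: "'h::{division_ring, ring_char_0}"
  assumes basis: "quaternion_basis i j"
begin

abbreviation cj :: "'h \<Rightarrow> 'h" where "cj \<equiv> main_involution i j"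

lemmas cj_add = main_involution_add [OF basis]
lemmas cj_coords = main_involution_coords [OF basis]

lemma cj_0 [simp]: "cj 0 = 0"
  using cj_add [of 0 0] by simp

lemma cj_minus: "cj (- x) = - cj x"
  using cj_add [of x "- x"] by (simp add: minus_unique)

lemma cj_diff: "cj (x - y) = cj x - cj y"
  using cj_add [of x "- y"] by (simp add: cj_minus)

lemma cj_sum: "cj (sum f I) = (\<Sum>a\<in>I. cj (f a))"
  by (induction I rule: infinite_finite_induct) (simp_all add: cj_add)

lemma anticommute: "j * i = - (i * j)"
  using basis by (simp add: quaternion_basis_def)

lemma obtain_squares:
  obtains a b where "a \<noteq> 0" "b \<noteq> 0" "i * i = of_Q a" "j * j = of_Q b"
  using basis by (auto simp: quaternion_basis_def)

lemma i_neq_0: "i \<noteq> 0" and j_neq_0: "j \<noteq> 0"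
proof -
  obtain a b where "a \<noteq> 0" "b \<noteq> 0" "i * i = of_Q a" "j * j = of_Q b"
    by (rule obtain_squares)
  then show "i \<noteq> 0" "j \<noteq> 0" by auto
qed

lemma noncommutative: "i * j \<noteq> j * i"
proof
  assume "i * j = j * i"
  then have "of_int 2 * (i * j) = 0"
    by (metis anticommute add.right_inverse mult_2 of_int_numeral)
  then show False
    using i_neq_0 j_neq_0 by simp
qed

lemma coords:
  obtains t u v w where "x = of_Q t + scaleQ u i + scaleQ v j + scaleQ w (i * j)"
proof -
  have "x \<in> rat_vs.span {1, i, j, i * j}"
    using basis by (simp add: quaternion_basis_def)
  then obtain t u v w where "x - scaleQ t 1 - scaleQ u i - scaleQ v j - scaleQ w (i * j) = 0"
    by (auto simp: rat_vs.span_insert)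
  then have "x = of_Q t + scaleQ u i + scaleQ v j + scaleQ w (i * j)"
    by (simp add: scaleQ_def algebra_simps)
  then show ?thesis by (rule that)
qed

lemma cj_of_Q [simp]: "cj (of_Q q) = of_Q q"
  using cj_coords [of q 0 0 0] by (simp add: scaleQ_def)

lemma cj_of_int [simp]: "cj (of_int n) = of_int n"
  using cj_of_Q [of "of_int n"] by simp

lemma cj_1 [simp]: "cj 1 = 1"
  using cj_of_int [of 1] by simp

lemma cj_of_Q_mult: "cj (of_Q q * x) = of_Q q * cj x"
proof (rule coords [of x])
  fix t u v w
  assume x: "x = of_Q t + scaleQ u i + scaleQ v j + scaleQ w (i * j)"
  have "of_Q q * x = of_Q (q * t) + scaleQ (q * u) i + scaleQ (q * v) j + scaleQ (q * w) (i * j)"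
    by (simp add: x scaleQ_def algebra_simps of_Q_mult mult.assoc)
  then have "cj (of_Q q * x) = of_Q (q * t) - scaleQ (q * u) i - scaleQ (q * v) j - scaleQ (q * w) (i * j)"
    by (simp only: cj_coords)
  then show ?thesis
    unfolding x cj_coords by (simp add: scaleQ_def algebra_simps of_Q_mult mult.assoc)
qed

lemma cj_of_int_mult: "cj (of_int n * x) = of_int n * cj x"
  using cj_of_Q_mult [of "of_int n"] by simp

lemma cj_i: "cj i = - i" and cj_j: "cj j = - j" and cj_ij: "cj (i * j) = - (i * j)"
  using cj_coords [of 0 1 0 0] cj_coords [of 0 0 1 0] cj_coords [of 0 0 0 1]
  by (simp_all add: scaleQ_def)

lemma cj_cj [simp]: "cj (cj x) = x"
proof (rule coords [of x])
  fix t u v w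
  assume x: "x = of_Q t + scaleQ u i + scaleQ v j + scaleQ w (i * j)"
  show ?thesis
    unfolding x by (simp add: cj_add scaleQ_def cj_of_Q_mult cj_i cj_j cj_ij cj_minus cj_diff)
qed

text \<open>Reduces identities that are additive and rationally homogeneous to the four basis
  elements.\<close>

lemma basis_induct:
  assumes "\<And>x y. P x \<Longrightarrow> P y \<Longrightarrow> P (x + y)" "\<And>q x. P x \<Longrightarrow> P (of_Q q * x)"
    "P 1" "P i" "P j" "P (i * j)"
  shows "P x"
proof (rule coords [of x])
  fix t u v w
  assume x: "x = of_Q t + scaleQ u i + scaleQ v j + scaleQ w (i * j)"
  have "P (of_Q t)" using assms(2) [OF assms(3), of t] by simp
  then show ?thesis
    unfolding x scaleQ_def by (intro assms)
qed

text \<open>Left multiplication by \<open>i\<close> and by \<open>j\<close> is checked on the basis.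
  The case of \<open>i * j\<close> follows by applying these two rules in succession, and linearity
  in \<open>x\<close> does the rest.\<close>

lemma cj_mult: "cj (x * y) = cj y * cj x"
proof -
  obtain a b where ab: "i * i = of_Q a" "j * j = of_Q b"
    by (rule obtain_squares)
  have i: "cj (i * y) = cj y * cj i" for y
  proof (induction y rule: basis_induct)
    case (2 q y)
    have "i * (of_Q q * y) = of_Q q * (i * y)"
      by (metis mult.assoc of_Q_commute)
    then show ?case by (simp only: cj_of_Q_mult 2 mult.assoc)
  next
    case 6
    have "i * (i * j) = of_Q a * j"
      by (simp add: ab flip: mult.assoc)
    moreover have "i * j * i = - (i * (i * j))"
      by (simp add: anticommute mult.assoc)
    ultimately have "i * (i * j) = of_Q a * j" "i * j * i = - (of_Q a * j)"
      by simp_all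
    then show ?case by (simp add: cj_of_Q_mult cj_i cj_j cj_ij)
  qed (simp_all add: cj_add cj_i cj_j cj_ij anticommute ab distrib_left distrib_right)
  have j: "cj (j * y) = cj y * cj j" for y
  proof (induction y rule: basis_induct)
    case (2 q y)
    have "j * (of_Q q * y) = of_Q q * (j * y)"
      by (metis mult.assoc of_Q_commute)
    then show ?case by (simp only: cj_of_Q_mult 2 mult.assoc)
  next
    case 6
    have "i * j * j = of_Q b * i"
      by (simp add: mult.assoc ab) (simp add: of_Q_commute)
    moreover have "j * (i * j) = - (i * j * j)"
      by (simp add: anticommute flip: mult.assoc)
    ultimately show ?case by (simp add: cj_of_Q_mult cj_i cj_j cj_ij cj_minus)
  qed (simp_all add: cj_add cj_i cj_j cj_ij anticommute ab distrib_left distrib_right cj_minus)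
  show ?thesis
  proof (induction x rule: basis_induct)
    case (2 q x)
    have "cj y * (of_Q q * cj x) = of_Q q * (cj y * cj x)"
      by (metis mult.assoc of_Q_commute)
    then show ?case by (simp only: cj_of_Q_mult 2 mult.assoc)
  next
    case 6
    have "cj (i * j * y) = cj y * (cj j * cj i)"
      by (simp add: mult.assoc i j)
    also have "cj j * cj i = cj (i * j)"
      by (simp add: i)
    finally show ?case .
  qed (simp_all add: i j cj_add distrib_left distrib_right)
qed

lemma cj_eq_0_iff [simp]: "cj x = 0 \<longleftrightarrow> x = 0"
  by (metis cj_0 cj_cj)

lemma trace_rational: "\<exists>q. x + cj x = of_Q q"
proof (rule coords [of x])
  fix t u v w
  assume x: "x = of_Q t + scaleQ u i + scaleQ v j + scaleQ w (i * j)"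
  have "x + cj x = of_Q (t + t)"
    unfolding x cj_coords of_Q_add by simp
  then show ?thesis by blast
qed

lemma fixed_rational:
  assumes "cj x = x"
  shows "\<exists>q. x = of_Q q"
proof -
  obtain q where "x + x = of_Q q" using trace_rational [of x] assms by auto
  then have "of_int 2 * x = of_int 2 * of_Q (q / 2)"
    by (metis mult_2 of_Q_add of_int_numeral field_sum_of_halves)
  then show ?thesis by auto
qed

lemma norm_rational: "\<exists>q. x * cj x = of_Q q"
  by (rule fixed_rational) (simp add: cj_mult)

text \<open>\<open>cj x\<close> is a rational number minus \<open>x\<close>, hence commutes with
  \<open>x\<close>.\<close>

lemma norm_commute: "cj x * x = x * cj x"
proof -
  obtain q where "x + cj x = of_Q q" using trace_rational by blast
  then have "cj x = of_Q q - x" by (simp add: algebra_simps)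
  then show ?thesis by (simp add: left_diff_distrib right_diff_distrib of_Q_commute [of q x])
qed

text \<open>With \<open>cj x\<close> = q - x and \<open>cj y\<close> = r - y the left side expands
  to xy + yx - rx - qy + qr, which is symmetric in the two factors.\<close>

lemma trace_commute: "x * y + cj (x * y) = y * x + cj (y * x)"
proof -
  obtain q r where q: "x + cj x = of_Q q" and r: "y + cj y = of_Q r"
    using trace_rational by metis
  then have c: "cj x = of_Q q - x" "cj y = of_Q r - y" by (simp_all add: algebra_simps)
  show ?thesis
    unfolding cj_mult c
    by (simp add: left_diff_distrib right_diff_distrib of_Q_commute [of q y] of_Q_commute [of r x]
        of_Q_commute [of q "of_Q r"])
qed

end

section \<open>Integrality in a maximal order\<close>

lemma finite_rat_denominator:
  assumes "finite F"
  shows "\<exists>D::int. D > 0 \<and> (\<forall>q\<in>F. \<exists>n. of_int D * q = (of_int n :: rat))"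
  using assms
proof induction
  case empty
  then show ?case by (intro exI [of _ 1]) simp
next
  case (insert q F)
  then obtain D where D: "D > 0" "\<And>r. r \<in> F \<Longrightarrow> \<exists>n. of_int D * r = (of_int n :: rat)" by blast
  obtain a b where "quotient_of q = (a, b)" by (cases "quotient_of q")
  then have b: "b > 0" and q: "q = of_int a / of_int b"
    using quotient_of_denom_pos quotient_of_div by auto
  have "\<exists>n. of_int (D * b) * r = (of_int n :: rat)" if "r \<in> insert q F" for r
  proof (cases "r = q")
    case True
    then show ?thesis using b q by (intro exI [of _ "D * a"]) simp
  next
    case False
    with that have "r \<in> F" by simp
    then obtain n where "of_int D * r = (of_int n :: rat)" using D(2) by blast
    then show ?thesis by (intro exI [of _ "b * n"]) (simp add: mult_ac)
  qed
  moreover have "D * b > 0" using D(1) b by simp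
  ultimately show ?case by blast
qed

text \<open>Stands in for the integral closedness of Z: if the lowest denominator b were at least 2,
  its powers would all divide \<open>D\<close>, but already 2 to the power \<open>D\<close> exceeds
  \<open>D\<close>.\<close>

lemma rat_int_if_power_denominators_bounded:
  fixes q :: rat
  assumes "D > 0" "\<And>k. \<exists>n. of_int D * q ^ k = of_int n"
  shows "\<exists>n. q = of_int n"
proof -
  obtain a b where ab: "quotient_of q = (a, b)" by (cases "quotient_of q")
  then have b: "b > 0" and q: "q = of_int a / of_int b" and c: "coprime a b"
    using quotient_of_denom_pos quotient_of_div quotient_of_coprime by auto
  have dvd: "b ^ k dvd D" for k
  proof -
    obtain n where n: "of_int D * q ^ k = of_int n" using assms(2) by blast
    have "(of_int (D * a ^ k) :: rat) = of_int (n * b ^ k)"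
      using n b by (simp add: q power_divide field_simps)
    then have "D * a ^ k = n * b ^ k" by (simp only: of_int_eq_iff)
    then have "b ^ k dvd D * a ^ k" by simp
    moreover have "coprime (b ^ k) (a ^ k)" using c by (simp add: coprime_commute)
    ultimately show ?thesis by (simp add: coprime_dvd_mult_left_iff)
  qed
  have "b = 1"
  proof (rule ccontr)
    assume "b \<noteq> 1"
    then have "b \<ge> 2" using b by simp
    then have "b ^ nat D \<ge> 2 ^ nat D" by (intro power_mono) auto
    moreover have "(2::int) ^ nat D > D"
      using of_nat_less_two_power [of "nat D", where 'a = int] assms(1) by simp
    moreover have "b ^ nat D \<le> D" using dvd assms(1) by (rule zdvd_imp_le)
    ultimately show False by simp
  qed
  then show ?thesis using q by auto
qed

lemma int_eq_0_if_dvd_all: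
  fixes m p :: int
  assumes "p > 1" "\<And>n. p ^ n dvd m"
  shows "m = 0"
proof (rule ccontr)
  assume "m \<noteq> 0"
  then have "p ^ nat \<bar>m\<bar> \<le> \<bar>m\<bar>"
    using assms(2) [of "nat \<bar>m\<bar>"] by (intro zdvd_imp_le) auto
  moreover have "(2::int) ^ nat \<bar>m\<bar> \<le> p ^ nat \<bar>m\<bar>"
    using assms(1) by (intro power_mono) auto
  moreover have "\<bar>m\<bar> < (2::int) ^ nat \<bar>m\<bar>"
    using of_nat_less_two_power [of "nat \<bar>m\<bar>", where 'a = int] by simp
  ultimately show False by simp
qed

locale maximal_quaternion_order = quaternion_algebra i j
  for i j :: "'h::{division_ring, ring_char_0}" +
  fixes A :: "'h set"
  assumes maximal: "maximal_order A"
begin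

lemma A_order: "quaternion_order A"
  using maximal by (simp add: maximal_order_def)

lemma A_gens: obtains S where "finite S" "A = group_closure S"
  using A_order by (auto simp: quaternion_order_def)

lemma A_1 [simp]: "1 \<in> A" and A_mult: "x \<in> A \<Longrightarrow> y \<in> A \<Longrightarrow> x * y \<in> A"
  and A_span: "rat_vs.span A = UNIV"
  using A_order by (auto simp: quaternion_order_def)

lemma A_0 [simp]: "0 \<in> A" and A_diff: "x \<in> A \<Longrightarrow> y \<in> A \<Longrightarrow> x - y \<in> A"
  and A_add: "x \<in> A \<Longrightarrow> y \<in> A \<Longrightarrow> x + y \<in> A" and A_minus [simp]: "- x \<in> A \<longleftrightarrow> x \<in> A"
  by (rule A_gens, auto intro: group_closure.diff group_closure_add)+

lemma scaleQ_of_int: "scaleQ (of_int n) x = of_int n * (x :: 'h)"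
  by (simp add: scaleQ_def)

lemma A_of_int_mult: "x \<in> A \<Longrightarrow> of_int n * x \<in> A"
  using rat_vs.subgroup_scale_of_int [of A x n] by (simp add: A_diff scaleQ_of_int)

lemma A_of_int [simp]: "of_int n \<in> A"
  using A_of_int_mult [of 1 n] by simp

lemma A_power: "x \<in> A \<Longrightarrow> x ^ k \<in> A"
  by (induction k) (auto intro: A_mult)

lemma A_denominator: "\<exists>n>0. of_int n * x \<in> A"
proof -
  have "x \<in> rat_vs.span A" by (simp add: A_span)
  then show ?thesis
  proof (induction rule: rat_vs.span_induct_alt)
    case base
    show ?case by (intro exI [of _ 1]) simp
  next
    case (step c x y)
    then obtain n where n: "n > 0" "of_int n * y \<in> A" by blast
    obtain a b where "quotient_of c = (a, b)" by (cases "quotient_of c")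
    then have b: "b > 0" and c: "c = of_int a / of_int b"
      using quotient_of_denom_pos quotient_of_div by auto
    have "of_int b * of_Q c = (of_int a :: 'h)"
      using b c by (metis mult.commute nonzero_eq_divide_eq of_Q_mult of_Q_of_int of_int_eq_0_iff order_less_irrefl)
    then have "of_int b * (of_Q c * x) = of_int a * x"
      by (simp flip: mult.assoc)
    moreover have "of_int (n * b) * (scaleQ c x + y) = of_int n * (of_int b * (of_Q c * x)) + of_int b * (of_int n * y)"
      by (simp add: scaleQ_def distrib_left mult.assoc) (metis mult.assoc mult_of_int_commute)
    ultimately have "of_int (n * b) * (scaleQ c x + y) = of_int n * (of_int a * x) + of_int b * (of_int n * y)"
      by simp
    then have "of_int (n * b) * (scaleQ c x + y) \<in> A"
      using step(1) n(2) by (auto intro!: A_add A_of_int_mult simp del: of_int_mult)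
    then show ?case using n(1) b by (intro exI [of _ "n * b"]) simp
  qed
qed

text \<open>The form in which maximality is applied. A ring between A and (1/n)A is finitely
  generated by the sandwich argument, hence an order, hence not larger than A.\<close>

lemma order_eqI:
  assumes "A \<subseteq> R" and "\<And>x y. x \<in> R \<Longrightarrow> y \<in> R \<Longrightarrow> x * y \<in> R" and diff: "\<And>x y. x \<in> R \<Longrightarrow> y \<in> R \<Longrightarrow> x - y \<in> R"
    and n: "n > 0" "\<And>x. x \<in> R \<Longrightarrow> of_int n * x \<in> A"
  shows "R = A"
proof -
  obtain S where S: "finite S" "A = group_closure S" by (rule A_gens)
  let ?S = "(\<lambda>s. inverse (of_int n) * s) ` S"
  have im: "inverse (of_int n) * y \<in> group_closure ?S" if "y \<in> group_closure S" for y
    using that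
    by induction (auto simp: right_diff_distrib intro: group_closure.diff group_closure.base)
  have "R \<subseteq> group_closure ?S"
  proof
    fix x assume "x \<in> R"
    then have "inverse (of_int n) * (of_int n * x) \<in> group_closure ?S"
      using n(2) im S(2) by blast
    then show "x \<in> group_closure ?S"
      using n(1) by (simp add: inverse_of_int_mult)
  qed
  moreover have "scaleQ (of_int n) s \<in> R" if "s \<in> ?S" for s
  proof -
    from that obtain s' where "s' \<in> S" "s = inverse (of_int n) * s'" by blast
    moreover have "S \<subseteq> A" unfolding S(2) by (auto intro: group_closure.base)
    ultimately show ?thesis
      using assms(1) n(1) by (auto simp: scaleQ_of_int inverse_of_int_mult)
  qed
  ultimately have "\<exists>T. finite T \<and> R = group_closure T"
    using S(1) n(1) assms(1) diff A_0 by (intro rat_vs.group_closure_sandwich [of ?S n R]) auto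
  moreover have "rat_vs.span R = UNIV"
    using rat_vs.span_mono [OF assms(1)] A_span by auto
  ultimately have "quaternion_order R"
    using assms(1,2) A_1 by (auto simp: quaternion_order_def)
  then show ?thesis
    using maximal assms(1) by (simp add: maximal_order_def)
qed

text \<open>The pairing is biadditive with rational values, so a common denominator for finitely
  many pairs of generators serves all of A.\<close>

lemma pairing_denominator:
  "\<exists>D>0. \<forall>x\<in>A. \<forall>y\<in>A. \<exists>n. of_int D * (x * cj y + y * cj x) = of_int n"
proof -
  obtain S where S: "finite S" "A = group_closure S" by (rule A_gens)
  have "\<exists>q. x * cj y + y * cj x = of_Q q" for x y
    using trace_rational [of "x * cj y"] by (simp add: cj_mult)
  then obtain B where B: "\<And>x y. x * cj y + y * cj x = of_Q (B x y)" by metis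
  obtain D where D: "D > 0" "\<And>s t. s \<in> S \<Longrightarrow> t \<in> S \<Longrightarrow> \<exists>n. of_int D * B s t = (of_int n :: rat)"
    using finite_rat_denominator [of "(\<lambda>(s, t). B s t) ` (S \<times> S)"] S(1) by auto
  have *: "\<exists>n. of_int D * (s * cj t + t * cj s) = of_int n" if "s \<in> S" "t \<in> S" for s t
  proof -
    from D(2) [OF that] obtain n where "of_int D * B s t = (of_int n :: rat)" ..
    then have "(of_int D * of_Q (B s t) :: 'h) = of_int n"
      by (metis of_Q_mult of_Q_of_int)
    then show ?thesis using B by metis
  qed
  have "\<exists>n. of_int D * (x * cj y + y * cj x) = of_int n" if "x \<in> A" "y \<in> A" for x y
    using that(1) unfolding S(2)
  proof induction
    case (base x)
    then consider "x = 0" | "x \<in> S" by auto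
    then show ?case
    proof cases
      case 1
      then show ?thesis by (intro exI [of _ 0]) simp
    next
      case 2
      show ?thesis
        using that(2) unfolding S(2)
      proof induction
        case (base y)
        then consider "y = 0" | "y \<in> S" by auto
        then show ?case
          by cases (use *2 in \<open>auto intro: exI [of _ 0]\<close>)
      next
        case (diff y z)
        then obtain m n where "of_int D * (x * cj y + y * cj x) = of_int m"
          "of_int D * (x * cj z + z * cj x) = of_int n" by blast
        then show ?case
          by (intro exI [of _ "m - n"]) (simp add: cj_diff algebra_simps)
      qed
    qed
  next
    case (diff x z)
    then obtain m n where "of_int D * (x * cj y + y * cj x) = of_int m"
      "of_int D * (z * cj y + y * cj z) = of_int n" by blast
    then show ?case
      by (intro exI [of _ "m - n"]) (simp add: cj_diff algebra_simps)
  qed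
  then show ?thesis using D(1) by blast
qed

lemma norm_power: "x ^ k * cj (x ^ k) = (x * cj x) ^ k"
proof (induction k)
  case (Suc k)
  obtain q where q: "(x * cj x) ^ k = of_Q q"
    using norm_rational Suc by metis
  have "x ^ Suc k * cj (x ^ Suc k) = x * (x ^ k * cj (x ^ k)) * cj x"
    by (simp add: cj_mult mult.assoc)
  also have "\<dots> = x * cj x * (x * cj x) ^ k"
    unfolding Suc q by (metis mult.assoc of_Q_commute)
  finally show ?case by simp
qed simp

lemma of_Q_power: "(of_Q q :: 'h) ^ k = of_Q (q ^ k)"
  by (induction k) (simp_all add: of_Q_mult)

text \<open>All powers of \<open>x\<close> stay in A, and the pairing of a power with itself is
  twice a power of the norm. So the powers of the norm have bounded denominators.\<close>

lemma norm_integral: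
  assumes "x \<in> A"
  shows "\<exists>n. x * cj x = of_int n"
proof -
  obtain D where D: "D > 0" "\<And>x y. x \<in> A \<Longrightarrow> y \<in> A \<Longrightarrow> \<exists>n. of_int D * (x * cj y + y * cj x) = of_int n"
    using pairing_denominator by blast
  obtain q where q: "x * cj x = of_Q q" using norm_rational by blast
  have "\<exists>n. of_int (D * 2) * q ^ k = of_int n" for k
  proof -
    obtain n where "of_int D * (x ^ k * cj (x ^ k) + x ^ k * cj (x ^ k)) = of_int n"
      using D(2) [OF A_power A_power] assms by blast
    then have "of_Q (of_int (D * 2) * q ^ k) = (of_int n :: 'h)"
      unfolding norm_power q of_Q_power of_Q_mult of_Q_of_int by (simp add: mult.assoc mult_2)
    then show ?thesis unfolding of_Q_eq_of_int_iff by blast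
  qed
  then obtain n where "q = of_int n"
    using rat_int_if_power_denominators_bounded [of "D * 2" q] D(1) by auto
  then show ?thesis using q by auto
qed

text \<open>The trace is the mixed term in the norm of \<open>x + 1\<close>.\<close>

lemma trace_integral:
  assumes "x \<in> A"
  shows "\<exists>n. x + cj x = of_int n"
proof -
  obtain m n where "x * cj x = of_int m" "(x + 1) * cj (x + 1) = of_int n"
    using norm_integral [OF assms] norm_integral [OF A_add [OF assms A_1]] by blast
  then have "x + cj x = of_int (n - m - 1)"
    by (simp add: cj_add algebra_simps)
  then show ?thesis by blast
qed

text \<open>The reduced trace and norm. Outside \<open>A\<close> they need not be integers and the values are junk.\<close>

definition tr :: "'h \<Rightarrow> int" where "tr x = (THE n. of_int n = x + cj x)"

definition nm :: "'h \<Rightarrow> int" where "nm x = (THE n. of_int n = x * cj x)"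

lemma tr: "x \<in> A \<Longrightarrow> of_int (tr x) = x + cj x"
  using trace_integral [of x] by (auto simp: tr_def)

lemma nm: "x \<in> A \<Longrightarrow> of_int (nm x) = x * cj x"
  using norm_integral [of x] by (auto simp: nm_def)

lemma A_cj: "x \<in> A \<Longrightarrow> cj x \<in> A"
proof -
  assume x: "x \<in> A"
  then have "cj x = of_int (tr x) - x" by (simp add: tr)
  then show ?thesis using x by (simp add: A_diff)
qed

lemma of_int_h_eqD: "(of_int m :: 'h) = of_int n \<Longrightarrow> m = n"
  by simp

text \<open>Bounded denominators again, now from pairing the powers of \<open>q\<close> with 1. In
  other words, A meets the rationals in Z.\<close>

lemma rational_in_A: "of_Q q \<in> A \<Longrightarrow> \<exists>n. q = of_int n"
proof -
  assume q: "of_Q q \<in> A"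
  obtain D where D: "D > 0" "\<And>x y. x \<in> A \<Longrightarrow> y \<in> A \<Longrightarrow> \<exists>n. of_int D * (x * cj y + y * cj x) = of_int n"
    using pairing_denominator by blast
  have "\<exists>n. of_int (D * 2) * q ^ k = of_int n" for k
  proof -
    obtain n where "of_int D * (of_Q (q ^ k) * cj 1 + 1 * cj (of_Q (q ^ k))) = of_int n"
      using D(2) [OF A_power [OF q] A_1] of_Q_power by metis
    then have "of_Q (of_int (D * 2) * q ^ k) = (of_int n :: 'h)"
      unfolding of_Q_mult of_Q_of_int by (simp add: mult.assoc mult_2)
    then show ?thesis unfolding of_Q_eq_of_int_iff by blast
  qed
  then show ?thesis
    using rat_int_if_power_denominators_bounded [of "D * 2" q] D(1) by auto
qed

lemma fixed_in_A: "x \<in> A \<Longrightarrow> cj x = x \<Longrightarrow> \<exists>n. x = of_int n"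
  by (metis fixed_rational of_Q_of_int rational_in_A)

lemma tr_add: "x \<in> A \<Longrightarrow> y \<in> A \<Longrightarrow> tr (x + y) = tr x + tr y"
  by (rule of_int_h_eqD) (simp add: tr A_add cj_add)

lemma tr_of_int [simp]: "tr (of_int n) = 2 * n"
  by (rule of_int_h_eqD) (simp only: tr A_of_int cj_of_int mult_2 of_int_add)

lemma nm_of_int [simp]: "nm (of_int n) = n * n"
  by (rule of_int_h_eqD) (simp add: nm)

lemma nm_1 [simp]: "nm 1 = 1"
  using nm_of_int [of 1] by simp

lemma tr_of_int_mult: "x \<in> A \<Longrightarrow> tr (of_int n * x) = n * tr x"
  by (rule of_int_h_eqD) (simp add: tr A_of_int_mult cj_of_int_mult distrib_left)

lemma tr_minus: "x \<in> A \<Longrightarrow> tr (- x) = - tr x"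
  by (rule of_int_h_eqD) (simp add: tr cj_minus)

lemma tr_cj: "x \<in> A \<Longrightarrow> tr (cj x) = tr x"
  by (rule of_int_h_eqD) (simp add: tr A_cj)

lemma tr_commute: "x \<in> A \<Longrightarrow> y \<in> A \<Longrightarrow> tr (x * y) = tr (y * x)"
  by (rule of_int_h_eqD) (simp only: tr A_mult trace_commute)

lemma nm_mult: "x \<in> A \<Longrightarrow> y \<in> A \<Longrightarrow> nm (x * y) = nm x * nm y"
proof (rule of_int_h_eqD)
  assume xy: "x \<in> A" "y \<in> A"
  then have "of_int (nm (x * y)) = x * (y * cj y) * cj x"
    by (simp add: nm A_mult cj_mult mult.assoc)
  also have "\<dots> = x * of_int (nm y) * cj x"
    using xy by (simp add: nm)
  also have "\<dots> = x * cj x * of_int (nm y)"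
    by (metis mult.assoc mult_of_int_commute)
  finally show "of_int (nm (x * y)) = (of_int (nm x * nm y) :: 'h)"
    using xy by (simp add: nm)
qed

lemma nm_of_int_mult: "x \<in> A \<Longrightarrow> nm (of_int n * x) = n * n * nm x"
  by (simp add: nm_mult)

lemma nm_cj: "x \<in> A \<Longrightarrow> nm (cj x) = nm x"
  by (rule of_int_h_eqD) (simp add: nm A_cj norm_commute)

lemma nm_minus: "x \<in> A \<Longrightarrow> nm (- x) = nm x"
  by (rule of_int_h_eqD) (simp add: nm cj_minus)

lemma nm_add: "x \<in> A \<Longrightarrow> y \<in> A \<Longrightarrow> nm (x + y) = nm x + nm y + tr (x * cj y)"
  by (rule of_int_h_eqD) (simp add: nm tr A_add A_mult A_cj cj_add cj_mult algebra_simps)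

lemma nm_eq_0_iff: "x \<in> A \<Longrightarrow> nm x = 0 \<longleftrightarrow> x = 0"
  using nm [of x] by (metis cj_0 cj_eq_0_iff mult_eq_0_iff of_int_eq_0_iff)

text \<open>Cayley-Hamilton for quaternions; it makes squares of radical elements divisible by
  p.\<close>

lemma square_eq: "x \<in> A \<Longrightarrow> x * x = of_int (tr x) * x - of_int (nm x)"
  by (simp add: tr nm distrib_right norm_commute)

section \<open>Congruences modulo the two-sided ideals nA\<close>

definition multiples :: "int \<Rightarrow> 'h set" where "multiples n = (\<lambda>a. of_int n * a) ` A"

lemma multiples_0 [simp]: "0 \<in> multiples n"
  unfolding multiples_def by (rule image_eqI [of _ _ 0]) auto

lemma multiplesI: "a \<in> A \<Longrightarrow> of_int n * a \<in> multiples n"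
  unfolding multiples_def by (rule imageI)

lemma multiplesE: assumes "x \<in> multiples n" obtains a where "a \<in> A" "x = of_int n * a"
  using assms by (auto simp: multiples_def)

lemma multiples_add: "x \<in> multiples n \<Longrightarrow> y \<in> multiples n \<Longrightarrow> x + y \<in> multiples n"
  by (metis A_add distrib_left multiplesE multiplesI)

lemma multiples_diff: "x \<in> multiples n \<Longrightarrow> y \<in> multiples n \<Longrightarrow> x - y \<in> multiples n"
  by (metis A_diff right_diff_distrib multiplesE multiplesI)

lemma multiples_minus: "x \<in> multiples n \<Longrightarrow> - x \<in> multiples n"
  using multiples_diff [of 0 n x] by simp

lemma multiples_sum: "(\<And>k. k \<in> I \<Longrightarrow> f k \<in> multiples n) \<Longrightarrow> sum f I \<in> multiples n"
  by (induction I rule: infinite_finite_induct) (auto intro: multiples_add)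

lemma multiples_mult_right: "x \<in> multiples n \<Longrightarrow> y \<in> A \<Longrightarrow> x * y \<in> multiples n"
  by (metis A_mult mult.assoc multiplesE multiplesI)

lemma multiples_mult_left: "x \<in> multiples n \<Longrightarrow> y \<in> A \<Longrightarrow> y * x \<in> multiples n"
  by (metis A_mult mult.assoc multiplesE multiplesI mult_of_int_commute)

lemma multiples_subset: "x \<in> multiples n \<Longrightarrow> x \<in> A"
  by (auto simp: multiples_def intro: A_of_int_mult)

lemma multiples_cj: "x \<in> multiples n \<Longrightarrow> cj x \<in> multiples n"
  by (metis A_cj cj_of_int_mult multiplesE multiplesI)

lemma multiples_dvd: "m dvd n \<Longrightarrow> x \<in> multiples n \<Longrightarrow> x \<in> multiples m"
  by (elim dvdE multiplesE) (simp add: mult.assoc multiplesI A_of_int_mult)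

lemma of_int_multiples_iff: "of_int k \<in> multiples n \<longleftrightarrow> n dvd k"
proof
  assume "of_int k \<in> multiples n"
  then obtain a where a: "a \<in> A" "of_int k = of_int n * a" by (rule multiplesE)
  show "n dvd k"
  proof (cases "n = 0")
    case False
    then have "a = of_Q (of_int k / of_int n)"
      using a(2) False
      by (simp add: of_Q_eq [of n _ k] divide_inverse mult_of_int_commute [of n a] mult.assoc)
    then obtain l where "of_int k / of_int n = (of_int l :: rat)" using rational_in_A a(1) by blast
    then have "(of_int k :: rat) = of_int (n * l)" using False by (simp add: field_simps)
    then show ?thesis by (simp only: of_int_eq_iff) simp
  qed (use a in auto)
next
  assume "n dvd k"
  then show "of_int k \<in> multiples n"
    using multiplesI [of "of_int (k div n)" n] by (simp flip: of_int_mult)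
qed

text \<open>In x = umx + vnx, with um + vn = 1, the factor x of the first summand is written as a
  multiple of \<open>n\<close> and that of the second as a multiple of \<open>m\<close>.\<close>

lemma multiples_coprime:
  assumes "coprime m n" "x \<in> multiples m" "x \<in> multiples n"
  shows "x \<in> multiples (m * n)"
proof -
  obtain u v where uv: "u * m + v * n = 1" using assms(1) bezout_int [of m n] by auto
  obtain a where a: "a \<in> A" "x = of_int m * a" using assms(2) by (rule multiplesE)
  obtain b where b: "b \<in> A" "x = of_int n * b" using assms(3) by (rule multiplesE)
  have regroup: "of_int k * (of_int l * y) = of_int (k * l) * y" for k l and y :: 'h
    by (simp add: mult.assoc)
  have "x = of_int (u * m) * x + of_int (v * n) * x"
    by (metis distrib_right mult_1 of_int_1 of_int_add uv)
  also have "of_int (u * m) * x = of_int (m * n) * (of_int u * b)"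
    unfolding b(2) regroup by (simp only: ac_simps)
  also have "of_int (v * n) * x = of_int (m * n) * (of_int v * a)"
    unfolding a(2) regroup by (simp only: ac_simps)
  finally have "x = of_int (m * n) * (of_int u * b + of_int v * a)"
    by (simp add: distrib_left)
  then show ?thesis
    using a b by (metis A_add A_of_int_mult multiplesI)
qed

text \<open>The norm transports the question to Z: it is divisible by every power of
  \<open>p\<close>, hence 0, and in a division algebra only 0 has norm 0.\<close>

lemma eq_0_if_multiples:
  assumes "p > 1" "\<And>n. x \<in> multiples (p ^ n)"
  shows "x = 0"
proof -
  have x: "x \<in> A" using assms(2) multiples_subset by blast
  have "p ^ n dvd nm x" for n
  proof -
    obtain a where "a \<in> A" "x = of_int (p ^ n) * a" using assms(2) by (rule multiplesE)
    then show ?thesis using nm_of_int_mult [of a "p ^ n"] by simp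
  qed
  then have "nm x = 0" using assms(1) int_eq_0_if_dvd_all by blast
  then show ?thesis using nm_eq_0_iff x by blast
qed

lemma finite_quotient:
  assumes "n > 0"
  shows "\<exists>F. finite F \<and> F \<subseteq> A \<and> (\<forall>x\<in>A. \<exists>f\<in>F. x - f \<in> multiples n)"
proof -
  obtain S where S: "finite S" "A = group_closure S" by (rule A_gens)
  obtain F where F: "finite F" "F \<subseteq> A" "\<And>x. x \<in> A \<Longrightarrow> \<exists>f\<in>F. \<exists>y\<in>A. x = f + scaleQ (of_int n) y"
    using rat_vs.group_closure_finite_index [OF S(1) assms] unfolding S(2) by blast
  have "\<exists>f\<in>F. x - f \<in> multiples n" if "x \<in> A" for x
  proof -
    from F(3) [OF that] obtain f y where "f \<in> F" "y \<in> A" "x = f + of_int n * y"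
      unfolding scaleQ_of_int by blast
    then show ?thesis by (intro bexI [of _ f]) (simp_all add: multiplesI)
  qed
  then show ?thesis using F by blast
qed

end

section \<open>The order modulo a prime\<close>

text \<open>Pigeonhole: for s and t running through 0, ..., (p-1)/2 the residues of s^2 and those of
  u - t^2 v are (p+1)/2 each, so the two sets of residues meet.\<close>

lemma sum_two_squares_mod_prime:
  fixes p u v :: int
  assumes p: "prime p" "p \<noteq> 2" and v: "\<not> p dvd v"
  shows "\<exists>s t. p dvd s * s + t * t * v - u"
proof -
  have p2: "p > 2" using p prime_ge_2_int [of p] by simp
  then have odd: "odd p" using p prime_odd_int by blast
  define h where "h = (p - 1) div 2"
  have h: "p = 2 * h + 1" using odd by (auto simp: h_def elim!: oddE)
  have inj: "s = s'" if "s \<in> {0..h}" "s' \<in> {0..h}" "p dvd s * s - s' * s'" for s s'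
  proof -
    have "p dvd (s - s') * (s + s')" using that(3) by (simp add: algebra_simps)
    then consider "p dvd s - s'" | "p dvd s + s'" using p prime_dvd_mult_iff by blast
    then show ?thesis
    proof cases
      case 1
      then show ?thesis using that(1,2) h p2 dvd_imp_le_int [of "s - s'" p] unfolding atLeastAtMost_iff by arith
    next
      case 2
      then show ?thesis using that(1,2) h p2 zdvd_not_zless [of "s + s'" p] by fastforce
    qed
  qed
  define f where "f = (\<lambda>s. s * s mod p)"
  define g where "g = (\<lambda>s. (u - s * s * v) mod p)"
  have "inj_on f {0..h}"
    unfolding f_def by (rule inj_onI) (metis inj mod_eq_dvd_iff)
  then have cf: "card (f ` {0..h}) = nat (h + 1)" by (simp add: card_image)
  have "inj_on g {0..h}"
  proof (rule inj_onI)
    fix s s' assume s: "s \<in> {0..h}" "s' \<in> {0..h}" "g s = g s'"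
    then have "p dvd (u - s * s * v) - (u - s' * s' * v)"
      by (simp add: g_def mod_eq_dvd_iff)
    then have "p dvd (s' * s' - s * s) * v" by (simp add: algebra_simps)
    then have "p dvd s' * s' - s * s" using p v prime_dvd_mult_iff by blast
    then show "s = s'" using inj [of s' s] s by simp
  qed
  then have cg: "card (g ` {0..h}) = nat (h + 1)" by (simp add: card_image)
  have "f ` {0..h} \<inter> g ` {0..h} \<noteq> {}"
  proof
    assume "f ` {0..h} \<inter> g ` {0..h} = {}"
    then have "card (f ` {0..h} \<union> g ` {0..h}) = nat (h + 1) + nat (h + 1)"
      by (simp add: card_Un_disjoint cf cg)
    moreover have "f ` {0..h} \<union> g ` {0..h} \<subseteq> {0..<p}"
      using p2 by (auto simp: f_def g_def)
    then have "card (f ` {0..h} \<union> g ` {0..h}) \<le> nat p"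
      using card_mono [of "{0..<p}"] by simp
    ultimately show False using h p2 by linarith
  qed
  then obtain s t where "f s = g t" by blast
  then have "p dvd s * s - (u - t * t * v)"
    by (simp add: f_def g_def mod_eq_dvd_iff)
  then show ?thesis by (intro exI [of _ s] exI [of _ t]) (simp add: algebra_simps)
qed

context maximal_quaternion_order
begin

text \<open>For a prime \<open>p\<close> this is the Jacobson radical of \<open>A\<close> at \<open>p\<close>.\<close>

definition rad :: "int \<Rightarrow> 'h set"
  where "rad p = {a \<in> A. p dvd nm a \<and> (\<forall>b\<in>A. p dvd tr (a * b))}"

lemma radD: "a \<in> rad p \<Longrightarrow> a \<in> A" "a \<in> rad p \<Longrightarrow> p dvd nm a"
  "a \<in> rad p \<Longrightarrow> b \<in> A \<Longrightarrow> p dvd tr (a * b)"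
  by (auto simp: rad_def)

lemma rad_tr: "a \<in> rad p \<Longrightarrow> p dvd tr a"
  using radD(3) [of a p 1] by simp

lemma rad_minus: "a \<in> rad p \<Longrightarrow> - a \<in> rad p"
  by (auto simp: rad_def nm_minus tr_minus A_mult)

lemma rad_add: "a \<in> rad p \<Longrightarrow> b \<in> rad p \<Longrightarrow> a + b \<in> rad p"
  by (auto simp: rad_def nm_add A_add A_mult A_cj distrib_right tr_add)

lemma rad_diff: "a \<in> rad p \<Longrightarrow> b \<in> rad p \<Longrightarrow> a - b \<in> rad p"
  using rad_add [of a p "- b"] rad_minus by simp

lemma rad_mult_right: "a \<in> rad p \<Longrightarrow> c \<in> A \<Longrightarrow> a * c \<in> rad p"
  by (auto simp: rad_def nm_mult A_mult mult.assoc)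

lemma rad_mult_left: 
  assumes "a \<in> rad p" "c \<in> A" shows "c * a \<in> rad p"
proof -
  have "p dvd tr (c * a * b)" if "b \<in> A" for b
  proof -
    have "tr (c * a * b) = tr (a * (b * c))"
      using assms that tr_commute [of c "a * b"] by (simp add: radD A_mult mult.assoc)
    then show ?thesis using assms that by (simp add: radD A_mult)
  qed
  then show ?thesis using assms by (auto simp: rad_def nm_mult A_mult)
qed

lemma rad_cj: 
  assumes "a \<in> rad p" shows "cj a \<in> rad p"
proof -
  have "p dvd tr (cj a * b)" if "b \<in> A" for b
  proof -
    have "tr (cj a * b) = tr (cj b * a)"
      using tr_cj [of "cj a * b"] assms that by (simp add: cj_mult A_mult A_cj radD)
    also have "\<dots> = tr (a * cj b)"
      using assms that by (intro tr_commute) (simp_all add: A_cj radD)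
    finally show ?thesis using assms that by (simp add: radD A_cj)
  qed
  then show ?thesis using assms by (auto simp: rad_def nm_cj A_cj)
qed

lemma multiples_rad: "a \<in> multiples p \<Longrightarrow> a \<in> rad p"
  by (elim multiplesE) (simp add: rad_def A_of_int_mult nm_mult mult.assoc tr_of_int_mult A_mult)

lemma rad_square: "a \<in> rad p \<Longrightarrow> a * a \<in> multiples p"
proof -
  assume a: "a \<in> rad p"
  then have "of_int (tr a) \<in> multiples p" "of_int (nm a) \<in> multiples p"
    by (simp_all add: of_int_multiples_iff rad_tr radD)
  then show ?thesis
    using a by (simp add: square_eq radD multiples_diff multiples_mult_right)
qed

lemma one_notin_multiples: "p > 1 \<Longrightarrow> 1 \<notin> multiples p"
  using of_int_multiples_iff [of 1 p] by auto

text \<open>The radical is nil modulo \<open>p\<close>: along an infinite chain of products of its elements, two members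
  agree modulo \<open>p\<close>, so one is killed by the unit \<open>1 - v\<close> with \<open>v\<close> in the radical.\<close>

lemma rad_left_annihilated:
  assumes p: "p > 1"
  shows "\<exists>z\<in>A. z \<notin> multiples p \<and> (\<forall>y\<in>rad p. y * z \<in> multiples p)"
proof (rule ccontr)
  assume "\<not> ?thesis"
  then have "\<forall>z. \<exists>y. z \<in> A - multiples p \<longrightarrow> y \<in> rad p \<and> y * z \<notin> multiples p" by blast
  then obtain g where g: "\<And>z. z \<in> A \<Longrightarrow> z \<notin> multiples p \<Longrightarrow> g z \<in> rad p \<and> g z * z \<notin> multiples p"
    by (metis DiffI)
  define f where "f = rec_nat (1 :: 'h) (\<lambda>_ z. g z * z)"
  have f0: "f 0 = 1" and fS: "f (Suc n) = g (f n) * f n" for n by (simp_all add: f_def)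
  have f: "f n \<in> A \<and> f n \<notin> multiples p" for n
    by (induction n) (use f0 fS g one_notin_multiples [OF p] in \<open>auto intro: A_mult radD\<close>)
  have chain: "\<exists>v\<in>rad p. f (Suc (m + k)) = v * f m" for m k
  proof (induction k)
    case 0
    then show ?case using fS f g by auto
  next
    case (Suc k)
    then obtain v where "v \<in> rad p" "f (Suc (m + k)) = v * f m" by blast
    moreover have "g (f (Suc (m + k))) \<in> rad p" using f g by blast
    ultimately show ?case
      using fS [of "Suc (m + k)"]
      by (intro bexI [of _ "g (f (Suc (m + k))) * v"]) (auto simp: mult.assoc intro: rad_mult_right radD)
  qed
  obtain F where F: "finite F" "\<And>x. x \<in> A \<Longrightarrow> \<exists>c\<in>F. x - c \<in> multiples p"
    using finite_quotient [of p] p by auto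
  obtain r where r: "\<And>n. r n \<in> F" "\<And>n. f n - r n \<in> multiples p" 
  proof -
    have "\<exists>c\<in>F. f n - c \<in> multiples p" for n using F(2) f by blast
    then show ?thesis using that by metis
  qed
  have "\<not> inj r"
    using F(1) r(1) finite_subset [of "range r" F] infinite_UNIV_nat finite_imageD [of r UNIV] by blast
  then obtain m n where "m < n" "r m = r n" by (metis injI nat_neq_iff)
  then obtain k where n: "n = Suc (m + k)" using less_iff_Suc_add by auto
  obtain v where v: "v \<in> rad p" "f n = v * f m" using chain n by blast
  have "f m - f n \<in> multiples p"
    using multiples_diff [OF r(2) [of m] r(2) [of n]] \<open>r m = r n\<close> by simp
  \<comment> \<open>Modulo \<open>p\<close> the inverse of 1 - v is 1 + v, because
    \<open>v * v\<close> lies in \<open>multiples p\<close>.\<close>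
  then have "(1 + v) * (f m - v * f m) \<in> multiples p"
    using v by (intro multiples_mult_left) (auto intro: A_add radD)
  moreover have "v * v * f m \<in> multiples p"
    using v f by (intro multiples_mult_right rad_square) auto
  ultimately have "(1 + v) * (f m - v * f m) + v * v * f m \<in> multiples p"
    by (rule multiples_add)
  then have "f m \<in> multiples p" by (simp add: algebra_simps)
  then show False using f by blast
qed

text \<open>Conjugation preserves both the radical and \<open>multiples p\<close>, and exchanges
  left and right.\<close>

lemma rad_right_annihilated:
  assumes p: "p > 1"
  shows "\<exists>z\<in>A. z \<notin> multiples p \<and> (\<forall>y\<in>rad p. z * y \<in> multiples p)"
proof -
  obtain z where z: "z \<in> A" "z \<notin> multiples p" "\<And>y. y \<in> rad p \<Longrightarrow> y * z \<in> multiples p"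
    using rad_left_annihilated [OF p] by blast
  have "cj z * y \<in> multiples p" if "y \<in> rad p" for y
    using multiples_cj [OF z(3) [OF rad_cj [OF that]]] by (simp add: cj_mult)
  moreover have "cj z \<notin> multiples p" using z(2) multiples_cj [of "cj z"] by auto
  ultimately show ?thesis using A_cj z(1) by blast
qed

lemma divide_multiple: "p \<noteq> 0 \<Longrightarrow> inverse (of_int p) * x \<in> A \<longleftrightarrow> x \<in> multiples p"
  unfolding multiples_def
  by (metis imageE inverse_of_int_mult(1) inverse_of_int_mult(2) imageI of_int_eq_0_iff)

text \<open>If \<open>A = \<int> + rad p\<close>, then maximality makes the radical locally principal, generated by some \<open>u\<close>.
  As \<open>u * u\<close> is divisible by \<open>p\<close>, the order is spanned by \<open>1\<close> and \<open>u\<close> modulo every power of \<open>p\<close>,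
  hence is commutative.\<close>

lemma not_scalar_mod_rad:
  assumes p: "prime p"
  shows "\<exists>a\<in>A. \<forall>m. a - of_int m \<notin> rad p"
proof (rule ccontr)
  assume "\<not> ?thesis"
  then have scalar: "\<exists>m. a - of_int m \<in> rad p" if "a \<in> A" for a using that by blast
  have p1: "p > 1" using p prime_gt_1_int by blast
  obtain z where z: "z \<in> A" "z \<notin> multiples p" "\<And>y. y \<in> rad p \<Longrightarrow> y * z \<in> multiples p"
    using rad_left_annihilated [OF p1] by blast
  \<comment> \<open>An element just outside A that the radical still multiplies into A from the
    left.\<close>
  define x where "x = inverse (of_int p) * z"
  have x: "x \<notin> A" using z(2) p1 divide_multiple [of p z] by (simp add: x_def)
  have yx: "y * x \<in> A" if "y \<in> rad p" for y
  proof -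
    have "y * x = inverse (of_int p) * (y * z)"
      unfolding x_def by (metis mult.assoc of_int_commute_inverse)
    then show ?thesis using divide_multiple [of p "y * z"] z(3) [OF that] p1 by simp
  qed
  \<comment> \<open>The ring of right multipliers of the radical. By maximality it is A, so it
    misses \<open>x\<close>: some \<open>u\<close> in the radical has \<open>u * x\<close> in A but
    outside the radical.\<close>
  define R where "R = {y. \<forall>u\<in>rad p. u * y \<in> rad p}"
  have "R = A"
  proof (rule order_eqI)
    show "A \<subseteq> R" by (auto simp: R_def rad_mult_right)
    show "x * y \<in> R" if "x \<in> R" "y \<in> R" for x y
      using that by (auto simp: R_def simp flip: mult.assoc)
    show "x - y \<in> R" if "x \<in> R" "y \<in> R" for x y
      using that by (auto simp: R_def right_diff_distrib rad_diff)
    show "p > 0" using p1 by simp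
    show "of_int p * x \<in> A" if "x \<in> R" for x
    proof -
      have "of_int p \<in> rad p" using of_int_multiples_iff [of p p] by (intro multiples_rad) simp
      then show ?thesis using that radD(1) unfolding R_def by blast
    qed
  qed
  then obtain u where u: "u \<in> rad p" "u * x \<notin> rad p" using x by (auto simp: R_def)
  obtain m where m: "u * x - of_int m \<in> rad p" using scalar [OF yx [OF u(1)]] by blast
  \<comment> \<open>Modulo the radical \<open>u * x\<close> is the scalar \<open>m\<close>, which p
    does not divide since \<open>u * x\<close> is outside the radical. Hence \<open>e\<close> is
    congruent to \<open>m * m\<close> and is prime to p as well.\<close>
  define e where "e = nm (u * x)"
  have "\<not> p dvd m"
  proof
    assume "p dvd m"
    then have "of_int m \<in> rad p" by (intro multiples_rad) (simp add: of_int_multiples_iff)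
    from rad_add [OF m this] show False using u(2) by simp
  qed
  moreover have "p dvd e - m * m"
  proof -
    have "nm (of_int m + (u * x - of_int m)) = m * m + nm (u * x - of_int m) + tr (of_int m * cj (u * x - of_int m))"
      using m by (subst nm_add) (auto simp: radD)
    moreover have "p dvd tr (of_int m * cj (u * x - of_int m))"
      using rad_tr [OF rad_mult_left [OF rad_cj [OF m], of "of_int m"]] by simp
    ultimately show ?thesis using radD(2) [OF m] by (simp add: e_def)
  qed
  ultimately have e: "\<not> p dvd e" using p by (metis dvd_diff_right_iff prime_dvd_mult_iff dvd_diff_commute)
  then have e0: "e \<noteq> 0" by auto
  define w where "w = cj (u * x)"
  have wA: "w \<in> A" using A_cj [OF yx [OF u(1)]] by (simp add: w_def)
  have uxw: "u * x * w = of_int e" using nm [OF yx [OF u(1)]] by (simp add: e_def w_def)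
  \<comment> \<open>From \<open>u * x * w\<close> = e one multiplies by \<open>u\<close> on the
    right and cancels \<open>u\<close> on the left; this moves \<open>u\<close> to the right end of
    the product.\<close>
  have "u * (x * w * u - of_int e) = u * x * w * u - of_int e * u"
    by (simp add: right_diff_distrib mult.assoc mult_of_int_commute)
  then have "u * (x * w * u - of_int e) = 0" by (simp add: uxw)
  moreover have "u \<noteq> 0" using uxw e0 by auto
  ultimately have xwu: "x * w * u = of_int e" by simp
  \<comment> \<open>The radical is A \<open>u\<close> up to the factor \<open>e\<close>: for y in
    the radical, e y = (y x) w u, and \<open>y * x\<close> lies in A by the choice of
    \<open>x\<close>.\<close>
  have step1: "\<exists>s b. b \<in> A \<and> of_int e * a = of_int s + b * u" if a: "a \<in> A" for a
  proof -
    obtain s where s: "a - of_int s \<in> rad p" using scalar [OF a] by blast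
    have "of_int e * (a - of_int s) = (a - of_int s) * of_int e"
      by (simp add: mult_of_int_commute)
    also have "\<dots> = (a - of_int s) * (x * w * u)" by (simp add: xwu)
    also have "\<dots> = (a - of_int s) * x * w * u" by (simp add: mult.assoc)
    finally have "of_int e * a = of_int (e * s) + (a - of_int s) * x * w * u"
      by (simp add: right_diff_distrib algebra_simps)
    then show ?thesis using yx [OF s] wA A_mult by blast
  qed
  \<comment> \<open>Expanding the coefficient of \<open>u\<close> once more produces a term in
    \<open>u * u\<close>, which is divisible by \<open>p\<close>. The factor \<open>e * e\<close> is
    then removed by inverting it modulo \<open>p\<close>.\<close>
  have step2: "\<exists>s t b. b \<in> A \<and> a = of_int s + of_int t * u + of_int p * b" if a: "a \<in> A" for a
  proof -
    obtain s b where b: "b \<in> A" "of_int e * a = of_int s + b * u" using step1 [OF a] by blast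
    obtain t c where c: "c \<in> A" "of_int e * b = of_int t + c * u" using step1 [OF b(1)] by blast
    have "of_int (e * e) * a = of_int e * (of_int s + b * u)" by (simp add: mult.assoc b(2))
    also have "\<dots> = of_int (e * s) + (of_int e * b) * u" by (simp add: distrib_left mult.assoc)
    also have "\<dots> = of_int (e * s) + of_int t * u + c * (u * u)"
      unfolding c(2) by (simp add: distrib_right mult.assoc)
    finally have ee: "of_int (e * e) * a = of_int (e * s) + of_int t * u + c * (u * u)" .
    obtain d where d: "d \<in> A" "c * (u * u) = of_int p * d"
      using multiples_mult_left [OF rad_square [OF u(1)] c(1)] by (rule multiplesE)
    have "coprime (e * e) p" using e p by (metis coprime_commute coprime_mult_right_iff prime_imp_coprime)
    then obtain k l where kl: "k * (e * e) + l * p = 1" using bezout_int [of "e * e" p] by auto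
    have "a = of_int (k * (e * e) + l * p) * a" by (simp only: kl) simp
    also have "\<dots> = of_int k * (of_int (e * e) * a) + of_int l * (of_int p * a)"
      by (simp add: distrib_right mult.assoc)
    also have "\<dots> = of_int (k * (e * s)) + of_int (k * t) * u + (of_int k * (of_int p * d) + of_int l * (of_int p * a))"
      unfolding ee d(2) by (simp add: distrib_left mult.assoc)
    also have "of_int k * (of_int p * d) + of_int l * (of_int p * a) = of_int p * (of_int k * d + of_int l * a)"
      by (simp add: distrib_left flip: mult.assoc of_int_mult) (simp only: mult.commute)
    finally show ?thesis using d(1) a A_add A_of_int_mult by blast
  qed
  have step3: "\<exists>s t b. b \<in> A \<and> a = of_int s + of_int t * u + of_int (p ^ n) * b" if "a \<in> A" for a n
    using that
  proof (induction n arbitrary: a)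
    case 0
    then show ?case by (intro exI [of _ 0] exI [of _ a]) simp
  next
    case (Suc n)
    then obtain s t b where b: "b \<in> A" "a = of_int s + of_int t * u + of_int (p ^ n) * b" by blast
    obtain s' t' b' where b': "b' \<in> A" "b = of_int s' + of_int t' * u + of_int p * b'"
      using step2 [OF b(1)] by blast
    have "a = of_int (s + p ^ n * s') + of_int (t + p ^ n * t') * u + of_int (p ^ n * p) * b'"
      unfolding b(2) b'(2) by (simp add: distrib_left distrib_right mult.assoc)
    then show ?case using b'(1) by (metis mult.commute power_Suc)
  qed
  \<comment> \<open>Modulo each power of \<open>p\<close> both elements are integral polynomials in
    \<open>u\<close>, so their commutator lies in all \<open>multiples (p ^ n)\<close>.\<close>
  have comm: "a * b = b * a" if "a \<in> A" "b \<in> A" for a b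
  proof -
    have "a * b - b * a \<in> multiples (p ^ n)" for n
    proof -
      obtain s t c where c: "c \<in> A" "a = of_int s + of_int t * u + of_int (p ^ n) * c"
        using step3 \<open>a \<in> A\<close> by blast
      obtain s' t' d where d: "d \<in> A" "b = of_int s' + of_int t' * u + of_int (p ^ n) * d"
        using step3 \<open>b \<in> A\<close> by blast
      define \<alpha> \<beta> where ab: "\<alpha> = of_int s + of_int t * u" "\<beta> = of_int s' + of_int t' * u"
      have "u * of_int s = of_int s * u" by (rule mult_of_int_commute [symmetric])
      moreover have "u * (of_int t * u) = of_int t * u * u"
        unfolding mult.assoc [symmetric] using mult_of_int_commute [of t u] by simp
      ultimately have "\<alpha> * u = u * \<alpha>"
        by (simp add: ab distrib_left distrib_right)
      then have "\<alpha> * (of_int t' * u) = of_int t' * u * \<alpha>"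
        by (metis mult.assoc mult_of_int_commute)
      moreover have "\<alpha> * of_int s' = of_int s' * \<alpha>" by (rule mult_of_int_commute [symmetric])
      ultimately have "\<alpha> * \<beta> = \<beta> * \<alpha>"
        by (simp add: ab(2) distrib_left distrib_right)
      then have eq: "a * b - b * a = of_int (p ^ n) * c * b - b * (of_int (p ^ n) * c)
          + (\<alpha> * (of_int (p ^ n) * d) - of_int (p ^ n) * d * \<alpha>)"
        unfolding c(2) d(2) ab [symmetric] by (simp add: algebra_simps)
      have "\<alpha> \<in> A" using radD(1) [OF u(1)] unfolding ab by (intro A_add A_of_int_mult A_of_int)
      then show ?thesis
        unfolding eq using c(1) d(1) that
        by (intro multiples_add multiples_diff multiples_mult_right multiples_mult_left multiplesI)
    qed
    then show ?thesis using eq_0_if_multiples [OF p1, of "a * b - b * a"] by simp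
  qed
  obtain k l where kl: "k > 0" "of_int k * i \<in> A" "l > 0" "of_int l * j \<in> A"
    using A_denominator by metis
  have mv: "of_int k * v * (of_int l * w) = of_int (k * l) * (v * w)" for k l and v w :: 'h
    by (metis mult.assoc mult_of_int_commute of_int_mult)
  have "of_int (k * l) * (i * j) = of_int (k * l) * (j * i)"
    using comm [OF kl(2,4)] unfolding mv by (simp only: mult.commute)
  then have "i * j = j * i" using kl by (simp del: of_int_mult)
  then show False using noncommutative by simp
qed

lemma nm_add_of_int: "a \<in> A \<Longrightarrow> nm (a + of_int k) = nm a + k * k + k * tr a"
proof -
  assume a: "a \<in> A"
  have "a * cj (of_int k) = of_int k * a" by (simp add: mult_of_int_commute)
  then show ?thesis using a by (simp add: nm_add tr_of_int_mult)
qed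

section \<open>Reduced trace and norm are onto modulo p\<close>

lemma trace_surjective_mod:
  assumes p: "prime p"
  shows "\<exists>t\<in>A. p dvd tr t - 1"
proof (cases "p = 2")
  case True
  obtain a where a: "a \<in> A" "\<And>m. a - of_int m \<notin> rad 2"
    using not_scalar_mod_rad [OF p] True by blast
  show ?thesis
  proof (rule ccontr)
    assume "\<not> ?thesis"
    then have ev: "2 dvd tr t" if "t \<in> A" for t using that True by auto
    have "a - of_int (nm a) \<in> rad 2"
    proof -
      have "nm (a + of_int (- nm a)) = nm a + nm a * nm a + (- nm a) * tr a"
        using a(1) by (subst nm_add_of_int) auto
      moreover have "2 dvd nm a + nm a * nm a" by simp
      moreover have "2 dvd (- nm a) * tr a" using ev [OF a(1)] by simp
      ultimately have "2 dvd nm (a - of_int (nm a))" by simp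
      then show ?thesis using a(1) by (auto simp: rad_def intro!: A_diff ev A_mult)
    qed
    then show False using a(2) by blast
  qed
next
  case False
  then have "odd p" using p prime_odd_int prime_ge_2_int [of p] by fastforce
  then obtain k where "p = 2 * k + 1" by (elim oddE)
  then show ?thesis by (intro bexI [of _ "of_int (k + 1)"]) (auto simp: add.commute simp del: of_int_add)
qed

text \<open>For odd p, a trace-zero \<open>x\<close> with norm prime to p suffices: the norm of s +
  tx is s^2 + t^2 \<open>nm x\<close>, which represents every residue. If no such \<open>x\<close>
  existed, all trace-zero elements obtained from A would fall into the radical, and A would be Z +
  \<open>rad p\<close>.\<close>

lemma norm_surjective_mod:
  assumes p: "prime p" and u: "\<not> p dvd u"
  shows "\<exists>a\<in>A. p dvd nm a - u"
proof (cases "p = 2")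
  case True
  then show ?thesis using u by (intro bexI [of _ 1]) auto
next
  case False
  then have "odd p" using p prime_odd_int prime_ge_2_int [of p] by fastforce
  then obtain h where h: "p = 2 * h + 1" by (elim oddE)
  obtain a where a: "a \<in> A" "\<And>m. a - of_int m \<notin> rad p"
    using not_scalar_mod_rad [OF p] by blast
  \<comment> \<open>This is x - \<open>cj x\<close>, twice the trace-zero part; the factor 2 keeps
    it in A.\<close>
  define pure where "pure = (\<lambda>x :: 'h. of_int 2 * x - of_int (tr x))"
  have pureA: "pure x \<in> A" if "x \<in> A" for x
    using that unfolding pure_def by (intro A_diff A_of_int_mult A_of_int)
  have tr_pure: "tr (pure x) = 0" if "x \<in> A" for x
    using tr_add [of "of_int 2 * x" "of_int (- tr x)"] that
    by (simp add: pure_def tr_of_int_mult A_of_int_mult del: of_int_minus of_int_numeral)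
      (simp add: pure_def)
  have ncj: "cj x = - x" if "x \<in> A" "tr x = 0" for x
    using tr [OF that(1)] that(2) by (simp add: eq_neg_iff_add_eq_0 add.commute)
  have "\<exists>x\<in>A. tr x = 0 \<and> \<not> p dvd nm x"
  proof (rule ccontr)
    assume "\<not> ?thesis"
    then have nm0: "p dvd nm x" if "x \<in> A" "tr x = 0" for x using that by blast
    \<comment> \<open>Polarization: on trace-zero elements conjugation is negation, so the mixed
      term of the norm is minus the trace of the product.\<close>
    have tr0: "p dvd tr (x * y)" if "x \<in> A" "tr x = 0" "y \<in> A" "tr y = 0" for x y
    proof -
      have "nm (x + y) = nm x + nm y - tr (x * y)"
        using that by (simp add: nm_add ncj tr_minus A_mult)
      moreover have "p dvd nm (x + y)" "p dvd nm x" "p dvd nm y"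
        using that by (auto intro!: nm0 simp: A_add tr_add)
      ultimately show ?thesis by (metis dvd_add dvd_diff diff_diff_eq2 add_diff_cancel_left')
    qed
    have "pure a \<in> rad p"
    proof -
      have "p dvd tr (pure a * b)" if b: "b \<in> A" for b
      proof -
        have "pure a * pure b = of_int 2 * (pure a * b) - of_int (tr b) * pure a"
        proof -
          have "pure b = of_int 2 * b - of_int (tr b)" by (simp add: pure_def)
          moreover have "pure a * (of_int 2 * b) = of_int 2 * (pure a * b)"
            by (metis mult.assoc mult_of_int_commute)
          moreover have "pure a * of_int (tr b) = of_int (tr b) * pure a"
            by (rule mult_of_int_commute [symmetric])
          ultimately show ?thesis by (simp only: right_diff_distrib)
        qed
        then have "of_int 2 * (pure a * b) = pure a * pure b + of_int (tr b) * pure a" by simp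
        then have "2 * tr (pure a * b) = tr (pure a * pure b)"
          using a(1) b by (metis tr_of_int_mult tr_add tr_pure pureA A_mult A_of_int_mult mult_zero_right add_0_right)
        moreover have "p dvd tr (pure a * pure b)" using a(1) b by (intro tr0 pureA tr_pure)
        ultimately have "p dvd 2 * tr (pure a * b)" by simp
        moreover have "\<not> p dvd 2" using False prime_ge_2_int [OF p] by (intro zdvd_not_zless) auto
        ultimately show ?thesis using p prime_dvd_mult_iff by blast
      qed
      then show ?thesis using a(1) by (auto simp: rad_def pureA tr_pure nm0)
    qed
    \<comment> \<open>\<open>h + 1\<close> inverts 2 modulo p, as 2(h + 1) = p + 1; this recovers
      \<open>a\<close> up to a scalar and an element of \<open>multiples p\<close>.\<close>
    then have "of_int (h + 1) * pure a \<in> rad p" by (intro rad_mult_left A_of_int)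
    moreover have "of_int (h + 1) * pure a = of_int p * a + (a - of_int ((h + 1) * tr a))"
      by (simp add: pure_def h algebra_simps) (simp only: mult_2)
    moreover have "of_int p * a \<in> rad p" using a(1) by (intro multiples_rad multiplesI)
    ultimately have "a - of_int ((h + 1) * tr a) \<in> rad p"
      using rad_diff by (metis add_diff_cancel_left')
    then show False using a(2) by blast
  qed
  then obtain x where x: "x \<in> A" "tr x = 0" "\<not> p dvd nm x" by blast
  obtain s t where st: "p dvd s * s + t * t * nm x - u"
    using sum_two_squares_mod_prime [OF p False x(3)] by blast
  have "tr (of_int s * cj (of_int t * x)) = 0"
    using x by (simp add: ncj cj_of_int_mult tr_of_int_mult A_of_int_mult tr_minus)
  then have "nm (of_int s + of_int t * x) = s * s + t * t * nm x"
    using x by (simp add: nm_add A_of_int_mult nm_of_int_mult)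
  then show ?thesis
    using st x(1) by (intro bexI [of _ "of_int s + of_int t * x"]) (auto intro: A_add A_of_int_mult)
qed

end

section \<open>Divisibility and limits in the profinite integers\<close>

lemma residue_props: "residue z 0 = 0" "0 < n \<Longrightarrow> m dvd n \<Longrightarrow> residue z n mod int m = residue z m"
  using residue [of z] by auto

lemma zhat_eqI:
  assumes "\<And>n. n > 0 \<Longrightarrow> residue x n = residue y n" shows "x = y"
proof -
  have "residue x n = residue y n" for n
    using assms by (cases "n = 0") (simp_all add: residue_props(1))
  then show ?thesis by (simp add: residue_inject [symmetric] fun_eq_iff)
qed

lemma residue_of_int: "0 < n \<Longrightarrow> residue (of_int k) n = k mod int n"
  by (cases k rule: int_cases2) (simp_all add: residue_of_nat uminus_zhat.rep_eq mod_minus_eq)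

lemma residue_diff: "0 < n \<Longrightarrow> residue (x - y) n = (residue x n - residue y n) mod int n"
  unfolding minus_zhat_def plus_zhat.rep_eq uminus_zhat.rep_eq mod_add_right_eq by simp

text \<open>The residue of the quotient modulo m is the residue of \<open>z\<close> modulo nm,
  divided by \<open>n\<close>.\<close>

lemma zhat_divide:
  assumes "n > 0" "residue z n = 0"
  shows "\<exists>y. z = of_nat n * y"
proof -
  define f where "f = (\<lambda>m. residue z (n * m) div int n)"
  have dvd: "residue z (n * m) = int n * f m" if "m > 0" for m
  proof -
    have "residue z (n * m) mod int n = 0"
      using residue_props(2) [of "n * m" n z] assms that by simp
    then show ?thesis by (auto simp: f_def)
  qed
  have "f m mod int k = f k" if "0 < m" "k dvd m" for m k
  proof -
    have k: "k > 0" using that by (auto intro: Nat.gr0I)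
    have "int n * (f m mod int k) = residue z (n * m) mod int (n * k)"
      by (simp only: dvd [OF that(1)] of_nat_mult mult_mod_right)
    also have "\<dots> = residue z (n * k)"
      using that assms(1) by (intro residue_props(2)) auto
    finally show ?thesis using assms(1) k by (simp add: dvd)
  qed
  moreover have "f 0 = 0" by (simp add: f_def residue_props)
  ultimately have f: "residue (Abs_zhat f) = f" by (intro Abs_zhat_inverse) simp
  have "z = of_nat n * Abs_zhat f"
  proof (rule zhat_eqI)
    fix m :: nat assume m: "m > 0"
    have "residue (of_nat n * Abs_zhat f) m = (int n * f m) mod int m"
      using m by (simp add: times_zhat.rep_eq f residue_of_nat mod_mult_left_eq)
    also have "\<dots> = residue z m"
      using residue_props(2) [of "n * m" m z] m assms(1) by (simp add: dvd)
    finally show "residue z m = residue (of_nat n * Abs_zhat f) m" by simp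
  qed
  then show ?thesis by blast
qed

lemma zhat_approx:
  assumes "n > 0"
  shows "\<exists>r y. z = of_int r + of_int n * (y :: zhat)"
proof -
  have n: "n = int (nat n)" "nat n > 0" using assms by simp_all
  let ?r = "residue z (nat n)"
  have "residue (z - of_int ?r) (nat n) = 0"
    using n by (simp add: residue_diff residue_of_int mod_diff_right_eq)
  then obtain y where "z - of_int ?r = of_nat (nat n) * y"
    using zhat_divide n(2) by blast
  moreover have "of_nat (nat n) = (of_int n :: zhat)" using assms by (simp add: of_nat_nat)
  ultimately show ?thesis
    by (intro exI [of _ ?r] exI [of _ y]) (simp add: algebra_simps)
qed

text \<open>The residue modulo m is read off from the vanishing of the product modulo km, where k is
  the absolute value of \<open>n\<close>.\<close>

lemma zhat_torsion_free:
  fixes z :: zhat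
  assumes "n \<noteq> 0" "of_int n * z = 0"
  shows "z = 0"
proof (rule zhat_eqI)
  fix m :: nat assume m: "m > 0"
  define k where "k = nat \<bar>n\<bar>"
  have k: "k > 0" "int k = \<bar>n\<bar>" using assms(1) by (simp_all add: k_def)
  have "of_nat k * z = 0"
    using assms(2) by (cases "n > 0") (auto simp: k_def of_nat_nat abs_if)
  then have "residue (of_nat k * z) (k * m) = 0" by (simp add: zero_zhat.rep_eq)
  then have "(int k * residue z (k * m)) mod int (k * m) = 0"
    using k m by (simp add: times_zhat.rep_eq residue_of_nat mod_mult_left_eq)
  then have "residue z (k * m) mod int m = 0"
    using k assms(1) by (simp add: mult_mod_right [symmetric])
  then show "residue z m = residue 0 m"
    using residue_props(2) [of "k * m" m z] k m by (simp add: zero_zhat.rep_eq)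
qed

lemma zhat_eq_0_if_divisible:
  assumes "\<And>n. n > 0 \<Longrightarrow> residue z n = 0" shows "z = 0"
  by (rule zhat_eqI) (simp add: assms zero_zhat.rep_eq)

text \<open>Completeness along the factorials: k divides k!, so the residue of \<open>r\<close>
  modulo k is stable from index k onwards.\<close>

lemma zhat_limit:
  fixes r :: "nat \<Rightarrow> int"
  assumes "\<And>n. fact n dvd r (Suc n) - r n"
  shows "\<exists>z :: zhat. \<forall>n. \<exists>y. z = of_int (r n) + of_int (fact n) * y"
proof -
  have step: "fact n dvd r m - r n" if "n \<le> m" for n m
    using that
  proof (induction m rule: dec_induct)
    case (step m)
    have "(fact n :: int) dvd fact m" using step(1) by (rule fact_dvd)
    then have "fact n dvd (r (Suc m) - r m) + (r m - r n)"
      using assms [of m] step.IH by (intro dvd_add) (auto intro: dvd_trans)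
    then show ?case by simp
  qed simp
  define f where "f = (\<lambda>m. if m = 0 then 0 else r m mod int m)"
  have "f m mod int k = f k" if "0 < m" "k dvd m" for m k
  proof -
    have k: "k > 0" "k \<le> m" using that by (auto intro: Nat.gr0I dvd_imp_le)
    have "int k dvd fact k" using k(1) by (metis dvd_fact int_dvd_int_iff of_nat_fact order_refl Suc_leI One_nat_def)
    then have "int k dvd r m - r k" using step [OF k(2)] dvd_trans by blast
    then show ?thesis using that k(1) by (simp add: f_def mod_mod_cancel mod_eq_dvd_iff)
  qed
  moreover have "f 0 = 0" by (simp add: f_def)
  ultimately have "residue (Abs_zhat f) = f" by (intro Abs_zhat_inverse) simp
  define z where "z = Abs_zhat f"
  have z: "residue z m = r m mod int m" if "m > 0" for m
    using that \<open>residue (Abs_zhat f) = f\<close> by (simp add: z_def f_def)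
  have "\<exists>y. z = of_int (r n) + of_int (fact n) * y" for n
  proof -
    \<comment> \<open>The residue of \<open>z\<close> modulo n! was defined through the term of
      index n!; since that index is at least n, the term agrees with \<open>r n\<close> modulo
      n!.\<close>
    have "n \<le> fact n" by (rule fact_ge_self)
    then have "fact n dvd r (fact n) - r n" by (rule step)
    then have "residue (z - of_int (r n)) (fact n) = 0"
      by (simp add: residue_diff residue_of_int z mod_diff_eq of_nat_fact)
    from zhat_divide [OF fact_gt_zero this]
    obtain y where "z - of_int (r n) = of_nat (fact n) * y" ..
    then show ?thesis by (intro exI [of _ y]) (simp add: algebra_simps of_nat_fact)
  qed
  then show ?thesis by blast
qed

text \<open>\<open>q\<close> is the greatest common divisor of \<open>K\<close> and the residue of \<open>z\<close> modulo \<open>K\<close>.\<close>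

lemma zhat_divisor_unit:
  fixes z w :: zhat
  assumes "K > 0" "z * w = of_int K"
  shows "\<exists>q u v. q > 0 \<and> u * v = 1 \<and> z = of_int q * u"
proof -
  obtain r y where z: "z = of_int r + of_int K * y" using zhat_approx [OF assms(1)] by blast
  define q where "q = gcd r K"
  have q: "q > 0" using assms(1) by (simp add: q_def gcd_pos_int)
  obtain r' K' where r': "r = q * r'" and K': "K = q * K'" and cop: "coprime r' K'"
    using gcd_coprime_exists [of r K] q unfolding q_def by (metis less_irrefl mult.commute)
  define u where "u = of_int r' + of_int K' * y"
  have zu: "z = of_int q * u" by (simp add: z r' K' u_def algebra_simps)
  have "of_int q * (u * w - of_int K') = 0"
    using assms(2) by (simp add: zu K' algebra_simps)
  then have uw: "u * w = of_int K'" using zhat_torsion_free [of q] q by fastforce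
  obtain a b where ab: "a * r' + b * K' = 1" using cop bezout_int [of r' K'] by auto
  \<comment> \<open>\<open>u\<close> divides K' and is congruent to r' modulo K'; a Bezout relation
    between r' and K' therefore yields an inverse of \<open>u\<close>.\<close>
  have "u * (of_int a + w * (of_int b - of_int a * y)) = of_int a * u + (u * w) * (of_int b - of_int a * y)"
    by (simp add: algebra_simps)
  also have "\<dots> = of_int (a * r' + b * K')"
    unfolding uw by (simp add: u_def algebra_simps)
  finally show ?thesis using q zu ab by (metis of_int_1)
qed

section \<open>The adelic algebra\<close>

lemma tens_0_left [simp]: "tens 0 y = 0" and tens_0_right [simp]: "tens x 0 = 0"
  using tens_add_left [of 0 0 y] tens_add_right [of x 0 0] by simp_all

lemma tens_minus_left: "tens (- x) y = - tens x y"
  using tens_add_left [of x "- x" y] by (simp add: minus_unique)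

lemma tens_minus_right: "tens x (- y) = - tens x y"
  using tens_add_right [of x y "- y"] by (simp add: minus_unique)

lemma tens_diff_left: "tens (x - x') y = tens x y - tens x' y"
  using tens_add_left [of x "- x'" y] by (simp add: tens_minus_left)

lemma tens_diff_right: "tens x (y - y') = tens x y - tens x y'"
  using tens_add_right [of x y "- y'"] by (simp add: tens_minus_right)

lemma tens_sum_left: "tens (sum f I) y = (\<Sum>k\<in>I. tens (f k) y)"
  by (induction I rule: infinite_finite_induct) (simp_all add: tens_add_left)

lemma tensor_induct [case_names tens diff]:
  assumes "\<And>x y. P (tens x y)" "\<And>s t. P s \<Longrightarrow> P t \<Longrightarrow> P (s - t)"
  shows "P t"
proof -
  have "t = abs_tensor (rep_tensor t)"
    by (simp add: Quotient3_abs_rep [OF Quotient3_tensor])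
  moreover have "P (abs_tensor u)" for u
  proof (induction u rule: frag_induct_of)
    case 1
    then show ?case using assms(1) [of 0 0] by (simp flip: zero_tensor_def)
  next
    case (2 x y)
    then show ?case using assms(1) [of x y] by (simp add: tens.abs_eq)
  next
    case (3 u v)
    then show ?case using assms(2) by (simp flip: minus_tensor.abs_eq)
  qed
  ultimately show ?thesis by metis
qed

lemma hat_of_int: "(of_int n :: 'h::{division_ring, ring_char_0} hat) = tens (of_int n) 1"
proof -
  have nat: "(of_nat m :: 'h hat) = tens (of_nat m) 1" for m
    by (induction m) (simp_all add: tens_add_left one_tensor_def)
  show ?thesis
    by (cases n rule: int_cases2) (simp_all add: nat tens_minus_left)
qed

lemma hat_of_int_right: "(of_int n :: 'h::{division_ring, ring_char_0} hat) = tens 1 (of_int n)"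
proof -
  have nat: "(of_nat m :: 'h hat) = tens 1 (of_nat m)" for m
    by (induction m) (simp_all add: tens_add_right one_tensor_def)
  show ?thesis
    by (cases n rule: int_cases2) (simp_all add: nat tens_minus_right)
qed

lemma of_int_mult_tens:
  fixes x :: "'h::{division_ring, ring_char_0}" and y :: zhat
  shows "of_int n * tens x y = tens (of_int n * x) y" "of_int n * tens x y = tens x (of_int n * y)"
  by (simp add: hat_of_int tens_mult, simp add: hat_of_int_right tens_mult)

lemma hat_of_int_inverse:
  fixes t :: "'h::{division_ring, ring_char_0} hat"
  assumes "n \<noteq> 0"
  shows "of_int n * (tens (inverse (of_int n)) 1 * t) = t" "tens (inverse (of_int n)) 1 * (of_int n * t) = t"
  using assms
  by (simp_all add: hat_of_int tens_mult flip: mult.assoc) (simp_all flip: one_tensor_def)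

lemma hat_of_int_cancel:
  fixes s t :: "'h::{division_ring, ring_char_0} hat"
  assumes "n \<noteq> 0"
  shows "of_int n * s = of_int n * t \<longleftrightarrow> s = t"
  by (metis assms hat_of_int_inverse(2))

lemma hat_of_int_eq_0:
  fixes t :: "'h::{division_ring, ring_char_0} hat"
  assumes "n \<noteq> 0"
  shows "of_int n * t = 0 \<longleftrightarrow> t = 0"
  using hat_of_int_cancel [OF assms, of t 0] by simp

context quaternion_algebra
begin

abbreviation hc :: "'h hat \<Rightarrow> 'h hat" where "hc \<equiv> hat_conj i j"

lemma hc_tens [simp]: "hc (tens x z) = tens (cj x) z"
  unfolding hat_conj_def by (rule map_left_tens) (rule cj_add)

lemma hc_add: "hc (s + t) = hc s + hc t"
  unfolding hat_conj_def by (rule map_left_add) (rule cj_add)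

lemma hc_0 [simp]: "hc 0 = 0"
  using hc_add [of 0 0] by simp

lemma hc_minus: "hc (- t) = - hc t"
  using hc_add [of t "- t"] by (simp add: minus_unique)

lemma hc_diff: "hc (s - t) = hc s - hc t"
  using hc_add [of s "- t"] by (simp add: hc_minus)

lemma hc_sum: "hc (sum f I) = (\<Sum>k\<in>I. hc (f k))"
  by (induction I rule: infinite_finite_induct) (simp_all add: hc_add)

lemma hc_of_int [simp]: "hc (of_int n) = of_int n"
  by (simp add: hat_of_int)

lemma hc_1 [simp]: "hc 1 = 1"
  using hc_of_int [of 1] by simp

lemma hc_hc [simp]: "hc (hc t) = t"
  by (induction t rule: tensor_induct) (simp_all add: hc_diff)

lemma hc_mult: "hc (s * t) = hc t * hc s"
proof (induction s rule: tensor_induct)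
  case (tens x y)
  show ?case
    by (induction t rule: tensor_induct)
      (simp_all add: hc_diff tens_mult cj_mult mult.commute right_diff_distrib left_diff_distrib)
qed (simp add: hc_diff right_diff_distrib left_diff_distrib)

text \<open>Only existence is claimed. Uniqueness of the coordinates is replaced by the trace form,
  which isolates each of them in \<open>infinitely_divisible_eq_0\<close>.\<close>

lemma hat_coords:
  fixes t :: "'h hat"
  obtains d z0 z1 z2 z3 where "d > 0"
    "of_int d * t = tens 1 z0 + tens i z1 + tens j z2 + tens (i * j) z3"
proof -
  have "\<exists>d>0. \<exists>z0 z1 z2 z3. of_int d * t = tens 1 z0 + tens i z1 + tens j z2 + tens (i * j) z3"
  proof (induction t rule: tensor_induct)
    case (tens x z)
    obtain a b c e where x: "x = of_Q a + scaleQ b i + scaleQ c j + scaleQ e (i * j)" by (rule coords)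
    obtain D where D: "D > 0" "\<And>q. q \<in> {a, b, c, e} \<Longrightarrow> \<exists>n. of_int D * q = (of_int n :: rat)"
      using finite_rat_denominator [of "{a, b, c, e}"] by auto
    obtain a' b' c' e' where abc: "of_int D * a = of_int a'" "of_int D * b = of_int b'"
      "of_int D * c = of_int c'" "of_int D * e = of_int e'"
      using D(2) [of a] D(2) [of b] D(2) [of c] D(2) [of e] by auto
    have DQ: "of_int D * of_Q q = (of_int k :: 'h)" if "of_int D * q = of_int k" for q k
      using that by (metis of_Q_mult of_Q_of_int)
    have "of_int D * x = of_int a' + of_int b' * i + of_int c' * j + of_int e' * (i * j)"
      unfolding x scaleQ_def by (simp add: distrib_left DQ [OF abc(1)] DQ [OF abc(2)] DQ [OF abc(3)] DQ [OF abc(4)] flip: mult.assoc)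
    then have "of_int D * tens x z = of_int a' * tens 1 z + of_int b' * tens i z + of_int c' * tens j z + of_int e' * tens (i * j) z"
      by (simp add: of_int_mult_tens(1) tens_add_left)
    then have "of_int D * tens x z = tens 1 (of_int a' * z) + tens i (of_int b' * z) + tens j (of_int c' * z) + tens (i * j) (of_int e' * z)"
      by (simp only: of_int_mult_tens(2))
    then show ?case using D(1) by blast
  next
    case (diff s t)
    then obtain d z0 z1 z2 z3 e w0 w1 w2 w3 where d: "d > 0" "e > 0"
      "of_int d * s = tens 1 z0 + tens i z1 + tens j z2 + tens (i * j) z3"
      "of_int e * t = tens 1 w0 + tens i w1 + tens j w2 + tens (i * j) w3" by blast
    have "of_int (d * e) * (s - t) = of_int e * (of_int d * s) - of_int d * (of_int e * t)"
      by (simp add: right_diff_distrib mult.commute [of d e] flip: mult.assoc of_int_mult)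
    also have "\<dots> = tens 1 (of_int e * z0 - of_int d * w0) + tens i (of_int e * z1 - of_int d * w1)
        + tens j (of_int e * z2 - of_int d * w2) + tens (i * j) (of_int e * z3 - of_int d * w3)"
      unfolding d by (simp add: distrib_left of_int_mult_tens(2) tens_diff_right)
    finally show ?case using d(1,2) by (intro exI [of _ "d * e"]) auto
  qed
  then show ?thesis using that by blast
qed

text \<open>The trace form is diagonal on 1, i, j, ij. The constants are a = 2 i^2 and b = 2 j^2;
  since the square of ij is -(i^2)(j^2), its trace is -ab/2.\<close>

lemma trace_basis:
  obtains a b where "a \<noteq> 0" "b \<noteq> 0"
    "i * i + cj (i * i) = of_Q a" "j * j + cj (j * j) = of_Q b"
    "i * j * (i * j) + cj (i * j * (i * j)) = of_Q (- (a * b / 2))"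
    "j * i + cj (j * i) = 0" "i * j * i + cj (i * j * i) = 0" "i * j * j + cj (i * j * j) = 0"
    "i * (i * j) + cj (i * (i * j)) = 0" "j * (i * j) + cj (j * (i * j)) = 0"
proof -
  obtain a b where ab: "a \<noteq> 0" "b \<noteq> 0" "i * i = of_Q a" "j * j = of_Q b"
    by (rule obtain_squares)
  have 1: "i * (i * j) = of_Q a * j" by (simp add: ab flip: mult.assoc)
  have 2: "i * j * j = of_Q b * i" by (simp add: ab mult.assoc of_Q_commute)
  have "i * j * (i * j) = i * (j * i) * j" by (simp add: mult.assoc)
  also have "\<dots> = - (i * (i * j) * j)" by (simp add: anticommute mult.assoc)
  also have "\<dots> = - (of_Q a * of_Q b)" by (simp add: 1 ab mult.assoc)
  finally have 3: "i * j * (i * j) = of_Q (- (a * b))" by (simp add: of_Q_mult of_Q_minus)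
  have dbl: "of_Q q + of_Q q = (of_Q (2 * q) :: 'h)" for q
    by (simp flip: of_Q_add)
  show ?thesis
  proof (rule that [of "2 * a" "2 * b"])
    show "i * j * (i * j) + cj (i * j * (i * j)) = of_Q (- (2 * a * (2 * b) / 2))"
      unfolding 3 cj_of_Q dbl by simp
    show "i * (i * j) + cj (i * (i * j)) = 0" unfolding 1 by (simp add: cj_of_Q_mult cj_j)
    then show "i * j * i + cj (i * j * i) = 0" using trace_commute [of "i * j" i] by simp
    show "i * j * j + cj (i * j * j) = 0" unfolding 2 by (simp add: cj_of_Q_mult cj_i)
    then show "j * (i * j) + cj (j * (i * j)) = 0" using trace_commute [of "i * j" j] by simp
    show "j * i + cj (j * i) = 0" by (simp add: anticommute cj_minus cj_ij)
  qed (use ab dbl in auto)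
qed

text \<open>Adding the conjugate cancels the coordinates at i, j and ij, at the cost of a factor
  2.\<close>

lemma hat_fixed:
  assumes "hc t = t"
  obtains d z where "d > 0" "of_int d * t = tens 1 z"
proof -
  obtain d z0 z1 z2 z3 where d: "d > 0" and
    t: "of_int d * t = tens 1 z0 + tens i z1 + tens j z2 + tens (i * j) z3" by (rule hat_coords)
  have "of_int d * t + of_int d * t = of_int d * t + hc (of_int d * t)"
    using assms by (simp add: hc_mult mult_of_int_commute)
  also have "\<dots> = tens 1 z0 + tens 1 z0"
    unfolding t by (simp add: hc_add cj_i cj_j cj_ij tens_minus_left)
  also have "\<dots> = tens 1 (z0 + z0)"
    by (simp only: tens_add_right)
  finally have "of_int (2 * d) * t = tens 1 (z0 + z0)"
    by (simp only: mult_2 of_int_add distrib_right)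
  then show ?thesis using d that [of "2 * d"] by simp
qed

text \<open>Up to a positive integer factor \<open>t\<close> is 1 tensor z, which commutes with pure
  tensors. Hence multipliers of similitudes are central.\<close>

lemma hat_fixed_central:
  assumes "hc t = t"
  shows "t * s = s * t"
proof -
  obtain d z where d: "d > 0" "of_int d * t = tens 1 z" using assms by (rule hat_fixed)
  have "tens 1 z * s = s * tens 1 z"
    by (induction s rule: tensor_induct) (simp_all add: tens_mult mult.commute right_diff_distrib left_diff_distrib)
  then have "of_int d * (t * s) = of_int d * (s * t)"
    by (metis d(2) mult.assoc mult_of_int_commute)
  then show ?thesis using d(1) hat_of_int_cancel [of d "t * s" "s * t"] by simp
qed

end

text \<open>Evaluation of formal sums at level \<open>n\<close>. On a tensor relation the value lies in \<open>A\<close> as soon as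
  \<open>n\<close> is sufficiently divisible; this makes \<open>H / A\<close> a quotient of the adelic algebra.\<close>

definition frag_value :: "nat \<Rightarrow> (('h::{division_ring, ring_char_0} \<times> zhat) \<Rightarrow>\<^sub>0 int) \<Rightarrow> 'h"
  where "frag_value n u =
    (\<Sum>z\<in>Poly_Mapping.keys u. of_int (poly_mapping.lookup u z) * (fst z * of_int (residue (snd z) n)))"

lemma frag_value_superset:
  assumes "finite K" "Poly_Mapping.keys u \<subseteq> K"
  shows "frag_value n u =
    (\<Sum>z\<in>K. of_int (poly_mapping.lookup u z) * (fst z * of_int (residue (snd z) n)))"
  unfolding frag_value_def
  by (rule sum.mono_neutral_left) (use assms in \<open>auto simp: in_keys_iff\<close>)

lemma frag_value_diff: "frag_value n (u - v) = frag_value n u - frag_value n v"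
proof -
  let ?K = "Poly_Mapping.keys u \<union> Poly_Mapping.keys v"
  have "Poly_Mapping.keys (u - v) \<subseteq> ?K"
    by (auto simp: in_keys_iff lookup_minus)
  then show ?thesis
    by (simp add: frag_value_superset [of ?K] lookup_minus algebra_simps sum_subtractf)
qed

lemma frag_value_of [simp]: "frag_value n (frag_of (x, y)) = x * of_int (residue y n)"
  by (simp add: frag_value_def)

lemma frag_value_0 [simp]: "frag_value n 0 = 0"
  by (simp add: frag_value_def)

context maximal_quaternion_order
begin

text \<open>Relations in the first argument evaluate to 0. Those in the second argument evaluate to
  x times the carry of an addition modulo n, a multiple of n; it lies in A once the denominator of x
  divides n.\<close>

lemma frag_value_relation:
  assumes "u \<in> group_closure tensor_relations"
  shows "\<exists>D>0. \<forall>n>0. D dvd int n \<longrightarrow> frag_value n u \<in> A"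
  using assms
proof induction
  case (base u)
  then consider "u = 0" | "u \<in> tensor_relations" by blast
  then show ?case
  proof cases
    case 1
    then show ?thesis by (intro exI [of _ 1]) simp
  next
    case 2
    then show ?thesis
    proof cases
      case (left x x' y)
      then show ?thesis
        by (intro exI [of _ 1]) (simp add: frag_value_diff distrib_right)
    next
      case (right x y y')
      obtain D where D: "D > 0" "of_int D * x \<in> A" using A_denominator by blast
      have "frag_value n u \<in> A" if n: "n > 0" "D dvd int n" for n
      proof -
        from n(2) obtain k where k: "int n = D * k" ..
        let ?a = "residue y n" and ?b = "residue y' n"
        have "residue (y + y') n = ?a + ?b - int n * ((?a + ?b) div int n)"
          by (simp add: plus_zhat.rep_eq minus_mult_div_eq_mod)
        also have "int n * ((?a + ?b) div int n) = D * (k * ((?a + ?b) div int n))"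
          by (simp add: k mult.assoc)
        finally have "frag_value n u = - (x * of_int (D * (k * ((?a + ?b) div int n))))"
          unfolding right(1) by (simp add: frag_value_diff right_diff_distrib distrib_left)
        also have "x * of_int (D * (k * ((?a + ?b) div int n))) = of_int D * x * of_int (k * ((?a + ?b) div int n))"
          by (simp only: of_int_mult mult.assoc [symmetric] mult_of_int_commute [of D x])
        finally show ?thesis using D(2) A_mult A_of_int by simp
      qed
      then show ?thesis using D(1) by blast
    qed
  qed
next
  case (diff s t)
  then obtain D E where DE: "D > 0" "\<And>n. n > 0 \<Longrightarrow> D dvd int n \<Longrightarrow> frag_value n s \<in> A"
    "E > 0" "\<And>n. n > 0 \<Longrightarrow> E dvd int n \<Longrightarrow> frag_value n t \<in> A" by blast
  then show ?case
    by (intro exI [of _ "D * E"]) (auto simp: frag_value_diff intro!: A_diff dest: dvd_mult_left dvd_mult_right)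
qed

section \<open>The integral adeles and their intersection with H\<close>

abbreviation OH :: "'h hat set" where "OH \<equiv> hat_order A"

lemma OH_tens: "x \<in> A \<Longrightarrow> tens x z \<in> OH"
  unfolding hat_order_def by (rule group_closure.base) auto

lemma OH_0 [simp]: "0 \<in> OH" and OH_diff: "s \<in> OH \<Longrightarrow> t \<in> OH \<Longrightarrow> s - t \<in> OH"
  and OH_add: "s \<in> OH \<Longrightarrow> t \<in> OH \<Longrightarrow> s + t \<in> OH" and OH_minus [simp]: "- t \<in> OH \<longleftrightarrow> t \<in> OH"
  unfolding hat_order_def by (auto intro: group_closure.diff group_closure_add)

lemma OH_sum: "(\<And>k. k \<in> I \<Longrightarrow> f k \<in> OH) \<Longrightarrow> sum f I \<in> OH"
  by (induction I rule: infinite_finite_induct) (auto intro: OH_add)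

lemma OH_induct [consumes 1, case_names tens diff]:
  assumes "t \<in> OH" "\<And>x z. x \<in> A \<Longrightarrow> P (tens x z)" "\<And>s t. s \<in> OH \<Longrightarrow> t \<in> OH \<Longrightarrow> P s \<Longrightarrow> P t \<Longrightarrow> P (s - t)"
  shows "P t"
  using assms(1) unfolding hat_order_def
proof induction
  case (base s)
  then show ?case using assms(2) [of 0 0] assms(2) by auto
next
  case (diff s t)
  then show ?case using assms(3) by (simp add: hat_order_def)
qed

lemma OH_mult: "s \<in> OH \<Longrightarrow> t \<in> OH \<Longrightarrow> s * t \<in> OH"
proof (induction s rule: OH_induct)
  case (tens x z)
  from \<open>t \<in> OH\<close> show ?case
    by (induction t rule: OH_induct) (use tens in \<open>auto simp: tens_mult right_diff_distrib intro!: OH_tens OH_diff A_mult\<close>)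
qed (simp add: left_diff_distrib OH_diff)

lemma OH_of_int [simp]: "of_int n \<in> OH"
  by (simp add: hat_of_int OH_tens)

lemma OH_1 [simp]: "1 \<in> OH"
  using OH_of_int [of 1] by simp

lemma OH_hc: "t \<in> OH \<Longrightarrow> hc t \<in> OH"
  by (induction t rule: OH_induct) (simp_all add: OH_tens A_cj hc_diff OH_diff)

lemma OH_of_int_mult: "t \<in> OH \<Longrightarrow> of_int n * t \<in> OH"
  by (simp add: OH_mult)

lemma OH_value: "t \<in> OH \<Longrightarrow> \<exists>u. t = abs_tensor u \<and> (\<forall>n. frag_value n u \<in> A)"
proof (induction t rule: OH_induct)
  case (tens x z)
  then show ?case
    by (intro exI [of _ "frag_of (x, z)"]) (simp add: tens.abs_eq A_mult)
next
  case (diff s t)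
  then obtain u v where "s = abs_tensor u" "t = abs_tensor v" "\<And>n. frag_value n u \<in> A" "\<And>n. frag_value n v \<in> A"
    by blast
  then show ?case
    by (intro exI [of _ "u - v"]) (simp add: minus_tensor.abs_eq frag_value_diff A_diff)
qed

text \<open>Compare x tensor 1 with a representative all of whose values lie in A: the two differ by
  a consequence of tensor relations, whose value lies in A at sufficiently divisible levels, where x
  tensor 1 has value \<open>x\<close>.\<close>

lemma OH_Int_H: "tens x 1 \<in> OH \<longleftrightarrow> x \<in> A"
proof
  assume "tens x 1 \<in> OH"
  then obtain u where u: "tens x 1 = abs_tensor u" "\<And>n. frag_value n u \<in> A" using OH_value by blast
  then have "frag_of (x, 1) - u \<in> group_closure tensor_relations"
    by (simp add: tens.abs_eq tensor.abs_eq_iff)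
  then obtain D where D: "D > 0" "\<And>n. n > 0 \<Longrightarrow> D dvd int n \<Longrightarrow> frag_value n (frag_of (x, 1) - u) \<in> A"
    using frag_value_relation by blast
  \<comment> \<open>The factor 2 guarantees n > 1; modulo 1 the residue of 1 would be 0.\<close>
  define n where "n = nat (2 * D)"
  have n: "n > 1" "D dvd int n" using D(1) by (auto simp: n_def)
  then have "frag_value n (frag_of (x, 1) - u) \<in> A" using D(2) by simp
  moreover have "residue 1 n = 1" using n(1) by (simp add: one_zhat.rep_eq)
  ultimately have "x - frag_value n u \<in> A" by (simp add: frag_value_diff)
  then show "x \<in> A" using A_add [OF _ u(2) [of n]] by fastforce
qed (rule OH_tens)

lemma multiples_if_hat: "tens x 1 = of_int n * s \<Longrightarrow> s \<in> OH \<Longrightarrow> n \<noteq> 0 \<Longrightarrow> x \<in> multiples n"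
proof -
  assume s: "tens x 1 = of_int n * s" "s \<in> OH" "n \<noteq> 0"
  then have "s = tens (inverse (of_int n) * x) 1"
    using hat_of_int_inverse(2) [of n s] by (simp add: tens_mult flip: s(1))
  then have "inverse (of_int n) * x \<in> A" using s(2) OH_Int_H by simp
  then show ?thesis using divide_multiple s(3) by blast
qed

lemma hat_denominator: "\<exists>n>0. of_int n * t \<in> OH"
proof (induction t rule: tensor_induct)
  case (tens x z)
  then show ?case using A_denominator [of x] by (auto simp: of_int_mult_tens(1) intro: OH_tens)
next
  case (diff s t)
  then obtain m n where mn: "m > 0" "of_int m * s \<in> OH" "n > 0" "of_int n * t \<in> OH" by blast
  have "of_int (m * n) * (s - t) = of_int n * (of_int m * s) - of_int m * (of_int n * t)"
    by (simp add: right_diff_distrib mult.commute [of m n] flip: mult.assoc of_int_mult)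
  then have "of_int (m * n) * (s - t) \<in> OH"
    using mn by (metis OH_diff OH_of_int_mult)
  then show ?case using mn by (intro exI [of _ "m * n"]) simp
qed

text \<open>H is dense: the profinite factor is replaced by an integer modulo nm, where m clears the
  denominator of the quaternion factor.\<close>

lemma hat_approx:
  assumes "n > 0"
  shows "\<exists>x. \<exists>s\<in>OH. t = tens x 1 + of_int n * s"
proof (induction t rule: tensor_induct)
  case (tens x z)
  obtain m where m: "m > 0" "of_int m * x \<in> A" using A_denominator by blast
  obtain r y where z: "z = of_int r + of_int (n * m) * y"
    using zhat_approx [OF mult_pos_pos [OF assms m(1)]] by blast
  have "tens x z = of_int r * tens x 1 + of_int (n * m) * tens x y"
    unfolding z by (simp only: tens_add_right of_int_mult_tens(2) mult_1_right)
  also have "\<dots> = tens (of_int r * x) 1 + of_int n * tens (of_int m * x) y"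
    by (simp add: of_int_mult_tens(1) mult.assoc)
  finally show ?case using OH_tens [OF m(2)] by blast
next
  case (diff s t)
  then obtain x s' y t' where "s' \<in> OH" "s = tens x 1 + of_int n * s'" "t' \<in> OH" "t = tens y 1 + of_int n * t'" by blast
  then show ?case
    by (intro exI [of _ "x - y"] bexI [of _ "s' - t'"]) (simp_all add: tens_diff_left algebra_simps OH_diff)
qed

lemma OH_approx:
  assumes "n > 0" "t \<in> OH"
  shows "\<exists>x\<in>A. \<exists>s\<in>OH. t = tens x 1 + of_int n * s"
proof -
  obtain x s where xs: "s \<in> OH" "t = tens x 1 + of_int n * s" using hat_approx [OF assms(1)] by blast
  then have "tens x 1 = t - of_int n * s" by simp
  then have "tens x 1 \<in> OH" using xs(1) assms(2) by (simp add: OH_diff OH_of_int_mult)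
  then show ?thesis using xs OH_Int_H by blast
qed

section \<open>The adelic algebra is separated\<close>

definition infinitely_divisible :: "'h hat \<Rightarrow> bool"
  where "infinitely_divisible t \<longleftrightarrow> (\<forall>n>0. \<exists>s\<in>OH. t = of_int n * s)"

lemma infinitely_divisible_mult_left: "infinitely_divisible t \<Longrightarrow> infinitely_divisible (w * t)"
  unfolding infinitely_divisible_def
proof (intro allI impI)
  fix n :: int assume t: "\<forall>n>0. \<exists>s\<in>OH. t = of_int n * s" and n: "n > 0"
  obtain m where m: "m > 0" "of_int m * w \<in> OH" using hat_denominator by blast
  obtain s where s: "s \<in> OH" "t = of_int (n * m) * s" using t m(1) n by (meson mult_pos_pos)
  have "w * t = of_int n * (of_int m * w * s)"
  proof -
    have "of_int n * (of_int m * w * s) = of_int (n * m) * w * s" by (simp add: mult.assoc)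
    also have "\<dots> = w * of_int (n * m) * s" by (simp only: mult_of_int_commute)
    finally show ?thesis by (simp only: s(2) mult.assoc)
  qed
  then show "\<exists>s\<in>OH. w * t = of_int n * s" using OH_mult [OF m(2) s(1)] by blast
qed

lemma infinitely_divisible_hc: "infinitely_divisible t \<Longrightarrow> infinitely_divisible (hc t)"
  unfolding infinitely_divisible_def by (metis OH_hc hc_mult hc_of_int mult_of_int_commute)

lemma infinitely_divisible_add: "infinitely_divisible s \<Longrightarrow> infinitely_divisible t \<Longrightarrow> infinitely_divisible (s + t)"
  unfolding infinitely_divisible_def by (metis OH_add distrib_left)

lemma infinitely_divisible_mult_right: "infinitely_divisible t \<Longrightarrow> infinitely_divisible (t * w)"
  using infinitely_divisible_hc [OF infinitely_divisible_mult_left [OF infinitely_divisible_hc, of t "hc w"]]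
  by (simp add: hc_mult)

text \<open>Modulo n the element is an integer r, and divisibility in the integral adeles forces r
  into nA, hence n to divide r. Applied to 0 this also shows that z is determined by 1 tensor
  z.\<close>

lemma infinitely_divisible_zhat: "infinitely_divisible (tens 1 z) \<Longrightarrow> z = 0"
proof (rule zhat_eq_0_if_divisible)
  fix n :: nat assume inf: "infinitely_divisible (tens 1 z)" and n: "n > 0"
  obtain s where s: "s \<in> OH" "tens 1 z = of_int (int n) * s"
    using inf n unfolding infinitely_divisible_def by (metis of_nat_0_less_iff)
  obtain r y where z: "z = of_int r + of_int (int n) * y" using zhat_approx [of "int n" z] n unfolding of_nat_0_less_iff by blast
  have "(tens 1 z :: 'h hat) = of_int r * tens 1 1 + of_int (int n) * tens 1 y"
    unfolding z by (simp only: tens_add_right of_int_mult_tens(2) mult_1_right)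
  then have "(tens (of_int r) 1 :: 'h hat) = tens 1 z - of_int (int n) * tens 1 y"
    by (simp add: of_int_mult_tens(1))
  also have "\<dots> = of_int (int n) * (s - tens 1 y)"
    by (simp only: s(2) right_diff_distrib)
  finally have "tens (of_int r) 1 = of_int (int n) * (s - tens 1 y)" .
  then have "of_int r \<in> multiples (int n)"
    using OH_diff [OF s(1) OH_tens [OF A_1, of y]] n by (intro multiples_if_hat) simp_all
  then have "int n dvd r" by (simp add: of_int_multiples_iff)
  moreover have "residue z n = r mod int n"
    unfolding z using n by (simp add: plus_zhat.rep_eq times_zhat.rep_eq residue_of_int residue_of_nat mod_add_left_eq)
  ultimately show "residue z n = 0" by simp
qed

lemma infinitely_divisible_rational:
  assumes "infinitely_divisible (tens (of_Q q) z)" "q \<noteq> 0" shows "z = 0"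
proof -
  have "tens (of_Q (inverse q)) 1 * tens (of_Q q) z = tens 1 z"
    using assms(2) by (simp add: tens_mult flip: of_Q_mult)
  then show ?thesis
    using infinitely_divisible_mult_left [OF assms(1)] infinitely_divisible_zhat by metis
qed

text \<open>Infinite divisibility survives multiplication and conjugation, hence traces. Traces
  against the basis are nonzero rational multiples of the single coordinates, because the trace form
  is diagonal on it.\<close>

lemma infinitely_divisible_eq_0:
  assumes "infinitely_divisible t" shows "t = 0"
proof -
  obtain d z0 z1 z2 z3 where d: "d > 0" and
    t: "of_int d * t = tens 1 z0 + tens i z1 + tens j z2 + tens (i * j) z3" by (rule hat_coords)
  define T where "T = (\<lambda>c. of_int d * t * tens c 1 + hc (of_int d * t * tens c 1))"
  have inf: "infinitely_divisible (T c)" for c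
    unfolding T_def
    by (intro infinitely_divisible_add infinitely_divisible_hc infinitely_divisible_mult_left infinitely_divisible_mult_right assms)
  have T: "T c = tens (c + cj c) z0 + tens (i * c + cj (i * c)) z1 + tens (j * c + cj (j * c)) z2
      + tens (i * j * c + cj (i * j * c)) z3" for c
    unfolding T_def t by (simp add: distrib_right tens_mult hc_add tens_add_left)
  obtain a b where ab: "a \<noteq> 0" "b \<noteq> 0"
    "i * i + cj (i * i) = of_Q a" "j * j + cj (j * j) = of_Q b"
    "i * j * (i * j) + cj (i * j * (i * j)) = of_Q (- (a * b / 2))"
    "j * i + cj (j * i) = 0" "i * j * i + cj (i * j * i) = 0" "i * j * j + cj (i * j * j) = 0"
    "i * (i * j) + cj (i * (i * j)) = 0" "j * (i * j) + cj (j * (i * j)) = 0"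
    by (rule trace_basis)
  have "(1 :: 'h) + 1 = of_Q 2" using of_Q_of_int [of 2, where 'a = 'h] by simp
  then have "T 1 = tens (of_Q 2) z0" unfolding T by (simp add: cj_i cj_j cj_ij)
  then have z0: "z0 = 0" using inf infinitely_divisible_rational [of 2] by (metis zero_neq_numeral)
  have "T i = tens (of_Q a) z1" unfolding T ab by (simp add: cj_i)
  then have z1: "z1 = 0" using inf infinitely_divisible_rational ab(1) by metis
  have "T j = tens (of_Q b) z2" unfolding T ab by (simp add: cj_j cj_ij)
  then have z2: "z2 = 0" using inf infinitely_divisible_rational ab(2) by metis
  have "T (i * j) = tens (of_Q (- (a * b / 2))) z3" unfolding T ab by (simp add: cj_ij)
  moreover have "- (a * b / 2) \<noteq> 0" using ab(1,2) by simp
  ultimately have z3: "z3 = 0" using inf infinitely_divisible_rational by metis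
  show ?thesis using t d hat_of_int_eq_0 [of d t] by (simp add: z0 z1 z2 z3)
qed

text \<open>Up to positive integers \<open>\<mu>\<close> and \<open>\<nu>\<close> are profinite
  integers z and w, and \<open>\<mu> * \<nu> = 1\<close> says that zw is a positive integer. Such a
  divisor z is an integer times a unit.\<close>

lemma hat_unit_rational_times_unit:
  assumes "hc \<mu> = \<mu>" "hc \<nu> = \<nu>" "\<mu> * \<nu> = 1"
  shows "\<exists>q u v. q \<noteq> 0 \<and> u * v = 1 \<and> \<mu> = tens (of_Q q) u"
proof -
  obtain m z where m: "m > 0" "of_int m * \<mu> = tens 1 z" using assms(1) by (rule hat_fixed)
  obtain n w where n: "n > 0" "of_int n * \<nu> = tens 1 w" using assms(2) by (rule hat_fixed)
  have "tens 1 (z * w) = of_int m * \<mu> * (of_int n * \<nu>)" by (simp add: m n tens_mult)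
  also have "\<dots> = of_int m * of_int n * (\<mu> * \<nu>)" by (metis mult.assoc mult_of_int_commute)
  also have "\<dots> = tens 1 (of_int (m * n))" by (simp only: assms(3) of_int_mult [symmetric] mult_1_right hat_of_int_right [of "m * n"])
  finally have "tens 1 (z * w - of_int (m * n)) = (0 :: 'h hat)" by (simp add: tens_diff_right)
  moreover have "infinitely_divisible 0"
    unfolding infinitely_divisible_def by (metis OH_0 mult_zero_right)
  ultimately have "z * w - of_int (m * n) = 0" by (intro infinitely_divisible_zhat) (simp only:)
  then have "z * w = of_int (m * n)" by simp
  then obtain q u v where q: "q > 0" "u * v = 1" "z = of_int q * u"
    using zhat_divisor_unit [of "m * n" z w] m(1) n(1) by auto
  have "\<mu> = tens (inverse (of_int m)) 1 * (of_int m * \<mu>)"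
    using m(1) by (simp add: hat_of_int_inverse)
  also have "\<dots> = tens (inverse (of_int m)) 1 * (of_int q * tens 1 u)"
    by (simp only: m(2) q(3) of_int_mult_tens(2))
  also have "\<dots> = tens (of_Q (inverse (of_int m) * of_int q)) u"
    by (simp add: of_int_mult_tens(1) tens_mult of_Q_mult of_Q_inverse_of_int)
  finally show ?thesis using q m(1) by (intro exI [of _ "inverse (of_int m) * of_int q"]) auto
qed

text \<open>Fixed generators of A need not be independent, so arbitrary coefficients of
  \<open>v n\<close> need not converge. Coefficients are chosen for the differences instead and
  summed up; the partial sums converge in the profinite integers.\<close>

lemma OH_limit:
  assumes "\<And>n. v (Suc n) - v n \<in> multiples (fact n)" "v 0 \<in> A"
  shows "\<exists>t\<in>OH. \<forall>n. \<exists>s\<in>OH. t = tens (v n) 1 + of_int (fact n) * s"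
proof -
  obtain S where S: "finite S" "A = group_closure S" by (rule A_gens)
  have comb: "\<exists>c. x = (\<Sum>s\<in>S. of_int (c s) * s)" if "x \<in> A" for x
    using that unfolding S(2)
  proof induction
    case (base x)
    then consider "x = 0" | "x \<in> S" by auto
    then show ?case
    proof cases
      case 1
      then show ?thesis by (intro exI [of _ "\<lambda>_. 0"]) simp
    next
      case 2
      have "(\<Sum>s\<in>S. of_int (if s = x then 1 else 0) * s) = (\<Sum>s\<in>S. if s = x then x else 0)"
        by (intro sum.cong) auto
      then show ?thesis using 2 S(1) by (intro exI [of _ "\<lambda>s. if s = x then 1 else 0"]) simp
    qed
  next
    case (diff x y)
    then obtain c d where "x = (\<Sum>s\<in>S. of_int (c s) * s)" "y = (\<Sum>s\<in>S. of_int (d s) * s)" by blast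
    then show ?case
      by (intro exI [of _ "\<lambda>s. c s - d s"]) (simp add: left_diff_distrib sum_subtractf)
  qed
  have "\<exists>a\<in>A. v (Suc n) - v n = of_int (fact n) * a" for n
    using assms(1) [of n] by (auto simp: multiples_def)
  then have "\<exists>c. v (Suc n) - v n = of_int (fact n) * (\<Sum>s\<in>S. of_int (c s) * s)" for n
    using comb by metis
  then obtain c where c: "\<And>n. v (Suc n) - v n = of_int (fact n) * (\<Sum>s\<in>S. of_int (c n s) * s)" by metis
  obtain c0 where c0: "v 0 = (\<Sum>s\<in>S. of_int (c0 s) * s)" using comb assms(2) by blast
  define r where "r = (\<lambda>s n. c0 s + (\<Sum>k<n. fact k * c k s))"
  have v: "v n = (\<Sum>s\<in>S. of_int (r s n) * s)" for n
  proof (induction n)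
    case 0
    then show ?case by (simp add: r_def c0)
  next
    case (Suc n)
    have "v (Suc n) = v n + of_int (fact n) * (\<Sum>s\<in>S. of_int (c n s) * s)"
      using c [of n] by (simp add: algebra_simps)
    then show ?case
      unfolding Suc by (simp add: r_def distrib_right sum.distrib sum_distrib_left mult.assoc flip: add.assoc)
  qed
  have "\<exists>z :: zhat. \<forall>n. \<exists>y. z = of_int (r s n) + of_int (fact n) * y" for s
    by (rule zhat_limit) (simp add: r_def)
  then obtain z where z: "\<And>s n. \<exists>y :: zhat. z s = of_int (r s n) + of_int (fact n) * y" by metis
  define t where "t = (\<Sum>s\<in>S. tens s (z s))"
  have SA: "s \<in> A" if "s \<in> S" for s unfolding S(2) using that by (auto intro: group_closure.base)
  have "\<exists>s\<in>OH. t = tens (v n) 1 + of_int (fact n) * s" for n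
  proof -
    obtain y where y: "\<And>s. z s = of_int (r s n) + of_int (fact n) * y s" using z [of _ n] by metis
    have "t = (\<Sum>s\<in>S. tens (of_int (r s n) * s) 1 + of_int (fact n) * tens s (y s))"
      unfolding t_def
      by (intro sum.cong refl) (metis mult_1_right of_int_mult_tens tens_add_right y)
    then have "t = tens (v n) 1 + of_int (fact n) * (\<Sum>s\<in>S. tens s (y s))"
      by (simp only: v tens_sum_left sum.distrib sum_distrib_left)
    then show ?thesis using SA by (intro bexI [of _ "\<Sum>s\<in>S. tens s (y s)"]) (auto intro: OH_sum OH_tens)
  qed
  moreover have "t \<in> OH" unfolding t_def using SA by (auto intro: OH_sum OH_tens)
  ultimately show ?thesis by blast
qed

end

section \<open>Dedekind finiteness of adelic matrices\<close>

text \<open>On the finite group \<open>X / Xm\<close> the kernel and the cokernel of \<open>N\<close> have the same size, which is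
  bounded by \<open>card F\<close> independently of \<open>Xm\<close>.\<close>

lemma kernel_elements_collide:
  fixes X :: "'v::ab_group_add set"
  assumes X: "0 \<in> X" "\<And>x y. x \<in> X \<Longrightarrow> y \<in> X \<Longrightarrow> x - y \<in> X"
    and Xm: "0 \<in> Xm" "\<And>x y. x \<in> Xm \<Longrightarrow> y \<in> Xm \<Longrightarrow> x - y \<in> Xm" "Xm \<subseteq> X"
    and N: "\<And>x y. N (x + y) = N x + N y" "\<And>x. x \<in> X \<Longrightarrow> N x \<in> X" "\<And>x. x \<in> Xm \<Longrightarrow> N x \<in> Xm"
    and F: "finite F" "F \<subseteq> X" "\<And>x. x \<in> X \<Longrightarrow> \<exists>f\<in>F. \<exists>s\<in>X. x = f + N s"
    and Fm: "finite Fm" "\<And>x. x \<in> X \<Longrightarrow> \<exists>f\<in>Fm. x - f \<in> Xm"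
    and \<tau>: "\<And>t. \<tau> t \<in> X" "\<And>t. N (\<tau> t) = 0"
  shows "\<exists>s t. s < t \<and> t \<le> card F \<and> \<tau> t - \<tau> s \<in> Xm"
proof (rule ccontr)
  assume contra: "\<not> ?thesis"
  have Xneg: "- x \<in> X" if "x \<in> X" for x using X(2) [OF X(1) that] by simp
  have Xadd: "x + y \<in> X" if "x \<in> X" "y \<in> X" for x y using X(2) [OF that(1) Xneg [OF that(2)]] by simp
  have mneg: "- x \<in> Xm" if "x \<in> Xm" for x using Xm(2) [OF Xm(1) that] by simp
  have madd: "x + y \<in> Xm" if "x \<in> Xm" "y \<in> Xm" for x y using Xm(2) [OF that(1) mneg [OF that(2)]] by simp
  have N0: "N 0 = 0" using N(1) [of 0 0] by simp
  have Ndiff: "N (x - y) = N x - N y" for x y using N(1) [of "x - y" y] by simp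
  \<comment> \<open>The set of candidates depends only on the coset of \<open>x\<close>, so
    \<open>SOME\<close> picks one representative per coset of \<open>Xm\<close>.\<close>
  define \<rho> where "\<rho> = (\<lambda>x. SOME y. y \<in> X \<and> x - y \<in> Xm)"
  have \<rho>: "\<rho> x \<in> X" "x - \<rho> x \<in> Xm" if "x \<in> X" for x
    using someI [of "\<lambda>y. y \<in> X \<and> x - y \<in> Xm" x] that Xm(1) by (auto simp: \<rho>_def)
  have \<rho>_eq: "\<rho> x = \<rho> y" if "x - y \<in> Xm" for x y
  proof -
    have "x - z \<in> Xm \<longleftrightarrow> y - z \<in> Xm" for z
      using madd [OF that, of "y - z"] Xm(2) [OF _ that, of "x - z"] by auto
    then show ?thesis by (simp add: \<rho>_def)
  qed
  have \<rho>_eqD: "x - y \<in> Xm" if "\<rho> x = \<rho> y" "x \<in> X" "y \<in> X" for x y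
    using Xm(2) [OF \<rho>(2) [OF that(2)] \<rho>(2) [OF that(3)]] that(1) by simp
  define Y where "Y = \<rho> ` X"
  have YX: "Y \<subseteq> X" using \<rho> by (auto simp: Y_def)
  have "Y \<subseteq> \<rho> ` Fm"
  proof
    fix y assume "y \<in> Y"
    then obtain x where x: "x \<in> X" "y = \<rho> x" by (auto simp: Y_def)
    then obtain f where "f \<in> Fm" "x - f \<in> Xm" using Fm(2) by blast
    then show "y \<in> \<rho> ` Fm" using \<rho>_eq x by blast
  qed
  then have finY: "finite Y" using Fm(1) finite_surj by blast
  define n where "n = (\<lambda>y. \<rho> (N y))"
  define Z where "Z = n ` Y"
  have finZ: "finite Z" using finY by (simp add: Z_def)
  have ZX: "Z \<subseteq> X" using YX N(2) \<rho>(1) by (auto simp: Z_def n_def)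
  have "Z \<noteq> {}" using X(1) by (auto simp: Z_def Y_def)
  \<comment> \<open>X is covered by the translates of the image of \<open>N\<close> by
    \<open>F\<close>, so \<open>card Y\<close> is at most \<open>card F * card Z\<close>.\<close>
  have "Y \<subseteq> (\<lambda>(f, b). \<rho> (f + b)) ` (F \<times> Z)"
  proof
    fix y assume "y \<in> Y"
    then obtain x where x: "x \<in> X" "y = \<rho> x" by (auto simp: Y_def)
    obtain f s where fs: "f \<in> F" "s \<in> X" "x = f + N s" using F(3) x(1) by blast
    have "N s - N (\<rho> s) \<in> Xm" using N(3) [OF \<rho>(2) [OF fs(2)]] by (simp add: Ndiff)
    moreover have "N (\<rho> s) - \<rho> (N (\<rho> s)) \<in> Xm" using \<rho> N(2) fs(2) by blast
    ultimately have "x - (f + n (\<rho> s)) \<in> Xm"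
      using madd [of "N s - N (\<rho> s)" "N (\<rho> s) - \<rho> (N (\<rho> s))"] by (simp add: fs(3) n_def)
    then have "y = \<rho> (f + n (\<rho> s))" using \<rho>_eq x(2) by simp
    moreover have "n (\<rho> s) \<in> Z" using fs(2) by (auto simp: Z_def Y_def)
    ultimately show "y \<in> (\<lambda>(f, b). \<rho> (f + b)) ` (F \<times> Z)" using fs(1) by force
  qed
  then have "card Y \<le> card (F \<times> Z)"
    using F(1) finZ by (meson card_image_le card_mono finite_SigmaI finite_imageI le_trans)
  then have le: "card Y \<le> card F * card Z" by (simp add: card_cartesian_product)
  define g where "g = inv_into Y n"
  have g: "g b \<in> Y" "n (g b) = b" if "b \<in> Z" for b
    using that inv_into_into [of b n Y] f_inv_into_f [of b n Y] by (simp_all add: g_def Z_def)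
  \<comment> \<open>Were the kernel elements with indices 0, ..., \<open>card F\<close> distinct
    modulo \<open>Xm\<close>, every fibre over \<open>Z\<close> would have more than
    \<open>card F\<close> members, against the bound on \<open>card Y\<close>.\<close>
  have "inj_on (\<lambda>(b, t). \<rho> (g b + \<tau> t)) (Z \<times> {0..card F})"
  proof (rule inj_onI, clarify)
    fix b t b' t' assume h: "b \<in> Z" "b' \<in> Z" "t \<in> {0..card F}" "t' \<in> {0..card F}"
      and eq: "\<rho> (g b + \<tau> t) = \<rho> (g b' + \<tau> t')"
    have gX: "g b \<in> X" "g b' \<in> X" using g h YX by auto
    have d: "(g b + \<tau> t) - (g b' + \<tau> t') \<in> Xm"
      using eq gX by (intro \<rho>_eqD Xadd \<tau>) auto
    then have "N (g b) - N (g b') \<in> Xm"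
      using N(3) [OF d] by (simp add: Ndiff N(1) \<tau>(2))
    then have "n (g b) = n (g b')" using \<rho>_eq by (simp add: n_def)
    then have bb: "b = b'" using g h by simp
    then have "\<tau> t - \<tau> t' \<in> Xm" "\<tau> t' - \<tau> t \<in> Xm"
      using d mneg [OF d] by simp_all
    then have "t = t'" using contra h by (metis atLeastAtMost_iff nat_neq_iff)
    then show "b = b' \<and> t = t'" using bb by simp
  qed
  moreover have "(\<lambda>(b, t). \<rho> (g b + \<tau> t)) ` (Z \<times> {0..card F}) \<subseteq> Y"
  proof clarify
    fix b t assume "b \<in> Z"
    then have "g b + \<tau> t \<in> X" using g YX \<tau>(1) Xadd by blast
    then show "\<rho> (g b + \<tau> t) \<in> Y" by (simp add: Y_def)
  qed
  ultimately have "card (Z \<times> {0..card F}) \<le> card Y"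
    using finY card_inj_on_le by blast
  then have "card Z + card Z * card F \<le> card Y" by (simp add: card_cartesian_product)
  then have "card Z = 0" using le mult.commute [of "card F" "card Z"] by linarith
  then show False using \<open>Z \<noteq> {}\<close> finZ by simp
qed

definition smat :: "int \<Rightarrow> 'b::ring_1 ^ 'n ^ 'm \<Rightarrow> 'b ^ 'n ^ 'm"
  where "smat d M = (\<chi> k l. of_int d * M $ k $ l)"

definition svec :: "int \<Rightarrow> 'b::ring_1 ^ 'n \<Rightarrow> 'b ^ 'n"
  where "svec d v = (\<chi> k. of_int d * v $ k)"

lemma svec_component [simp]: "svec d v $ k = of_int d * v $ k"
  by (simp add: svec_def)

lemma smat_component [simp]: "smat d M $ k $ l = of_int d * M $ k $ l"
  by (simp add: smat_def)

lemma smat_mult: "smat c M ** smat d N = smat (c * d) (M ** N)"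
proof -
  have "of_int c * x * (of_int d * y) = of_int (c * d) * (x * y)" for x y :: 'a
    by (metis mult.assoc mult_of_int_commute of_int_mult)
  then show ?thesis
    by (simp add: vec_eq_iff matrix_matrix_mult_def sum_distrib_left del: of_int_mult)
qed

lemma smat_mat: "smat d (mat 1) = mat (of_int d)"
  by (simp add: vec_eq_iff mat_def)

lemma matrix_vector_svec: "M *v svec d v = svec d (M *v v)"
proof -
  have "M $ k $ l * (of_int d * v $ l) = of_int d * (M $ k $ l * v $ l)" for k l
    by (metis mult.assoc mult_of_int_commute)
  then show ?thesis
    by (simp add: vec_eq_iff matrix_vector_mult_def sum_distrib_left)
qed

lemma smat_vector: "smat d M *v v = svec d (M *v v)"
  by (simp add: vec_eq_iff matrix_vector_mult_def sum_distrib_left mult.assoc)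

lemma mat_vector: "mat c *v v = (\<chi> k. c * v $ k)"
  by (simp add: vec_eq_iff matrix_vector_mult_def mat_def if_distrib if_distribR cong: if_cong)

lemma mat_matrix: "mat c ** M = (\<chi> k l. c * M $ k $ l)"
  by (simp add: vec_eq_iff matrix_matrix_mult_def mat_def if_distrib if_distribR cong: if_cong)

lemma matrix_mat: "M ** mat c = (\<chi> k l. M $ k $ l * c)"
  by (simp add: vec_eq_iff matrix_matrix_mult_def mat_def if_distrib if_distribR cong: if_cong)

lemma matrix_vector_column: "(M *v axis l 1) $ k = M $ k $ l" for M :: "'b::ring_1 ^ 'n ^ 'm"
  by (simp add: matrix_vector_mult_def axis_def if_distrib if_distribR cong: if_cong)

lemma finite_vec_components:
  assumes "finite F" shows "finite {x :: 'b ^ 'n::finite. \<forall>k. x $ k \<in> F}"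
proof -
  have "finite ((\<lambda>f. (\<chi> k. f k) :: 'b ^ 'n) ` (UNIV \<rightarrow>\<^sub>E F))"
    using assms by (intro finite_imageI finite_PiE) simp_all
  then show ?thesis
  proof (rule finite_subset [rotated], intro subsetI)
    fix x :: "'b ^ 'n" assume "x \<in> {x. \<forall>k. x $ k \<in> F}"
    then show "x \<in> (\<lambda>f. (\<chi> k. f k) :: 'b ^ 'n) ` (UNIV \<rightarrow>\<^sub>E F)"
      by (intro image_eqI [of _ _ "\<lambda>k. x $ k"]) auto
  qed
qed

context maximal_quaternion_order
begin

definition OV :: "('h hat ^ 'g) set" where "OV = {x. \<forall>k. x $ k \<in> OH}"

lemma OV_iff: "x \<in> OV \<longleftrightarrow> (\<forall>k. x $ k \<in> OH)"
  by (simp add: OV_def)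

lemma OV_0 [simp]: "0 \<in> OV" and OV_diff: "x \<in> OV \<Longrightarrow> y \<in> OV \<Longrightarrow> x - y \<in> OV"
  and OV_add: "x \<in> OV \<Longrightarrow> y \<in> OV \<Longrightarrow> x + y \<in> OV"
  by (simp_all add: OV_iff OH_diff OH_add)

lemma OV_svec: "x \<in> OV \<Longrightarrow> svec d x \<in> OV"
  by (simp add: OV_iff OH_of_int_mult)

lemma OV_axis: "axis l 1 \<in> OV"
  by (simp add: OV_iff axis_def)

definition OM :: "('h hat ^ 'n ^ 'm) set" where "OM = {M. \<forall>k l. M $ k $ l \<in> OH}"

lemma OM_iff: "M \<in> OM \<longleftrightarrow> (\<forall>k l. M $ k $ l \<in> OH)"
  by (simp add: OM_def)

lemma OM_mult: "M \<in> OM \<Longrightarrow> N \<in> OM \<Longrightarrow> M ** N \<in> OM"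
  by (auto simp: OM_iff matrix_matrix_mult_def intro!: OH_sum OH_mult)

lemma OM_vector: "M \<in> OM \<Longrightarrow> x \<in> OV \<Longrightarrow> M *v x \<in> OV"
  by (auto simp: OM_iff OV_iff matrix_vector_mult_def intro!: OH_sum OH_mult)

lemma OM_dagger: "M \<in> OM \<Longrightarrow> dagger hc M \<in> OM"
  by (auto simp: OM_iff dagger_def transpose_def OH_hc)

lemma finite_hat_denominator:
  assumes "finite T" shows "\<exists>d>0. \<forall>t\<in>T. of_int d * t \<in> OH"
  using assms
proof induction
  case empty
  then show ?case by (intro exI [of _ 1]) simp
next
  case (insert t T)
  then obtain d where d: "d > 0" "\<And>s. s \<in> T \<Longrightarrow> of_int d * s \<in> OH" by blast
  obtain e where e: "e > 0" "of_int e * t \<in> OH" using hat_denominator by blast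
  have "of_int (d * e) * s \<in> OH" if "s \<in> insert t T" for s
    using that d(2) e(2) OH_of_int_mult [of "of_int e * t" d] OH_of_int_mult [of "of_int d * s" e]
    by (auto simp: mult.commute [of d e] simp flip: mult.assoc of_int_mult)
  then show ?case using d(1) e(1) by (intro exI [of _ "d * e"]) auto
qed

lemma matrix_denominator: "\<exists>d>0. smat d M \<in> OM" for M :: "'h hat ^ 'n::finite ^ 'm::finite"
  using finite_hat_denominator [of "range (\<lambda>(k, l). M $ k $ l)"] by (auto simp: OM_iff)

lemma OV_finite_quotient:
  assumes "n > 0"
  shows "\<exists>F. finite F \<and> F \<subseteq> (OV :: ('h hat ^ 'g::finite) set) \<and> (\<forall>x\<in>OV. \<exists>f\<in>F. \<exists>s\<in>OV. x = f + svec n s)"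
proof -
  obtain F where F: "finite F" "F \<subseteq> A" "\<And>x. x \<in> A \<Longrightarrow> \<exists>f\<in>F. x - f \<in> multiples n"
    using finite_quotient [OF assms] by blast
  let ?F = "{x :: 'h hat ^ 'g. \<forall>k. x $ k \<in> (\<lambda>f. tens f 1) ` F}"
  have comp: "\<exists>f\<in>(\<lambda>f. tens f 1) ` F. \<exists>s\<in>OH. t = f + of_int n * s" if t: "t \<in> OH" for t
  proof -
    obtain x s where xs: "x \<in> A" "s \<in> OH" "t = tens x 1 + of_int n * s" using OH_approx [OF assms t] by blast
    obtain f where f: "f \<in> F" "x - f \<in> multiples n" using F(3) xs(1) by blast
    obtain a where a: "a \<in> A" "x - f = of_int n * a" using f(2) by (rule multiplesE)
    have "tens x 1 = tens f 1 + of_int n * tens a (1 :: zhat)"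
      using a(2) by (simp add: of_int_mult_tens(1) tens_diff_left flip: a(2))
    then have "t = tens f 1 + of_int n * (tens a 1 + s)"
      by (simp add: xs(3) distrib_left)
    then show ?thesis using f(1) OH_add [OF OH_tens [OF a(1)] xs(2)] by blast
  qed
  have "\<exists>f\<in>?F. \<exists>s\<in>OV. x = f + svec n s" if x: "x \<in> OV" for x
  proof -
    have "\<forall>k. \<exists>f s. f \<in> (\<lambda>f. tens f 1) ` F \<and> s \<in> OH \<and> x $ k = f + of_int n * s"
      using comp x unfolding OV_iff by blast
    then obtain f s where fs: "\<And>k. f k \<in> (\<lambda>f. tens f 1) ` F" "\<And>k. s k \<in> OH"
      "\<And>k. x $ k = f k + of_int n * s k" by metis
    show ?thesis
      by (intro bexI [of _ "\<chi> k. f k"] bexI [of _ "\<chi> k. s k"])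
        (simp_all add: vec_eq_iff fs OV_iff)
  qed
  moreover have "finite ?F" using F(1) by (intro finite_vec_components) simp
  moreover have "x $ k \<in> OH" if x: "x \<in> ?F" for x k
  proof -
    obtain f where "f \<in> F" "x $ k = tens f 1" using x by blast
    then show ?thesis using F(2) OH_tens by auto
  qed
  then have "?F \<subseteq> OV" by (auto simp: OV_iff)
  ultimately show ?thesis by (intro exI [of _ ?F]) simp
qed

text \<open>The defect E = e - M'N' is annihilated by N'. For y in its image the multiples ty all
  lie in the kernel of N', and modulo any m two of them with small t collide. So a bounded multiple
  of y is divisible by m for every m, and y = 0.\<close>

lemma hat_left_inverse_imp_right_inverse:
  fixes M N :: "'h hat ^ 'g::finite ^ 'g"
  assumes "N ** M = mat 1"
  shows "M ** N = mat 1"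
proof -
  obtain d where d: "d > 0" "smat d M \<in> OM" using matrix_denominator by blast
  obtain d' where d': "d' > 0" "smat d' N \<in> OM" using matrix_denominator by blast
  define e where "e = d' * d"
  have e: "e > 0" using d d' by (simp add: e_def)
  define N' M' where "N' = smat d' N" and "M' = smat d M"
  have NM: "N' ** M' = mat (of_int e)" by (simp only: N'_def M'_def smat_mult assms e_def smat_mat)
  define E where "E = mat (of_int e) - M' ** N'"
  have "N' ** E = 0"
  proof -
    have "N' ** (M' ** N') = mat (of_int e) ** N'" by (simp add: matrix_mul_assoc NM)
    also have "\<dots> = N' ** mat (of_int e)" by (simp add: mat_matrix matrix_mat mult_of_int_commute)
    moreover have "N' ** (A - B) = N' ** A - N' ** B" for A B :: "'h hat ^ 'g ^ 'g"
      by (simp add: vec_eq_iff matrix_matrix_mult_def right_diff_distrib sum_subtractf)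
    ultimately show ?thesis by (simp add: E_def)
  qed
  have E0: "E *v w = 0" if w: "w \<in> OV" for w
  proof -
    define y where "y = E *v w"
    have "M' \<in> OM" "N' \<in> OM" using d d' by (simp_all add: M'_def N'_def)
    then have "E \<in> OM"
      using OM_mult [of M' N'] by (auto simp: E_def OM_iff mat_def intro!: OH_diff)
    then have yO: "y \<in> OV" using w by (simp add: y_def OM_vector)
    have Ny: "N' *v y = 0"
      by (simp add: y_def matrix_vector_mul_assoc \<open>N' ** E = 0\<close>)
    obtain F where F: "finite F" "F \<subseteq> (OV :: ('h hat ^ 'g) set)"
      "\<And>x. x \<in> OV \<Longrightarrow> \<exists>f\<in>F. \<exists>s\<in>OV. x = f + svec e s"
      using OV_finite_quotient [OF e] by blast
    \<comment> \<open>The image of N' contains e times the lattice \<open>OV\<close>, so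
      \<open>F\<close> also represents the cokernel of N'.\<close>
    have F': "\<exists>f\<in>F. \<exists>s\<in>OV. x = f + N' *v s" if x: "x \<in> OV" for x
    proof -
      obtain f s where fs: "f \<in> F" "s \<in> OV" "x = f + svec e s" using F(3) x by blast
      have "svec e s = N' *v (M' *v s)"
        by (simp add: matrix_vector_mul_assoc NM mat_vector svec_def)
      then show ?thesis
        using fs OM_vector [OF \<open>M' \<in> OM\<close> fs(2)] by (intro bexI [of _ f] bexI [of _ "M' *v s"]) simp_all
    qed
    \<comment> \<open>The colliding indices differ by at most \<open>card F\<close>; the factorial
      is a common multiple of all possible differences and does not depend on m.\<close>
    have "infinitely_divisible (of_int (fact (card F)) * y $ k)" for k
      unfolding infinitely_divisible_def
    proof (intro allI impI)
      fix m :: int assume m: "m > 0"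
      obtain Fm where Fm: "finite Fm" "\<And>x :: 'h hat ^ 'g. x \<in> OV \<Longrightarrow> \<exists>f\<in>Fm. \<exists>s\<in>OV. x = f + svec m s"
        using OV_finite_quotient [OF m] by blast
      have "\<exists>s t. s < t \<and> t \<le> card F \<and> svec (int t) y - svec (int s) y \<in> svec m ` OV"
      proof (rule kernel_elements_collide [where X = OV and N = "\<lambda>x. N' *v x" and Fm = Fm])
        show "0 \<in> svec m ` OV" by (intro image_eqI [of _ _ 0]) (simp_all add: vec_eq_iff)
        show "x - y \<in> svec m ` OV" if xy: "x \<in> svec m ` OV" "y \<in> svec m ` OV" for x y :: "'h hat ^ 'g"
        proof -
          obtain x' y' where "x' \<in> OV" "x = svec m x'" "y' \<in> OV" "y = svec m y'" using xy by blast
          then show ?thesis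
            by (intro image_eqI [of _ _ "x' - y'"]) (simp_all add: vec_eq_iff right_diff_distrib OV_diff)
        qed
        show "N' *v (x + y) = N' *v x + N' *v y" for x y by (rule matrix_vector_right_distrib)
        show "N' *v x \<in> svec m ` OV" if "x \<in> svec m ` OV" for x
          using that OM_vector [OF \<open>N' \<in> OM\<close>] by (auto simp: matrix_vector_svec)
        show "\<exists>f\<in>Fm. x - f \<in> svec m ` OV" if "x \<in> OV" for x
          using Fm(2) [OF that] by (auto intro!: bexI)
        show "N' *v svec (int t) y = 0" for t
          by (simp add: matrix_vector_svec Ny vec_eq_iff)
      qed (use OV_diff OV_svec OM_vector [OF \<open>N' \<in> OM\<close>] F F' Fm(1) yO in auto)
      then obtain s t x where st: "s < t" "t \<le> card F" "x \<in> OV" "svec (int t) y - svec (int s) y = svec m x" by blast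
      define r where "r = int t - int s"
      have "t - s dvd fact (card F)" using st(1,2) by (intro dvd_fact) simp_all
      then have "int (t - s) dvd int (fact (card F))" by (simp only: int_dvd_int_iff)
      then have "r dvd fact (card F)" using st(1) by (simp add: r_def of_nat_diff)
      then obtain c where c: "fact (card F) = c * r" by (metis dvd_def mult.commute)
      have "of_int r * y $ k = of_int m * x $ k"
        using st(4) by (simp add: vec_eq_iff r_def left_diff_distrib)
      then have "of_int (c * r) * y $ k = of_int c * (of_int m * x $ k)"
        by (simp add: mult.assoc)
      also have "\<dots> = of_int m * (of_int c * x $ k)"
        unfolding mult.assoc [symmetric] mult_of_int_commute [of c "of_int m"] ..
      finally have "of_int (fact (card F)) * y $ k = of_int m * (of_int c * x $ k)"
        unfolding c .
      moreover have "of_int c * x $ k \<in> OH" using st(3) by (simp add: OV_iff OH_of_int_mult)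
      ultimately show "\<exists>s\<in>OH. of_int (fact (card F)) * y $ k = of_int m * s" by blast
    qed
    then have "of_int (fact (card F)) * y $ k = 0" for k by (rule infinitely_divisible_eq_0)
    then have "y $ k = 0" for k using hat_of_int_eq_0 [of "fact (card F)" "y $ k"] by simp
    then show ?thesis by (simp add: vec_eq_iff y_def)
  qed
  have "E $ k $ l = 0" for k l
    using E0 [OF OV_axis] matrix_vector_column [of E l k] by simp
  then have "E = 0" by (simp add: vec_eq_iff)
  then have "smat (d * d') (M ** N) = mat (of_int e)"
    by (simp add: E_def M'_def N'_def smat_mult)
  then have "smat e (M ** N) = smat e (mat 1)" by (simp add: smat_mat e_def mult.commute)
  then show ?thesis using e by (simp add: vec_eq_iff hat_of_int_cancel)
qed

section \<open>Unitary similitudes\<close>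

lemma dagger_component [simp]: "dagger \<sigma> M $ k $ l = \<sigma> (M $ l $ k)"
  by (simp add: dagger_def transpose_def)

lemma dagger_mult: "dagger hc (M ** N) = dagger hc N ** dagger hc M"
  by (simp add: vec_eq_iff matrix_matrix_mult_def hc_sum hc_mult)

lemma dagger_mat: "dagger hc (mat c) = mat (hc c)"
  by (simp add: vec_eq_iff mat_def)

lemma dagger_dagger: "dagger hc (dagger hc M) = M"
  by (simp add: vec_eq_iff)

lemma mat_mult: "mat a ** mat b = (mat (a * b) :: 'b::ring_1 ^ 'n ^ 'n)"
  by (simp add: mat_matrix) (simp add: mat_def vec_eq_iff)

lemma mat_fixed_commute: "hc c = c \<Longrightarrow> mat c ** M = M ** mat c"
  by (simp add: mat_matrix matrix_mat vec_eq_iff) (metis hat_fixed_central)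

lemma GU_UNIV_E:
  assumes "M \<in> GU UNIV hc"
  obtains \<mu> \<nu> where "hc \<mu> = \<mu>" "hc \<nu> = \<nu>" "\<mu> * \<nu> = 1" "\<nu> * \<mu> = 1" "dagger hc M ** M = mat \<mu>"
  using assms by (auto simp: GU_def fixed_ring_def)

lemma GU_UNIV_I:
  assumes "hc \<mu> = \<mu>" "hc \<nu> = \<nu>" "\<mu> * \<nu> = 1" "dagger hc M ** M = mat \<mu>"
  shows "M \<in> GU UNIV hc"
  using assms hat_fixed_central [of \<mu> \<nu>] by (auto simp: GU_def fixed_ring_def)

lemma GU_OH_iff:
  "M \<in> GU OH hc \<longleftrightarrow> M \<in> OM \<and>
    (\<exists>\<mu>\<in>OH. \<exists>\<nu>\<in>OH. hc \<mu> = \<mu> \<and> hc \<nu> = \<nu> \<and> \<mu> * \<nu> = 1 \<and> dagger hc M ** M = mat \<mu>)"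
  unfolding GU_def fixed_ring_def OM_def using hat_fixed_central by fastforce

lemma GU_OH_subset: "M \<in> GU OH hc \<Longrightarrow> M \<in> GU UNIV hc"
  by (auto simp: GU_OH_iff intro: GU_UNIV_I)

lemma GU_mult:
  assumes "M \<in> GU UNIV hc" "N \<in> GU UNIV hc"
  shows "M ** N \<in> GU UNIV hc"
proof -
  obtain \<mu> \<nu> where M: "hc \<mu> = \<mu>" "hc \<nu> = \<nu>" "\<mu> * \<nu> = 1" "dagger hc M ** M = mat \<mu>"
    using assms(1) by (elim GU_UNIV_E)
  obtain \<mu>' \<nu>' where N: "hc \<mu>' = \<mu>'" "hc \<nu>' = \<nu>'" "\<mu>' * \<nu>' = 1" "dagger hc N ** N = mat \<mu>'"
    using assms(2) by (elim GU_UNIV_E)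
  show ?thesis
  proof (rule GU_UNIV_I)
    show "hc (\<mu> * \<mu>') = \<mu> * \<mu>'" "hc (\<nu>' * \<nu>) = \<nu>' * \<nu>"
      using M N hat_fixed_central by (simp_all add: hc_mult)
    show "\<mu> * \<mu>' * (\<nu>' * \<nu>) = 1"
      using M N by (metis mult.assoc mult_1_right)
    have "dagger hc (M ** N) ** (M ** N) = dagger hc N ** (dagger hc M ** M) ** N"
      by (simp add: dagger_mult matrix_mul_assoc)
    also have "\<dots> = mat \<mu> ** (dagger hc N ** N)"
      unfolding M(4) mat_fixed_commute [OF M(1), symmetric] by (simp add: matrix_mul_assoc)
    finally show "dagger hc (M ** N) ** (M ** N) = mat (\<mu> * \<mu>')"
      by (simp add: N(4) mat_mult)
  qed
qed

text \<open>The left inverse is immediate from the definition. That it is two-sided rests on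
  Dedekind finiteness, and this gives the inverse the multiplier \<open>\<nu>\<close>.\<close>

lemma similitude_inverse:
  fixes M :: "'h hat ^ 'g::finite ^ 'g"
  assumes \<mu>: "hc \<mu> = \<mu>" "hc \<nu> = \<nu>" "\<mu> * \<nu> = 1" "dagger hc M ** M = mat \<mu>"
  shows "(mat \<nu> ** dagger hc M) ** M = mat 1" "M ** (mat \<nu> ** dagger hc M) = mat 1"
    "mat \<nu> ** dagger hc M \<in> GU UNIV hc"
proof -
  have "\<nu> * \<mu> = 1" using \<mu> hat_fixed_central [of \<mu> \<nu>] by simp
  then show left: "(mat \<nu> ** dagger hc M) ** M = mat 1"
    by (simp add: \<mu>(4) mat_mult flip: matrix_mul_assoc)
  then show right: "M ** (mat \<nu> ** dagger hc M) = mat 1"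
    by (rule hat_left_inverse_imp_right_inverse)
  show "mat \<nu> ** dagger hc M \<in> GU UNIV hc"
  proof (rule GU_UNIV_I)
    have "dagger hc (mat \<nu> ** dagger hc M) ** (mat \<nu> ** dagger hc M) = M ** mat \<nu> ** (mat \<nu> ** dagger hc M)"
      by (simp add: dagger_mult dagger_dagger dagger_mat \<mu>(2))
    also have "\<dots> = mat \<nu> ** (M ** (mat \<nu> ** dagger hc M))"
      by (simp add: matrix_mul_assoc mat_fixed_commute [OF \<mu>(2), of M])
    finally show "dagger hc (mat \<nu> ** dagger hc M) ** (mat \<nu> ** dagger hc M) = mat \<nu>"
      by (simp add: right)
  qed (use \<mu> \<open>\<nu> * \<mu> = 1\<close> in auto)
qed

lemma GU_inverse:
  fixes M :: "'h hat ^ 'g::finite ^ 'g"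
  assumes "M \<in> GU UNIV hc"
  obtains N where "N \<in> GU UNIV hc" "N ** M = mat 1" "M ** N = mat 1"
  using assms by (elim GU_UNIV_E) (metis similitude_inverse)

lemma GU_OH_inverse:
  fixes M :: "'h hat ^ 'g::finite ^ 'g"
  assumes "M \<in> GU OH hc"
  obtains N where "N \<in> OM" "M ** N = mat 1"
proof -
  obtain \<mu> \<nu> where \<mu>: "M \<in> OM" "\<nu> \<in> OH" "hc \<mu> = \<mu>" "hc \<nu> = \<nu>" "\<mu> * \<nu> = 1" "dagger hc M ** M = mat \<mu>"
    using assms by (auto simp: GU_OH_iff)
  have "mat \<nu> ** dagger hc M \<in> OM"
    using \<mu>(1,2) OM_dagger [of M] by (auto simp: mat_matrix OM_iff OH_mult)
  then show ?thesis using similitude_inverse(2) [OF \<mu>(3-)] that by blast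
qed

text \<open>For integral P the product of P^dagger and P is integral, so the multiplier, being its
  diagonal entry, is integral. Applied to \<open>M\<close> and to \<open>N\<close> this gives an
  integral multiplier with integral inverse.\<close>

lemma GU_OH_I:
  fixes M N :: "'h hat ^ 'g::finite ^ 'g"
  assumes "M \<in> GU UNIV hc" "N \<in> GU UNIV hc" "N ** M = mat 1" "M \<in> OM" "N \<in> OM"
  shows "M \<in> GU OH hc"
proof -
  obtain \<mu> \<nu> where M: "hc \<mu> = \<mu>" "hc \<nu> = \<nu>" "\<mu> * \<nu> = 1" "dagger hc M ** M = mat \<mu>"
    using assms(1) by (elim GU_UNIV_E)
  obtain \<mu>' \<nu>' where N: "hc \<mu>' = \<mu>'" "hc \<nu>' = \<nu>'" "\<mu>' * \<nu>' = 1" "dagger hc N ** N = mat \<mu>'"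
    using assms(2) by (elim GU_UNIV_E)
  have scalar_OH: "c \<in> OH" if "P \<in> OM" "dagger hc P ** P = mat c" for P :: "'h hat ^ 'g ^ 'g" and c
  proof -
    have "(mat c :: 'h hat ^ 'g ^ 'g) \<in> OM" using that OM_mult [OF OM_dagger] by metis
    then have "(mat c :: 'h hat ^ 'g ^ 'g) $ k $ k \<in> OH" for k by (simp only: OM_iff)
    then show ?thesis by (simp add: mat_def)
  qed
  have "mat 1 = dagger hc (N ** M) ** (N ** M)" by (simp add: assms(3) dagger_mat)
  also have "\<dots> = dagger hc M ** (dagger hc N ** N) ** M" by (simp add: dagger_mult matrix_mul_assoc)
  also have "\<dots> = mat \<mu>' ** (dagger hc M ** M)"
    unfolding N(4) mat_fixed_commute [OF N(1), symmetric] by (simp add: matrix_mul_assoc)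
  finally have "mat 1 = (mat (\<mu>' * \<mu>) :: 'h hat ^ 'g ^ 'g)" by (simp add: M(4) mat_mult)
  then have "(mat 1 :: 'h hat ^ 'g ^ 'g) $ k $ k = mat (\<mu>' * \<mu>) $ k $ k" for k by simp
  then have "\<mu> * \<mu>' = 1" using hat_fixed_central [OF N(1)] by (simp add: mat_def)
  then show ?thesis
    using M N scalar_OH assms(4,5) unfolding GU_OH_iff by blast
qed

section \<open>The lattice of a similitude\<close>

lemma gamma_iff: "v \<in> gamma A M \<longleftrightarrow> (\<exists>x\<in>OV. hat_vec v = M *v x)"
  by (auto simp: gamma_def OV_def)

lemma gamma_inverse_iff:
  assumes "N ** M = mat 1" "M ** N = mat 1"
  shows "v \<in> gamma A M \<longleftrightarrow> N *v hat_vec v \<in> OV"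
proof
  assume "v \<in> gamma A M"
  then show "N *v hat_vec v \<in> OV" using assms by (auto simp: gamma_iff matrix_vector_mul_assoc)
next
  assume "N *v hat_vec v \<in> OV"
  then show "v \<in> gamma A M"
    unfolding gamma_iff using assms
    by (intro bexI [of _ "N *v hat_vec v"]) (simp_all add: matrix_vector_mul_assoc)
qed

lemma gamma_mult_GU_OH:
  fixes M P :: "'h hat ^ 'g::finite ^ 'g"
  assumes "P \<in> GU OH hc"
  shows "gamma A (M ** P) = gamma A M"
proof -
  obtain Q where Q: "Q \<in> OM" "P ** Q = mat 1" using assms by (rule GU_OH_inverse)
  have P: "P \<in> OM" using assms by (simp add: GU_OH_iff)
  have "(\<exists>x\<in>OV. w = M *v (P *v x)) \<longleftrightarrow> (\<exists>x\<in>OV. w = M *v x)" for w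
  proof
    assume "\<exists>x\<in>OV. w = M *v x"
    then obtain x where "x \<in> OV" "w = M *v x" by blast
    moreover have "P *v (Q *v x) = x" for x by (simp add: matrix_vector_mul_assoc Q)
    ultimately show "\<exists>x\<in>OV. w = M *v (P *v x)" using OM_vector [OF Q(1)] by metis
  qed (use OM_vector [OF P] in blast)
  then show ?thesis by (auto simp: gamma_iff simp flip: matrix_vector_mul_assoc)
qed

text \<open>A rational vector close to \<open>M *v x\<close> lies in the lattice as soon as the
  error is divisible by \<open>d\<close>, which clears the denominators of \<open>N\<close>; the
  precision \<open>d * n\<close> provides this and the required congruence.\<close>

lemma gamma_dense:
  fixes M N :: "'h hat ^ 'g::finite ^ 'g"
  assumes "N ** M = mat 1" "M ** N = mat 1" and n: "n > 0" and x: "x \<in> OV"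
  shows "\<exists>v\<in>gamma A M. \<exists>s\<in>OV. M *v x = hat_vec v + svec n s"
proof -
  obtain d where d: "d > 0" "smat d N \<in> OM" using matrix_denominator by blast
  have "\<forall>k. \<exists>v s. s \<in> OH \<and> (M *v x) $ k = tens v 1 + of_int (d * n) * s"
    using hat_approx [of "d * n"] d(1) n by (metis mult_pos_pos)
  then obtain v s where vs: "\<And>k. s k \<in> OH" "\<And>k. (M *v x) $ k = tens (v k) 1 + of_int (d * n) * s k"
    by metis
  define v' s' where "v' = (\<chi> k. v k)" and "s' = (\<chi> k. of_int n * s k)"
  have s': "s' \<in> OV" using vs(1) by (simp add: s'_def OV_iff OH_of_int_mult)
  have "M *v x = hat_vec v' + svec d s'"
    by (simp add: vec_eq_iff vs(2) v'_def s'_def hat_vec_def mult.assoc)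
  then have "N *v (M *v x) = N *v hat_vec v' + smat d N *v s'"
    by (simp add: matrix_vector_right_distrib matrix_vector_svec smat_vector)
  then have "N *v hat_vec v' = x - smat d N *v s'"
    by (simp add: matrix_vector_mul_assoc assms)
  then have "N *v hat_vec v' \<in> OV" using x OM_vector [OF d(2) s'] by (simp add: OV_diff)
  then have "v' \<in> gamma A M" using gamma_inverse_iff assms by blast
  moreover have "M *v x = hat_vec v' + svec n (\<chi> k. of_int d * s k)"
    by (simp add: vec_eq_iff vs(2) v'_def hat_vec_def mult.commute [of d n] flip: mult.assoc of_int_mult)
  moreover have "(\<chi> k. of_int d * s k) \<in> OV" using vs(1) by (simp add: OV_iff OH_of_int_mult)
  ultimately show ?thesis by blast
qed

text \<open>Columns are tested on axis vectors: N' maps the approximating lattice vector into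
  \<open>OV\<close> by the inclusion, and the error too, because \<open>d\<close> clears the
  denominators of N'.\<close>

lemma gamma_subset_imp_OM:
  fixes M N M' N' :: "'h hat ^ 'g::finite ^ 'g"
  assumes M: "N ** M = mat 1" "M ** N = mat 1" and M': "N' ** M' = mat 1" "M' ** N' = mat 1"
    and sub: "gamma A M \<subseteq> gamma A M'"
  shows "N' ** M \<in> OM"
proof -
  obtain d where d: "d > 0" "smat d N' \<in> OM" using matrix_denominator by blast
  have "(N' ** M) $ k $ l \<in> OH" for k l
  proof -
    obtain v s where v: "v \<in> gamma A M" "s \<in> OV" "M *v axis l 1 = hat_vec v + svec d s"
      using gamma_dense [OF M d(1) OV_axis] by blast
    have "(N' ** M) *v axis l 1 = N' *v (M *v axis l 1)"
      by (simp add: matrix_vector_mul_assoc)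
    also have "\<dots> = N' *v hat_vec v + smat d N' *v s"
      by (simp add: v(3) matrix_vector_right_distrib matrix_vector_svec smat_vector)
    also have "\<dots> \<in> OV"
      using v sub gamma_inverse_iff [OF M'] OM_vector [OF d(2) v(2)] by (intro OV_add) auto
    finally show ?thesis using matrix_vector_column [of "N' ** M" l k] by (metis OV_iff)
  qed
  then show ?thesis by (simp add: OM_iff)
qed

lemma gamma_eq_imp:
  fixes M M' :: "'h hat ^ 'g::finite ^ 'g"
  assumes "M \<in> GU UNIV hc" "M' \<in> GU UNIV hc" "gamma A M = gamma A M'"
  shows "\<exists>P\<in>GU OH hc. M' = M ** P"
proof -
  obtain N where N: "N \<in> GU UNIV hc" "N ** M = mat 1" "M ** N = mat 1" using assms(1) by (rule GU_inverse)
  obtain N' where N': "N' \<in> GU UNIV hc" "N' ** M' = mat 1" "M' ** N' = mat 1" using assms(2) by (rule GU_inverse)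
  have "N ** M' \<in> GU OH hc"
  proof (rule GU_OH_I)
    show "N ** M' \<in> GU UNIV hc" "N' ** M \<in> GU UNIV hc" using GU_mult N(1) N'(1) assms by auto
    show "N' ** M ** (N ** M') = mat 1"
      by (metis N'(2) N(3) matrix_mul_assoc matrix_mul_lid)
    show "N ** M' \<in> OM" "N' ** M \<in> OM"
      using gamma_subset_imp_OM [OF N'(2,3) N(2,3)] gamma_subset_imp_OM [OF N(2,3) N'(2,3)] assms(3)
      by auto
  qed
  moreover have "M' = M ** (N ** M')" by (simp add: matrix_mul_assoc N)
  ultimately show ?thesis by blast
qed

end

section \<open>The hermitian form on rational and on adelic vectors\<close>

context quaternion_algebra
begin

abbreviation h0 :: "'h ^ 'g::finite \<Rightarrow> 'h ^ 'g \<Rightarrow> 'h" where "h0 \<equiv> H0 i j"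

lemma h0_add_left: "h0 (x + y) z = h0 x z + h0 y z"
  and h0_add_right: "h0 z (x + y) = h0 z x + h0 z y"
  and h0_diff_right: "h0 z (x - y) = h0 z x - h0 z y"
  by (simp_all add: H0_def cj_add cj_diff algebra_simps sum.distrib sum_subtractf)

lemma h0_0_right [simp]: "h0 z 0 = 0"
  by (simp add: H0_def)

lemma h0_sum_right: "h0 z (sum f I) = (\<Sum>k\<in>I. h0 z (f k))"
  by (induction I rule: infinite_finite_induct) (simp_all add: h0_add_right)

lemma h0_mult_right: "h0 x (\<chi> k. y $ k * a) = h0 x y * a"
  by (simp add: H0_def sum_distrib_right mult.assoc)

lemma cj_h0: "cj (h0 x y) = h0 y x"
  by (simp add: H0_def cj_sum cj_mult)

lemma h0_axis: "h0 x (axis k a) = cj (x $ k) * a"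
  by (simp add: H0_def axis_def if_distrib cong: if_cong)

definition hdot :: "'h hat ^ 'g::finite \<Rightarrow> 'h hat ^ 'g \<Rightarrow> 'h hat"
  where "hdot x y = (\<Sum>k\<in>UNIV. hc (x $ k) * y $ k)"

lemma hdot_hat_vec: "hdot (hat_vec x) (hat_vec y) = tens (h0 x y) 1"
  by (simp add: hdot_def hat_vec_def H0_def tens_mult tens_sum_left)

lemma hdot_add_right: "hdot x (y + z) = hdot x y + hdot x z"
  by (simp add: hdot_def distrib_left sum.distrib)

lemma hdot_adjoint: "hdot (M *v x) y = hdot x (dagger hc M *v y)"
proof -
  have "hdot (M *v x) y = (\<Sum>k\<in>UNIV. \<Sum>l\<in>UNIV. hc (x $ l) * (hc (M $ k $ l) * y $ k))"
    by (simp add: hdot_def matrix_vector_mult_def hc_sum hc_mult sum_distrib_right mult.assoc)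
  also have "\<dots> = (\<Sum>l\<in>UNIV. \<Sum>k\<in>UNIV. hc (x $ l) * (hc (M $ k $ l) * y $ k))"
    by (rule sum.swap)
  finally show ?thesis
    by (simp add: hdot_def matrix_vector_mult_def sum_distrib_left dagger_def transpose_def)
qed

lemma hdot_mat: "hc c = c \<Longrightarrow> hdot x (mat c *v y) = c * hdot x y"
proof -
  assume c: "hc c = c"
  have "hc (x $ k) * (c * y $ k) = c * (hc (x $ k) * y $ k)" for k
    by (simp only: mult.assoc [symmetric] hat_fixed_central [OF c, of "hc (x $ k)"])
  then show ?thesis by (simp add: hdot_def mat_vector sum_distrib_left)
qed

end

section \<open>Lattices as right modules, and the polarization of the lattice of a
  similitude\<close>

lemma hat_vec_component: "hat_vec v $ k = tens (v $ k) 1"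
  by (simp add: hat_vec_def)

lemma vec_sum_axis: "v = (\<Sum>k\<in>UNIV. axis k (v $ k :: 'b::comm_monoid_add))"
  by (simp add: vec_eq_iff axis_def if_distrib cong: if_cong)

lemma axis_0: "axis k (0 :: 'b::zero) = 0"
  by (simp add: vec_eq_iff axis_def)

lemma axis_diff: "axis k (a - b :: 'b::ab_group_add) = axis k a - axis k b"
  by (simp add: vec_eq_iff axis_def)

lemma vscaleQ_of_int: "vscaleQ (of_int n) v = (\<chi> k. of_int n * v $ k)"
  by (simp add: vscaleQ_def scaleQ_def)

context maximal_quaternion_order
begin

lemma submodule_mult: "right_submodule A L \<Longrightarrow> v \<in> L \<Longrightarrow> a \<in> A \<Longrightarrow> (\<chi> k. v $ k * a) \<in> L"
  by (simp add: right_submodule_def)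

lemma submodule_0: "right_submodule A L \<Longrightarrow> 0 \<in> L"
  and submodule_add: "right_submodule A L \<Longrightarrow> v \<in> L \<Longrightarrow> w \<in> L \<Longrightarrow> v + w \<in> L"
  by (simp_all add: right_submodule_def)

lemma submodule_of_int: "right_submodule A L \<Longrightarrow> v \<in> L \<Longrightarrow> (\<chi> k. of_int n * v $ k) \<in> L"
  using submodule_mult [of L v "of_int n"] by (simp add: mult_of_int_commute)

lemma submodule_diff: "right_submodule A L \<Longrightarrow> v \<in> L \<Longrightarrow> w \<in> L \<Longrightarrow> v - w \<in> L"
proof -
  assume L: "right_submodule A L" "v \<in> L" "w \<in> L"
  have "v - w = v + (\<chi> k. of_int (- 1) * w $ k)" by (simp add: vec_eq_iff)
  also have "\<dots> \<in> L" by (intro submodule_add submodule_of_int L)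
  finally show ?thesis .
qed

lemma submodule_sum: "right_submodule A L \<Longrightarrow> (\<And>k. k \<in> I \<Longrightarrow> f k \<in> L) \<Longrightarrow> sum f I \<in> L"
  by (induction I rule: infinite_finite_induct) (auto intro: submodule_0 submodule_add)

lemma right_submodule_hull: "right_submodule A (right_submodule A hull S)"
  by (rule hull_in) (auto simp: right_submodule_def)

lemma hull_eq_group_closure:
  assumes "right_submodule A (group_closure T)"
  shows "right_submodule A hull T = group_closure T"
proof
  show "right_submodule A hull T \<subseteq> group_closure T"
    using assms by (intro hull_minimal) (auto intro: group_closure.base)
  show "group_closure T \<subseteq> right_submodule A hull T"
    by (intro group_closure_subset hull_subset submodule_0 submodule_diff right_submodule_hull)
qed

text \<open>The sandwich argument between (1/n)A^g and nA^g, which explains the factor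
  \<open>n * n\<close>.\<close>

lemma lattice_finitely_generated:
  fixes L :: "('h ^ 'g::finite) set"
  assumes L: "right_submodule A L" and n: "n > 0"
    and upper: "\<And>v k. v \<in> L \<Longrightarrow> of_int n * v $ k \<in> A"
    and lower: "\<And>k a. a \<in> A \<Longrightarrow> axis k (of_int n * a) \<in> L"
  shows "\<exists>T. finite T \<and> L = group_closure T"
proof -
  obtain S where S: "finite S" "A = group_closure S" by (rule A_gens)
  let ?S = "(\<lambda>(k, s). axis k (inverse (of_int n) * s) :: 'h ^ 'g) ` (UNIV \<times> S)"
  have ax: "axis k (inverse (of_int n) * a) \<in> group_closure ?S" if "a \<in> A" for k a
    using that unfolding S(2)
  proof induction
    case (base s)
    then consider "s = 0" | "s \<in> S" by blast
    then show ?case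
    proof cases
      case 2
      then show ?thesis by (intro group_closure.base insertI2 image_eqI [of _ _ "(k, s)"]) simp_all
    qed (simp add: axis_0)
  next
    case (diff s t)
    then show ?case by (simp add: right_diff_distrib axis_diff group_closure.diff)
  qed
  show ?thesis
  proof (rule rat_vec.group_closure_sandwich [of ?S "n * n" L])
    show "finite ?S" using S(1) by simp
    show "n * n > 0" using n by simp
    show "L \<subseteq> group_closure ?S"
    proof
      fix v assume v: "v \<in> L"
      have "axis k (v $ k) \<in> group_closure ?S" for k
        using ax [OF upper [OF v], of k k] n by (simp add: inverse_of_int_mult)
      then have "(\<Sum>k\<in>UNIV. axis k (v $ k)) \<in> group_closure ?S" by (intro group_closure_sum_mem)
      then show "v \<in> group_closure ?S" by (simp flip: vec_sum_axis)
    qed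
    show "vscaleQ (of_int (n * n)) x \<in> L" if xS: "x \<in> ?S" for x
    proof -
      obtain k s where s: "s \<in> S" and x: "x = axis k (inverse (of_int n) * s)" using xS by auto
      have "of_int (n * n) * (inverse (of_int n) * s) = of_int n * s"
        using n by (simp add: mult.assoc inverse_of_int_mult)
      then have "vscaleQ (of_int (n * n)) x = axis k (of_int n * s)"
        unfolding x vscaleQ_of_int by (simp add: vec_eq_iff axis_def)
      moreover have "s \<in> A" unfolding S(2) using s by (auto intro: group_closure.base)
      ultimately show ?thesis using lower by simp
    qed
  qed (use submodule_0 submodule_diff L in auto)
qed

lemma lattice_span:
  fixes L :: "('h ^ 'g::finite) set"
  assumes n: "n > 0" and lower: "\<And>k a. a \<in> A \<Longrightarrow> axis k (of_int n * a) \<in> L"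
  shows "rat_vec.span L = UNIV"
proof -
  have "axis k x \<in> rat_vec.span L" for k x
  proof -
    obtain m where m: "m > 0" "of_int m * x \<in> A" using A_denominator by blast
    have "axis k (of_int n * (of_int m * x)) \<in> rat_vec.span L"
      using lower [OF m(2)] by (rule rat_vec.span_base)
    then have "vscaleQ (inverse (of_int (n * m))) (axis k (of_int n * (of_int m * x))) \<in> rat_vec.span L"
      by (rule rat_vec.span_scale)
    moreover have "scaleQ (inverse (of_int (n * m))) (of_int n * (of_int m * x)) = x"
      using n m(1) inverse_of_int_mult(2) [of "n * m" x]
      by (simp add: scaleQ_def of_Q_inverse_of_int mult.assoc del: of_int_mult) (simp add: mult.assoc)
    then have "vscaleQ (inverse (of_int (n * m))) (axis k (of_int n * (of_int m * x))) = axis k x"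
      by (simp add: vec_eq_iff vscaleQ_def axis_def)
    ultimately show ?thesis by simp
  qed
  then have "(\<Sum>k\<in>UNIV. axis k (v $ k)) \<in> rat_vec.span L" for v :: "'h ^ 'g"
    by (intro rat_vec.span_sum)
  then show ?thesis by (metis UNIV_eq_I vec_sum_axis)
qed

lemma right_linear_sum:
  assumes "right_linear_on A L f" "right_submodule A L" "\<And>k. k \<in> I \<Longrightarrow> g k \<in> L"
  shows "f (sum g I) = (\<Sum>k\<in>I. f (g k))"
proof -
  have add: "f (v + w) = f v + f w" if "v \<in> L" "w \<in> L" for v w
    using assms(1) that by (simp add: right_linear_on_def)
  have "f 0 = 0" using add [of 0 0] submodule_0 [OF assms(2)] by simp
  then show ?thesis
    using assms(3)
    by (induction I rule: infinite_finite_induct) (simp_all add: add submodule_sum [OF assms(2)])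
qed

lemma gamma_submodule: "right_submodule A (gamma A M)"
  unfolding right_submodule_def gamma_iff
proof (intro conjI ballI)
  show "\<exists>x\<in>OV. hat_vec 0 = M *v x"
    by (intro bexI [of _ 0]) (simp_all add: vec_eq_iff hat_vec_def matrix_vector_mult_def)
  fix v w assume "v \<in> gamma A M" "w \<in> gamma A M"
  then obtain x y where "x \<in> OV" "hat_vec v = M *v x" "y \<in> OV" "hat_vec w = M *v y"
    by (auto simp: gamma_iff)
  then show "\<exists>x\<in>OV. hat_vec (v + w) = M *v x"
    by (intro bexI [of _ "x + y"])
      (simp_all add: OV_add matrix_vector_right_distrib vec_eq_iff hat_vec_component tens_add_left)
next
  fix v a assume "v \<in> gamma A M" and a: "a \<in> A"
  then obtain x where x: "x \<in> OV" "hat_vec v = M *v x" by (auto simp: gamma_iff)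
  have "tens (v $ k) 1 = (M *v x) $ k" for k using x(2) by (metis hat_vec_component)
  moreover have "tens (v $ k * a) 1 = tens (v $ k) 1 * tens a (1 :: zhat)" for k
    by (simp add: tens_mult)
  ultimately have "tens (v $ k * a) 1 = (\<Sum>l\<in>UNIV. M $ k $ l * x $ l) * tens a 1" for k
    by (simp add: matrix_vector_mult_def)
  then show "\<exists>x\<in>OV. hat_vec (\<chi> k. v $ k * a) = M *v x"
    using x(1) a
    by (intro bexI [of _ "\<chi> l. x $ l * tens a 1"])
      (simp_all add: vec_eq_iff hat_vec_component OV_iff OH_mult OH_tens matrix_vector_mult_def sum_distrib_right mult.assoc)
qed

lemma gamma_principally_polarized:
  fixes M :: "'h hat ^ 'g::finite ^ 'g"
  assumes "M \<in> GU UNIV hc"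
  shows "principally_polarized i j A (gamma A M)"
proof -
  let ?L = "gamma A M"
  obtain \<mu> \<nu> where \<mu>: "hc \<mu> = \<mu>" "hc \<nu> = \<nu>" "\<mu> * \<nu> = 1" "\<nu> * \<mu> = 1" "dagger hc M ** M = mat \<mu>"
    using assms by (rule GU_UNIV_E)
  define N where "N = mat \<nu> ** dagger hc M"
  have N: "N ** M = mat 1" "M ** N = mat 1"
    using similitude_inverse [OF \<mu>(1-3,5)] by (simp_all add: N_def)
  obtain q u u' where q: "q \<noteq> 0" "u * u' = 1" "\<mu> = tens (of_Q q) u"
    using hat_unit_rational_times_unit [OF \<mu>(1-3)] by blast
  define c where "c = inverse q"
  define C :: "'h hat" where "C = tens (of_Q c) 1"
  have cq: "of_Q c * of_Q q = (1 :: 'h)" using q(1) by (simp add: c_def flip: of_Q_mult)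
  have C: "hc C = C" by (simp add: C_def)
  have C\<mu>: "C * \<mu> = tens 1 u" by (simp add: C_def q(3) tens_mult cq)
  have uu: "tens 1 u * tens 1 u' = (1 :: 'h hat)" by (simp add: tens_mult q(2) one_tensor_def)
  have "\<nu> = \<nu> * (C * \<mu> * tens 1 u')" by (simp add: C\<mu> uu)
  also have "\<dots> = C * (\<nu> * \<mu>) * tens 1 u'" by (simp only: mult.assoc [symmetric] hat_fixed_central [OF C, of \<nu>])
  finally have \<nu>: "\<nu> = C * tens 1 u'" by (simp add: \<mu>(4))
  obtain d1 where d1: "d1 > 0" "smat d1 M \<in> OM" using matrix_denominator by blast
  obtain d2 where d2: "d2 > 0" "smat d2 N \<in> OM" using matrix_denominator by blast
  define n where "n = d1 * d2"
  have n: "n > 0" using d1 d2 by (simp add: n_def)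
  have upper: "of_int n * v $ k \<in> A" if v: "v \<in> ?L" for v k
  proof -
    obtain x where x: "x \<in> OV" "hat_vec v = M *v x" using v by (auto simp: gamma_iff)
    have "svec d1 (hat_vec v) = smat d1 M *v x" by (simp add: x(2) smat_vector)
    then have "svec d1 (hat_vec v) \<in> OV" using OM_vector [OF d1(2) x(1)] by simp
    then have "tens (of_int d1 * v $ k) 1 \<in> OH" by (simp add: OV_iff hat_vec_component of_int_mult_tens(1))
    then have "of_int d1 * v $ k \<in> A" by (simp add: OH_Int_H)
    then have "of_int d2 * (of_int d1 * v $ k) \<in> A" by (rule A_of_int_mult)
    then show ?thesis by (simp add: n_def mult.commute [of d1 d2] flip: mult.assoc of_int_mult)
  qed
  have lower: "axis k (of_int n * a) \<in> ?L" if a: "a \<in> A" for k a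
  proof -
    have "hat_vec (axis k (of_int n * a)) = svec d2 (\<chi> l. of_int d1 * (if l = k then tens a 1 else 0))"
      by (simp add: vec_eq_iff hat_vec_component axis_def of_int_mult_tens(1) n_def mult.commute [of d1 d2] mult.assoc)
    then have "N *v hat_vec (axis k (of_int n * a)) = smat d2 N *v (\<chi> l. of_int d1 * (if l = k then tens a 1 else 0))"
      by (simp add: matrix_vector_svec smat_vector)
    also have "\<dots> \<in> OV"
      by (intro OM_vector d2) (simp add: OV_iff OH_of_int_mult OH_tens a)
    finally show ?thesis using gamma_inverse_iff [OF N] by blast
  qed
  have Lsub: "right_submodule A ?L" by (rule gamma_submodule)
  obtain T where T: "finite T" "?L = group_closure T"
    using lattice_finitely_generated [OF Lsub n upper lower] by blast
  then have fg: "\<exists>S. finite S \<and> ?L = right_submodule A hull S"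
    using hull_eq_group_closure Lsub by metis
  have val: "scaleQ c (h0 x y) \<in> A" if xy: "x \<in> ?L" "y \<in> ?L" for x y
  proof -
    obtain a b where ab: "a \<in> OV" "hat_vec x = M *v a" "b \<in> OV" "hat_vec y = M *v b"
      using xy by (auto simp: gamma_iff)
    have "tens (scaleQ c (h0 x y)) 1 = C * hdot (hat_vec x) (hat_vec y)"
      by (simp add: hdot_hat_vec C_def tens_mult scaleQ_def)
    also have "\<dots> = C * (\<mu> * hdot a b)"
      by (simp add: ab hdot_adjoint matrix_vector_mul_assoc \<mu>(5) hdot_mat [OF \<mu>(1)])
    also have "\<dots> = tens 1 u * hdot a b" by (simp add: C\<mu> flip: mult.assoc)
    also have "\<dots> \<in> OH"
      using ab unfolding hdot_def OV_iff by (intro OH_mult OH_tens OH_sum OH_hc) auto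
    finally show ?thesis by (simp add: OH_Int_H)
  qed
  have rep: "\<exists>!x. x \<in> ?L \<and> (\<forall>y\<in>?L. f y = scaleQ c (h0 x y))"
    if f: "right_linear_on A ?L f" "f ` ?L \<subseteq> A" for f
  proof (rule ex_ex1I)
    have axL: "axis k (of_int n) \<in> ?L" for k using lower [of 1 k] by simp
    define a where "a = (\<lambda>k. f (axis k (of_int n)))"
    \<comment> \<open>The entries of \<open>a\<close>, divided by n, are the coefficients of the
      linear form f; conjugation moves them into the first argument of the hermitian form, and the
      factor q cancels c.\<close>
    define x where "x = (\<chi> k. cj (a k * inverse (of_int n)) * of_Q q)"
    have fx: "f y = scaleQ c (h0 x y)" if y: "y \<in> ?L" for y
    proof -
      \<comment> \<open>The factor \<open>n * n\<close> is split between the axis vector, which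
        thereby lies in the lattice, and its coefficient, which thereby lies in A.\<close>
      have "(\<chi> k. y $ k * of_int (n * n)) = (\<Sum>k\<in>UNIV. \<chi> l. axis k (of_int n) $ l * (of_int n * y $ k))"
        by (simp add: vec_eq_iff axis_def if_distrib if_distribR cong: if_cong)
          (metis mult.assoc mult_of_int_commute)
      then have "f (\<chi> k. y $ k * of_int (n * n)) = (\<Sum>k\<in>UNIV. f (\<chi> l. axis k (of_int n) $ l * (of_int n * y $ k)))"
        by (simp only:) (intro right_linear_sum [OF f(1) Lsub] submodule_mult [OF Lsub axL] upper y)
      also have "\<dots> = (\<Sum>k\<in>UNIV. a k * (of_int n * y $ k))"
        using f(1) axL upper [OF y] by (simp add: right_linear_on_def a_def)
      also have "f (\<chi> k. y $ k * of_int (n * n)) = f y * of_int (n * n)"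
        using f(1) y A_of_int [of "n * n"] unfolding right_linear_on_def by blast
      finally have "of_int (n * n) * f y = (\<Sum>k\<in>UNIV. a k * (of_int n * y $ k))"
        by (simp only: mult_of_int_commute)
      also have "\<dots> = of_int (n * n) * (\<Sum>k\<in>UNIV. a k * inverse (of_int n) * y $ k)"
        unfolding sum_distrib_left
      proof (rule sum.cong [OF refl])
        fix k
        have "of_int (n * n) * (a k * inverse (of_int n) * y $ k) = of_int n * (of_int n * inverse (of_int n)) * (a k * y $ k)"
          unfolding of_int_mult of_int_commute_inverse [of n "a k", symmetric] by (simp only: mult.assoc)
        then show "a k * (of_int n * y $ k) = of_int (n * n) * (a k * inverse (of_int n) * y $ k)"
          using n by simp (metis mult.assoc mult_of_int_commute)
      qed
      finally have "f y = (\<Sum>k\<in>UNIV. a k * inverse (of_int n) * y $ k)" using n by simp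
      also have "\<dots> = (\<Sum>k\<in>UNIV. of_Q c * (cj (x $ k) * y $ k))"
      proof (rule sum.cong [OF refl])
        fix k
        have "of_Q c * (cj (x $ k) * y $ k) = of_Q c * of_Q q * (a k * inverse (of_int n) * y $ k)"
          by (simp add: x_def cj_mult mult.assoc)
        then show "a k * inverse (of_int n) * y $ k = of_Q c * (cj (x $ k) * y $ k)" by (simp add: cq)
      qed
      finally show ?thesis by (simp add: scaleQ_def H0_def sum_distrib_left)
    qed
    \<comment> \<open>The l-th entry is, up to the unit u', the conjugate of the scaled form at x
      and the l-th column of M. That column is a lattice vector v plus an error divisible by m; on v
      the form takes the value f v in A.\<close>
    have "N *v hat_vec x \<in> OV"
      unfolding OV_iff
    proof
      fix l
      obtain m where m: "m > 0" "\<And>k. of_int m * (C * hc (hat_vec x $ k)) \<in> OH"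
        using finite_hat_denominator [of "range (\<lambda>k. C * hc (hat_vec x $ k))"] by auto
      obtain v s where v: "v \<in> ?L" "s \<in> OV" "M *v axis l 1 = hat_vec v + svec m s"
        using gamma_dense [OF N m(1) OV_axis] by blast
      have "C * hdot (hat_vec x) (M *v axis l 1) = C * tens (h0 x v) 1 + C * hdot (hat_vec x) (svec m s)"
        by (simp add: v(3) hdot_add_right hdot_hat_vec distrib_left)
      also have "C * tens (h0 x v) 1 = tens (f v) 1"
        by (simp add: fx [OF v(1)] C_def tens_mult scaleQ_def)
      also have "C * hdot (hat_vec x) (svec m s) = (\<Sum>k\<in>UNIV. of_int m * (C * hc (hat_vec x $ k)) * s $ k)"
        unfolding hdot_def sum_distrib_left svec_component
        by (rule sum.cong [OF refl]) (metis mult.assoc mult_of_int_commute)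
      also have "tens (f v) 1 + \<dots> \<in> OH"
      proof (intro OH_add OH_tens OH_sum)
        show "f v \<in> A" using f(2) v(1) by blast
        show "of_int m * (C * hc (hat_vec x $ k)) * s $ k \<in> OH" for k
          using OH_mult [OF m(2)] v(2) by (simp only: OV_iff)
      qed
      finally have "hc (C * hdot (hat_vec x) (M *v axis l 1)) \<in> OH" by (rule OH_hc)
      then have "tens 1 u' * hc (C * hdot (hat_vec x) (M *v axis l 1)) \<in> OH"
        by (intro OH_mult OH_tens) simp_all
      also have "hdot (hat_vec x) (M *v axis l 1) = (\<Sum>k\<in>UNIV. hc (hat_vec x $ k) * M $ k $ l)"
        by (simp add: hdot_def matrix_vector_column)
      also have "tens 1 u' * hc (C * \<dots>) = tens 1 u' * C * (\<Sum>k\<in>UNIV. hc (M $ k $ l) * hat_vec x $ k)"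
        by (simp add: hc_mult hc_sum C hat_fixed_central [OF C] mult.assoc)
      also have "tens 1 u' * C = \<nu>" by (simp add: \<nu> hat_fixed_central [OF C])
      also have "\<nu> * (\<Sum>k\<in>UNIV. hc (M $ k $ l) * hat_vec x $ k) = (N *v hat_vec x) $ l"
        by (simp add: N_def mat_vector dagger_component matrix_vector_mult_def [of "dagger hc M"] flip: matrix_vector_mul_assoc)
      finally show "(N *v hat_vec x) $ l \<in> OH" .
    qed
    then have "x \<in> ?L" using gamma_inverse_iff [OF N] by blast
    then show "\<exists>x. x \<in> ?L \<and> (\<forall>y\<in>?L. f y = scaleQ c (h0 x y))" using fx by blast
    fix x y assume xy: "x \<in> ?L \<and> (\<forall>z\<in>?L. f z = scaleQ c (h0 x z))" "y \<in> ?L \<and> (\<forall>z\<in>?L. f z = scaleQ c (h0 y z))"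
    have "x $ k = y $ k" for k
    proof -
      have "scaleQ c (h0 x (axis k (of_int n))) = scaleQ c (h0 y (axis k (of_int n)))"
        using xy axL by metis
      then have "cj (x $ k) * of_int n = cj (y $ k) * of_int n"
        using q(1) by (simp add: scaleQ_def c_def h0_axis)
      then show ?thesis using n by (metis cj_cj mult_right_cancel of_int_eq_0_iff order_less_irrefl)
    qed
    then show "x = y" by (simp add: vec_eq_iff)
  qed
  have "c \<noteq> 0" using q(1) by (simp add: c_def)
  moreover have "rat_vec.span ?L = UNIV" using n lower by (rule lattice_span)
  ultimately show ?thesis
    unfolding principally_polarized_def unimodular_on_def
    using fg by (intro conjI exI [of _ c] ballI allI impI) (use val rep in \<open>auto simp only:\<close>)
qed

end

section \<open>Polarized lattices modulo a prime\<close>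

text \<open>Gaussian elimination over a division ring, with coefficients acting from the left; the
  pivot unknown is solved for at the end.\<close>

lemma underdetermined_system:
  fixes m :: "'a \<Rightarrow> 'b \<Rightarrow> 'h::division_ring"
  assumes "finite I" "finite J" "card I < card J"
  shows "\<exists>w. (\<exists>k\<in>J. w k \<noteq> 0) \<and> (\<forall>a\<in>I. (\<Sum>k\<in>J. m a k * w k) = 0)"
  using assms
proof (induction I arbitrary: J m rule: finite_induct)
  case empty
  then have "J \<noteq> {}" by auto
  then show ?case by (intro exI [of _ "\<lambda>_. 1"]) auto
next
  case (insert a I)
  show ?case
  proof (cases "\<forall>k\<in>J. m a k = 0")
    case True
    obtain w where "\<exists>k\<in>J. w k \<noteq> 0" "\<forall>b\<in>I. (\<Sum>k\<in>J. m b k * w k) = 0"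
      using insert.IH [of J m] insert.prems insert.hyps by auto
    then show ?thesis using True by (intro exI [of _ w]) auto
  next
    case False
    then obtain k0 where k0: "k0 \<in> J" "m a k0 \<noteq> 0" by blast
    define J' where "J' = J - {k0}"
    have J: "finite J'" "k0 \<notin> J'" "J = insert k0 J'" using insert.prems k0 by (auto simp: J'_def)
    then have "card I < card J'" using insert.prems insert.hyps by simp
    then obtain w where w: "\<exists>k\<in>J'. w k \<noteq> 0"
      "\<And>b. b \<in> I \<Longrightarrow> (\<Sum>k\<in>J'. (m b k - m b k0 * inverse (m a k0) * m a k) * w k) = 0"
      using insert.IH [of J' "\<lambda>b k. m b k - m b k0 * inverse (m a k0) * m a k"] J(1) by auto
    define s where "s = (\<Sum>k\<in>J'. m a k * w k)"
    define w' where "w' = w(k0 := - (inverse (m a k0) * s))"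
    have eq: "(\<Sum>k\<in>J. m b k * w' k) = (\<Sum>k\<in>J'. m b k * w k) - m b k0 * inverse (m a k0) * s" for b
    proof -
      have "(\<Sum>k\<in>J'. m b k * w' k) = (\<Sum>k\<in>J'. m b k * w k)"
        using J(2) by (intro sum.cong) (auto simp: w'_def)
      then show ?thesis using J(1,2) by (simp add: J(3) w'_def mult.assoc)
    qed
    have "(\<Sum>k\<in>J. m b k * w' k) = 0" if "b \<in> insert a I" for b
    proof (cases "b = a")
      case True
      then show ?thesis using k0 by (simp add: eq s_def)
    next
      case False
      then have "b \<in> I" using that by simp
      then show ?thesis
        using w(2) [of b] by (simp add: eq s_def left_diff_distrib sum_subtractf sum_distrib_left mult.assoc)
    qed
    moreover have "\<exists>k\<in>J. w' k \<noteq> 0" using w(1) J(2,3) by (auto simp: w'_def)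
    ultimately show ?thesis by blast
  qed
qed

definition rmul :: "'h::ring_1 ^ 'g \<Rightarrow> 'h \<Rightarrow> 'h ^ 'g"
  where "rmul v a = (\<chi> k. v $ k * a)"

lemma rmul_component [simp]: "rmul v a $ k = v $ k * a"
  by (simp add: rmul_def)

lemma rmul_rmul: "rmul (rmul v a) b = rmul v (a * b)"
  by (simp add: vec_eq_iff mult.assoc)

lemma rmul_diff: "rmul v (a - b) = rmul v a - rmul v b"
  by (simp add: vec_eq_iff right_diff_distrib)

text \<open>Finite generation is kept as the common denominator \<open>bounded\<close>, spanning as
  \<open>full\<close>, and the scaling factor \<open>c\<close> of the form is fixed.\<close>

locale polarized_lattice = maximal_quaternion_order i j A
  for i j :: "'h::{division_ring, ring_char_0}" and A +
  fixes L :: "('h ^ 'g::finite) set" and c :: rat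
  assumes submodule: "right_submodule A L"
    and bounded: "\<exists>D>0. \<forall>v\<in>L. \<forall>k. of_int D * v $ k \<in> A"
    and full: "\<exists>n>0. svec n v \<in> L"
    and c: "c \<noteq> 0"
    and integral: "x \<in> L \<Longrightarrow> y \<in> L \<Longrightarrow> scaleQ c (H0 i j x y) \<in> A"
    and unimodular: "unimodular_on A L (\<lambda>x y. scaleQ c (H0 i j x y))"
begin

definition h :: "'h ^ 'g \<Rightarrow> 'h ^ 'g \<Rightarrow> 'h" where "h x y = of_Q c * h0 x y"

lemma h_A: "x \<in> L \<Longrightarrow> y \<in> L \<Longrightarrow> h x y \<in> A"
  using integral by (simp add: h_def scaleQ_def)

lemma h_add_left: "h (x + y) z = h x z + h y z"
  and h_add_right: "h z (x + y) = h z x + h z y"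
  and h_diff_right: "h z (x - y) = h z x - h z y"
  by (simp_all add: h_def h0_add_left h0_add_right h0_diff_right distrib_left right_diff_distrib)

lemma h_sum_right: "h z (sum f I) = (\<Sum>k\<in>I. h z (f k))"
  by (simp add: h_def h0_sum_right sum_distrib_left)

lemma h_rmul_right: "h x (rmul y a) = h x y * a"
  by (simp add: h_def rmul_def h0_mult_right mult.assoc)

lemma cj_h: "cj (h x y) = h y x"
  by (simp add: h_def cj_of_Q_mult cj_h0)

lemma h_rmul_left: "h (rmul x a) y = cj a * h x y"
  using cj_h [of y "rmul x a"] by (simp add: h_rmul_right cj_mult cj_h)

lemma svec_rmul: "svec n (v :: 'h ^ 'g) = rmul v (of_int n)"
  by (simp add: vec_eq_iff mult_of_int_commute)

lemma h_svec_left: "h (svec n x) y = of_int n * h x y"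
  by (simp add: svec_rmul h_rmul_left)

lemma h_svec_right: "h x (svec n y) = of_int n * h x y"
  by (simp add: svec_rmul h_rmul_right mult_of_int_commute)

lemma L_0: "0 \<in> L" and L_add: "x \<in> L \<Longrightarrow> y \<in> L \<Longrightarrow> x + y \<in> L"
  and L_diff: "x \<in> L \<Longrightarrow> y \<in> L \<Longrightarrow> x - y \<in> L"
  and L_sum: "(\<And>k. k \<in> I \<Longrightarrow> f k \<in> L) \<Longrightarrow> sum f I \<in> L"
  and L_rmul: "x \<in> L \<Longrightarrow> a \<in> A \<Longrightarrow> rmul x a \<in> L"
  using submodule by (auto simp: rmul_def intro: submodule_0 submodule_add submodule_diff submodule_sum submodule_mult)

lemma L_svec: "x \<in> L \<Longrightarrow> svec n x \<in> L"
  by (simp add: svec_rmul L_rmul)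

lemma h_nondegenerate:
  assumes "\<And>z. z \<in> L \<Longrightarrow> h x z = h y z" shows "x = y"
proof -
  have "x $ k = y $ k" for k
  proof -
    obtain n where n: "n > 0" "svec n (axis k 1) \<in> L" using full by blast
    have "h z (svec n (axis k 1)) = of_int n * (of_Q c * cj (z $ k))" for z
      by (simp only: h_svec_right) (simp add: h_def h0_axis)
    then have "cj (x $ k) = cj (y $ k)" using assms [OF n(2)] n(1) c by simp
    then show ?thesis by (metis cj_cj)
  qed
  then show ?thesis by (simp add: vec_eq_iff)
qed

lemma representable:
  assumes "\<And>v w. v \<in> L \<Longrightarrow> w \<in> L \<Longrightarrow> f (v + w) = f v + f w"
    "\<And>v a. v \<in> L \<Longrightarrow> a \<in> A \<Longrightarrow> f (rmul v a) = f v * a" "\<And>v. v \<in> L \<Longrightarrow> f v \<in> A"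
  shows "\<exists>x\<in>L. \<forall>y\<in>L. f y = h x y"
proof -
  have "right_linear_on A L f \<and> f ` L \<subseteq> A"
    using assms by (auto simp: right_linear_on_def rmul_def)
  then have "\<exists>!x. x \<in> L \<and> (\<forall>y\<in>L. f y = scaleQ c (h0 x y))"
    using unimodular unfolding unimodular_on_def by (elim allE impE)
  then show ?thesis unfolding h_def scaleQ_def by (elim ex1E) blast
qed

lemma h_self: "x \<in> L \<Longrightarrow> \<exists>k. h x x = of_int k"
  by (rule fixed_in_A) (simp_all add: h_A cj_h)

definition delta :: "'g \<Rightarrow> 'g \<Rightarrow> 'h" where "delta a b = (if a = b then 1 else 0)"

lemma delta_A [simp]: "delta a b \<in> A"
  by (simp add: delta_def)

text \<open>If no vector orthogonal to \<open>e\<close> modulo \<open>p\<close> has unit length, then the vectors \<open>w\<close> that are exactly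
  orthogonal to \<open>e\<close> pair into the radical; by unimodularity they are stable under the order of all
  \<open>y\<close> with \<open>y * rad p \<subseteq> A\<close>, which is strictly larger than \<open>A\<close>.\<close>

lemma unit_length_mod_prime:
  assumes p: "prime p" and I: "I \<noteq> UNIV" and e: "\<And>a. a \<in> I \<Longrightarrow> e a \<in> L"
    and orth: "\<And>a b. a \<in> I \<Longrightarrow> b \<in> I \<Longrightarrow> h (e a) (e b) - delta a b \<in> multiples p"
  shows "\<exists>x\<in>L. \<exists>k. (\<forall>a\<in>I. h (e a) x \<in> multiples p) \<and> h x x = of_int k \<and> \<not> p dvd k"
proof (rule ccontr)
  assume contra: "\<not> ?thesis"
  have p1: "p > 1" using p prime_gt_1_int by blast
  define L' where "L' = {x \<in> L. \<forall>a\<in>I. h (e a) x \<in> multiples p}"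
  have L'L: "x \<in> L" if "x \<in> L'" for x using that by (simp add: L'_def)
  have L'_add: "x + y \<in> L'" if "x \<in> L'" "y \<in> L'" for x y
    using that by (auto simp: L'_def L_add h_add_right multiples_add)
  have L'_rmul: "rmul x a \<in> L'" if "x \<in> L'" "a \<in> A" for x a
    using that by (auto simp: L'_def L_rmul h_rmul_right multiples_mult_right)
  have self: "h x x \<in> multiples p" if "x \<in> L'" for x
  proof -
    obtain k where "h x x = of_int k" using h_self L'L \<open>x \<in> L'\<close> by blast
    moreover from this have "p dvd k" using contra \<open>x \<in> L'\<close> by (auto simp: L'_def)
    ultimately show ?thesis by (simp add: of_int_multiples_iff)
  qed
  have trh: "p dvd tr (h x y)" if xy: "x \<in> L'" "y \<in> L'" for x y
  proof -
    have "h (x + y) (x + y) - h x x - h y y \<in> multiples p"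
      using xy by (intro multiples_diff self L'_add)
    moreover have "h (x + y) (x + y) - h x x - h y y = h x y + cj (h x y)"
      by (simp add: h_add_left h_add_right cj_h)
    ultimately have "of_int (tr (h x y)) \<in> multiples p"
      using tr [OF h_A [OF L'L L'L]] xy by simp
    then show ?thesis by (simp add: of_int_multiples_iff)
  qed
  \<comment> \<open>An element of trace 1 modulo p turns the information on traces into one on
    norms: pairing x h(x,y) with yt gives \<open>nm (h x y)\<close> times t.\<close>
  obtain t where t: "t \<in> A" "p dvd tr t - 1" using trace_surjective_mod [OF p] by blast
  have h_rad: "h x y \<in> rad p" if xy: "x \<in> L'" "y \<in> L'" for x y
  proof -
    have hA: "h x y \<in> A" using xy L'L h_A by blast
    have "p dvd tr (h x y * b)" if "b \<in> A" for b
      using trh [OF xy(1) L'_rmul [OF xy(2) that]] by (simp add: h_rmul_right)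
    moreover have "p dvd nm (h x y)"
    proof -
      have "h (rmul x (h x y)) (rmul y t) = of_int (nm (h x y)) * t"
        using nm [OF hA] by (simp add: h_rmul_left h_rmul_right norm_commute mult.assoc [symmetric])
      then have "p dvd tr (of_int (nm (h x y)) * t)"
        using trh [OF L'_rmul [OF xy(1) hA] L'_rmul [OF xy(2) t(1)]] by simp
      then have "p dvd nm (h x y) * tr t" using t(1) by (simp add: tr_of_int_mult)
      moreover have "\<not> p dvd tr t"
      proof
        assume "p dvd tr t"
        then have "p dvd tr t - (tr t - 1)" using t(2) by (rule dvd_diff)
        then show False using p1 by simp
      qed
      ultimately show ?thesis using p prime_dvd_mult_iff by blast
    qed
    ultimately show ?thesis using hA by (simp add: rad_def)
  qed
  define W where "W = {w \<in> L. \<forall>a\<in>I. h (e a) w = 0}"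
  have h_W: "h w y \<in> rad p" if w: "w \<in> W" and y: "y \<in> L" for w y
  proof -
    \<comment> \<open>Gram-Schmidt modulo p. The correction is invisible to \<open>w\<close>, which
      is exactly orthogonal to \<open>e\<close>.\<close>
    define y' where "y' = y - (\<Sum>a\<in>I. rmul (e a) (h (e a) y))"
    have "y' \<in> L" unfolding y'_def using y e by (intro L_diff L_sum L_rmul h_A) auto
    moreover have "h (e b) y' \<in> multiples p" if b: "b \<in> I" for b
    proof -
      have "h (e b) y' = h (e b) y - (\<Sum>a\<in>I. h (e b) (e a) * h (e a) y)"
        by (simp add: y'_def h_diff_right h_sum_right h_rmul_right)
      also have "h (e b) y = (\<Sum>a\<in>I. delta b a * h (e a) y)"
        using b by (simp add: delta_def if_distribR sum.delta' [OF finite] if_distrib cong: if_cong)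
      also have "\<dots> - (\<Sum>a\<in>I. h (e b) (e a) * h (e a) y) = - (\<Sum>a\<in>I. (h (e b) (e a) - delta b a) * h (e a) y)"
        by (simp add: left_diff_distrib sum_subtractf)
      also have "\<dots> \<in> multiples p"
        using b y e orth by (intro multiples_minus multiples_sum multiples_mult_right h_A) auto
      finally show ?thesis .
    qed
    ultimately have "y' \<in> L'" by (simp add: L'_def)
    moreover have "w \<in> L'" using w by (simp add: W_def L'_def)
    moreover have we: "h w (e a) = 0" if "a \<in> I" for a
      using w that cj_h [of "e a" w] by (simp add: W_def)
    then have "h w y' = h w y"
      by (simp add: y'_def h_diff_right h_sum_right h_rmul_right)
    ultimately show ?thesis using h_rad by metis
  qed
  have W_rmul: "rmul w a \<in> W" if "w \<in> W" "a \<in> A" for w a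
    using that by (auto simp: W_def L_rmul h_rmul_right)
  \<comment> \<open>Fewer than g linear conditions leave a nonzero solution. A nonzero coordinate of
    it bounds the denominators of \<open>R\<close> below.\<close>
  obtain w k where w: "w \<in> W" "w $ k \<noteq> 0"
  proof -
    have "card I < card (UNIV :: 'g set)" using I by (simp add: psubset_card_mono psubset_eq)
    then obtain w where w: "\<exists>k. w k \<noteq> 0" "\<And>a. a \<in> I \<Longrightarrow> (\<Sum>k\<in>UNIV. cj (e a $ k) * w k) = 0"
      using underdetermined_system [of I UNIV "\<lambda>a k. cj (e a $ k)"] by auto
    obtain n where n: "n > 0" "svec n (\<chi> k. w k) \<in> L" using full by blast
    have "h (e a) (svec n (\<chi> k. w k)) = 0" if "a \<in> I" for a
      using w(2) [OF that] by (simp add: h_svec_right) (simp add: h_def H0_def)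
    then have "svec n (\<chi> k. w k) \<in> W" using n(2) by (simp add: W_def)
    moreover obtain k where "w k \<noteq> 0" using w(1) by blast
    ultimately show ?thesis using n(1) that [of "svec n (\<chi> k. w k)" k] by simp
  qed
  define R where "R = {y. \<forall>w\<in>W. rmul w (cj y) \<in> W}"
  obtain D where D: "D > 0" "\<And>v k. v \<in> L \<Longrightarrow> of_int D * v $ k \<in> A" using bounded by blast
  obtain m where m: "m > 0" "of_int m * inverse (w $ k) \<in> A" using A_denominator by blast
  have "R = A"
  proof (rule order_eqI)
    show "A \<subseteq> R" by (auto simp: R_def W_rmul A_cj)
    show "x * y \<in> R" if "x \<in> R" "y \<in> R" for x y
      using that by (auto simp: R_def cj_mult simp flip: rmul_rmul)
    show "x - y \<in> R" if "x \<in> R" "y \<in> R" for x y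
      using that by (auto simp: R_def cj_diff rmul_diff W_def L_diff h_diff_right)
    show "m * D > 0" using m(1) D(1) by simp
    show "of_int (m * D) * y \<in> A" if "y \<in> R" for y
    proof -
      have "rmul w (cj y) \<in> L" using that w(1) by (auto simp: R_def W_def)
      then have "of_int D * (w $ k * cj y) \<in> A" using D(2) [of "rmul w (cj y)" k] by simp
      then have "of_int m * inverse (w $ k) * (of_int D * (w $ k * cj y)) \<in> A" using m(2) A_mult by blast
      also have "of_int m * inverse (w $ k) * (of_int D * (w $ k * cj y))
          = of_int D * (of_int m * inverse (w $ k) * (w $ k * cj y))"
      proof -
        have "X * (of_int D * Y) = of_int D * (X * Y)" for X Y :: 'h
          by (simp only: mult.assoc [symmetric] mult_of_int_commute [of D X])
        then show ?thesis .
      qed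
      also have "\<dots> = of_int (m * D) * (inverse (w $ k) * w $ k * cj y)"
        by (simp only: mult.commute [of m D] of_int_mult mult.assoc)
      finally have "of_int (m * D) * cj y \<in> A" using w(2) by simp
      then show ?thesis using A_cj cj_of_int_mult [of "m * D" "cj y"] by fastforce
    qed
  qed
  obtain z where z: "z \<in> A" "z \<notin> multiples p" "\<And>y. y \<in> rad p \<Longrightarrow> z * y \<in> multiples p"
    using rad_right_annihilated [OF p1] by blast
  define x where "x = inverse (of_int p) * z"
  have xrad: "x * y \<in> A" if "y \<in> rad p" for y
    using divide_multiple [of p "z * y"] z(3) [OF that] p1 by (simp add: x_def mult.assoc)
  \<comment> \<open>y \<mapsto> x h(v,y) has values in A because h(v,y) lies in the radical.
    Unimodularity represents it by a vector of L, which by nondegeneracy is \<open>v\<close> times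
    \<open>cj x\<close>.\<close>
  have "rmul v (cj x) \<in> W" if v: "v \<in> W" for v
  proof -
    have "\<exists>u\<in>L. \<forall>y\<in>L. x * h v y = h u y"
      using xrad h_W [OF v]
      by (intro representable) (auto simp: h_add_right distrib_left h_rmul_right mult.assoc)
    then obtain u where u: "u \<in> L" "\<And>y. y \<in> L \<Longrightarrow> x * h v y = h u y" by blast
    have "rmul v (cj x) = u"
      by (rule h_nondegenerate) (simp add: h_rmul_left u(2))
    then show ?thesis using u(1) v by (auto simp: W_def h_rmul_right)
  qed
  then have "x \<in> A" using \<open>R = A\<close> by (auto simp: R_def)
  then show False using z(2) p1 divide_multiple [of p z] by (simp add: x_def)
qed

text \<open>The new vector x has length k prime to p; multiplied by b it has length k
  \<open>nm b\<close>, and b is chosen with norm inverse to k modulo p.\<close>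

lemma orthonormal_mod_prime:
  assumes p: "prime p"
  shows "\<exists>e. (\<forall>a\<in>I. e a \<in> L) \<and> (\<forall>a\<in>I. \<forall>b\<in>I. h (e a) (e b) - delta a b \<in> multiples p)"
  using finite [of I]
proof (induction I rule: finite_induct)
  case empty
  then show ?case by simp
next
  case (insert a I)
  then obtain e where e: "\<And>a. a \<in> I \<Longrightarrow> e a \<in> L"
    "\<And>a b. a \<in> I \<Longrightarrow> b \<in> I \<Longrightarrow> h (e a) (e b) - delta a b \<in> multiples p" by blast
  have "I \<noteq> UNIV" using insert.hyps by auto
  then obtain x k where x: "x \<in> L" "\<And>a. a \<in> I \<Longrightarrow> h (e a) x \<in> multiples p" "h x x = of_int k" "\<not> p dvd k"
    using unit_length_mod_prime [of p I e] p e by blast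
  have "coprime k p" using x(4) p by (metis coprime_commute prime_imp_coprime)
  then obtain u v where uv: "u * k + v * p = 1" using bezout_int [of k p] by auto
  have "\<not> p dvd u"
  proof
    assume "p dvd u"
    then have "p dvd u * k + v * p" by simp
    then show False using uv prime_gt_1_int [OF p] by simp
  qed
  then obtain b where b: "b \<in> A" "p dvd nm b - u" using norm_surjective_mod [OF p] by blast
  define y where "y = rmul x b"
  have y: "y \<in> L" using x(1) b(1) by (simp add: y_def L_rmul)
  have "cj b * of_int k * b = of_int k * (cj b * b)"
    by (simp only: mult_of_int_commute [symmetric] mult.assoc)
  then have "h y y = of_int (k * nm b)"
    using nm [OF b(1)] by (simp add: y_def h_rmul_left h_rmul_right x(3) norm_commute mult.assoc)
  moreover have "p dvd k * nm b - 1"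
  proof -
    have "k * nm b - 1 = k * (nm b - u) - v * p" using uv by (simp add: algebra_simps)
    then show ?thesis using b(2) by simp
  qed
  ultimately have yy: "h y y - 1 \<in> multiples p"
    using of_int_multiples_iff [of "k * nm b - 1" p] by simp
  have ey: "h (e a) y \<in> multiples p" if "a \<in> I" for a
    using x(2) [OF that] b(1) by (simp add: y_def h_rmul_right multiples_mult_right)
  then have ye: "h y (e a) \<in> multiples p" if "a \<in> I" for a
    using that multiples_cj [of "h (e a) y" p] by (simp add: cj_h)
  define e' where "e' = e(a := y)"
  have "e' b \<in> L" if "b \<in> insert a I" for b
    using that y e(1) by (auto simp: e'_def)
  moreover have "h (e' b) (e' d) - delta b d \<in> multiples p" if bd: "b \<in> insert a I" "d \<in> insert a I" for b d
  proof -
    consider "b = a" "d = a" | "b = a" "d \<in> I" "d \<noteq> a" | "b \<in> I" "b \<noteq> a" "d = a" | "b \<in> I" "d \<in> I" "b \<noteq> a" "d \<noteq> a"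
      using bd insert.hyps by auto
    then show ?thesis
      by cases (use yy ey ye e(2) in \<open>auto simp: e'_def delta_def\<close>)
  qed
  ultimately show ?case by blast
qed

section \<open>Lifting orthonormal bases\<close>

definition orthonormal :: "int \<Rightarrow> ('g \<Rightarrow> 'h ^ 'g) \<Rightarrow> bool"
  where "orthonormal n e \<longleftrightarrow> (\<forall>a. e a \<in> L) \<and> (\<forall>a b. h (e a) (e b) - delta a b \<in> multiples n)"

text \<open>\<open>\<alpha>\<close> is 1 and \<open>\<beta>\<close> is 0 modulo \<open>n\<close>, so
  the vectors agree with \<open>e\<close> modulo \<open>n\<close> whatever \<open>f\<close>
  is.\<close>

lemma orthonormal_combine:
  assumes e: "orthonormal n e" "\<And>a. f a \<in> L" and ab: "\<alpha> + \<beta> = 1" "n dvd \<beta>"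
  shows "h (svec \<alpha> (e a) + svec \<beta> (f a)) (svec \<alpha> (e b) + svec \<beta> (f b)) - delta a b \<in> multiples n"
proof -
  have eL: "e a \<in> L" for a using e(1) by (simp add: orthonormal_def)
  define x y z w where "x = h (e a) (e b)" and "y = h (e a) (f b)" and "z = h (f a) (e b)" and "w = h (f a) (f b)"
  have A: "x \<in> A" "y \<in> A" "z \<in> A" "w \<in> A" using eL e(2) by (simp_all add: x_def y_def z_def w_def h_A)
  have \<alpha>: "\<alpha> = 1 - \<beta>" using ab by simp
  have "h (svec \<alpha> (e a) + svec \<beta> (f a)) (svec \<alpha> (e b) + svec \<beta> (f b))
      = of_int \<alpha> * (of_int \<alpha> * x) + of_int \<alpha> * (of_int \<beta> * y) + (of_int \<beta> * (of_int \<alpha> * z) + of_int \<beta> * (of_int \<beta> * w))"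
    unfolding x_def y_def z_def w_def
    by (simp only: h_add_left h_svec_left) (simp only: h_add_right h_svec_right distrib_left)
  also have "of_int \<alpha> * (of_int \<alpha> * x) = x + of_int \<beta> * (of_int (\<beta> - 2) * x)"
  proof -
    have "\<alpha> * \<alpha> = 1 + \<beta> * (\<beta> - 2)" by (simp add: \<alpha> algebra_simps)
    then have "of_int (\<alpha> * \<alpha>) * x = of_int (1 + \<beta> * (\<beta> - 2)) * x" by simp
    then show ?thesis by (simp only: of_int_mult of_int_add of_int_1 distrib_right mult_1_left mult.assoc)
  qed
  also have "of_int \<alpha> * (of_int \<beta> * y) = of_int \<beta> * (of_int \<alpha> * y)"
    by (simp only: mult.assoc [symmetric] of_int_mult [symmetric] mult.commute)
  finally have "h (svec \<alpha> (e a) + svec \<beta> (f a)) (svec \<alpha> (e b) + svec \<beta> (f b)) - delta a b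
      = (x - delta a b) + of_int \<beta> * (of_int (\<beta> - 2) * x + of_int \<alpha> * y + of_int \<alpha> * z + of_int \<beta> * w)"
    by (simp add: distrib_left)
  moreover have "x - delta a b \<in> multiples n" using e(1) by (simp add: orthonormal_def x_def)
  moreover have "of_int \<beta> * (of_int (\<beta> - 2) * x + of_int \<alpha> * y + of_int \<alpha> * z + of_int \<beta> * w) \<in> multiples n"
    using A by (intro multiples_dvd [OF ab(2)] multiplesI A_add A_of_int_mult)
  ultimately show ?thesis by (simp only: multiples_add)
qed

text \<open>Chinese remainder theorem: a Bezout relation glues the basis modulo \<open>n\<close>
  with an unrelated one modulo \<open>p\<close>.\<close>

lemma orthonormal_lift_coprime:
  assumes p: "prime p" and cop: "coprime n p" and e: "orthonormal n e"
  shows "\<exists>e'. orthonormal (n * p) e' \<and> (\<forall>a. \<exists>v\<in>L. e' a = e a + svec n v)"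
proof -
  obtain u v where uv: "u * n + v * p = 1" using cop bezout_int [of n p] by auto
  obtain f where f: "orthonormal p f"
    using orthonormal_mod_prime [OF p, of UNIV] by (auto simp: orthonormal_def)
  have L: "e a \<in> L" "f a \<in> L" for a using e f by (simp_all add: orthonormal_def)
  define e' where "e' = (\<lambda>a. svec (v * p) (e a) + svec (u * n) (f a))"
  have 1: "h (e' a) (e' b) - delta a b \<in> multiples n" for a b
    unfolding e'_def using uv L by (intro orthonormal_combine e) auto
  have 2: "h (e' a) (e' b) - delta a b \<in> multiples p" for a b
    unfolding e'_def using uv L by (subst (1 2) add.commute) (intro orthonormal_combine f, auto)
  have "orthonormal (n * p) e'"
    unfolding orthonormal_def using multiples_coprime [OF cop 1 2] L
    by (auto simp: e'_def L_add L_svec)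
  moreover have "e' a = e a + svec n (svec u (f a - e a))" for a
  proof -
    have vp: "v * p = 1 - n * u" using uv by (simp add: mult.commute)
    show ?thesis
      unfolding e'_def vp mult.commute [of u n] by (simp add: vec_eq_iff algebra_simps)
  qed
  ultimately show ?thesis using L by (metis L_diff L_svec)
qed

text \<open>Hensel's lemma: a correction \<open>e + n e T\<close> changes the Gram matrix by \<open>n (T + T\<^sup>\<dagger>)\<close> modulo \<open>p n\<close>, and every
  hermitian matrix is of the form \<open>T + T\<^sup>\<dagger>\<close> modulo \<open>p\<close> because the reduced trace is onto.\<close>

lemma orthonormal_lift_dvd:
  assumes p: "prime p" and dvd: "p dvd n" and n: "n > 0" and e: "orthonormal n e"
  shows "\<exists>e'. orthonormal (n * p) e' \<and> (\<forall>a. \<exists>v\<in>L. e' a = e a + svec n v)"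
proof -
  have L: "e a \<in> L" for a using e by (simp add: orthonormal_def)
  obtain t where t: "t \<in> A" "p dvd tr t - 1" using trace_surjective_mod [OF p] by blast
  have "\<exists>s\<in>A. h (e a) (e b) - delta a b = of_int n * s" for a b
  proof -
    have "h (e a) (e b) - delta a b \<in> multiples n" using e by (simp add: orthonormal_def)
    then show ?thesis by (auto elim: multiplesE)
  qed
  then obtain S where S: "\<And>a b. S a b \<in> A" "\<And>a b. h (e a) (e b) - delta a b = of_int n * S a b" by metis
  have "of_int n * cj (S a b) = of_int n * S b a" for a b
    unfolding S(2) [symmetric] cj_of_int_mult [symmetric] by (simp add: cj_diff cj_h delta_def)
  then have Scj: "cj (S a b) = S b a" for a b using n by simp
  \<comment> \<open>A linear order on the indices, so that T can be taken triangular.\<close>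
  obtain r :: "'g \<Rightarrow> nat" where r: "inj r" using finite_imp_inj_to_nat_seg [OF finite [of UNIV]] by blast
  \<comment> \<open>Off the diagonal -S is cancelled from one side of the diagonal only, its
    conjugate transpose serving the other. On the diagonal S is an integer and \<open>t\<close>
    splits it, having trace 1 modulo p.\<close>
  define T where "T = (\<lambda>a b. if a = b then - (S a a * t) else if r a < r b then - S a b else 0)"
  have TA: "T a b \<in> A" for a b using S(1) t(1) by (auto simp: T_def A_mult)
  have T: "S a b + T a b + cj (T b a) \<in> multiples p" for a b
  proof (cases "a = b")
    case True
    obtain s where s: "S a a = of_int s" using fixed_in_A [OF S(1) Scj] by blast
    have "S a b + T a b + cj (T b a) = of_int s - of_int s * t - cj t * of_int s"
      using True [symmetric] by (simp add: T_def s cj_minus cj_mult)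
    also have "cj t * of_int s = of_int s * cj t" by (simp only: mult_of_int_commute)
    also have "of_int s - of_int s * t - of_int s * cj t = of_int (- s * (tr t - 1))"
      using tr [OF t(1)] by (simp add: algebra_simps)
    finally show ?thesis using t(2) by (simp only: of_int_multiples_iff) simp
  next
    case False
    then have "r a \<noteq> r b" using r by (auto dest: injD)
    then show ?thesis using False Scj [of b a] by (cases "r a < r b") (auto simp: T_def cj_minus)
  qed
  define F where "F = (\<lambda>b. \<Sum>d\<in>UNIV. rmul (e d) (T d b))"
  have F: "F b \<in> L" for b unfolding F_def using L TA by (intro L_sum L_rmul)
  have hF: "h (e a) (F b) - T a b \<in> multiples p" for a b
  proof -
    have "T a b = (\<Sum>d\<in>UNIV. delta a d * T d b)"
      by (simp add: delta_def if_distribR if_distrib cong: if_cong)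
    then have "h (e a) (F b) - T a b = (\<Sum>d\<in>UNIV. (h (e a) (e d) - delta a d) * T d b)"
      by (simp add: F_def h_sum_right h_rmul_right left_diff_distrib sum_subtractf)
    also have "\<dots> = (\<Sum>d\<in>UNIV. of_int n * S a d * T d b)" by (simp add: S(2))
    also have "\<dots> \<in> multiples p"
      using S(1) TA by (intro multiples_sum multiples_mult_right multiples_dvd [OF dvd] multiplesI)
    finally show ?thesis .
  qed
  define e' where "e' = (\<lambda>a. e a + svec n (F a))"
  have "h (e' a) (e' b) - delta a b \<in> multiples (n * p)" for a b
  proof -
    \<comment> \<open>The quadratic term keeps a factor n, divisible by p, so the condition on the
      correction is linear modulo p.\<close>
    have "h (e' a) (e' b) - delta a b = of_int n * (S a b + h (e a) (F b) + h (F a) (e b) + of_int n * h (F a) (F b))"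
      using S(2) [of a b] by (simp add: e'_def h_add_left h_add_right h_svec_left h_svec_right distrib_left algebra_simps)
    moreover have "S a b + h (e a) (F b) + h (F a) (e b) + of_int n * h (F a) (F b) \<in> multiples p"
    proof -
      have "S a b + h (e a) (F b) + h (F a) (e b) + of_int n * h (F a) (F b) =
          (S a b + T a b + cj (T b a)) + (h (e a) (F b) - T a b) + cj (h (e b) (F a) - T b a) + of_int n * h (F a) (F b)"
        by (simp add: cj_diff cj_h)
      also have "\<dots> \<in> multiples p"
        using F by (intro multiples_add T hF multiples_cj multiples_dvd [OF dvd] multiplesI h_A)
      finally show ?thesis .
    qed
    then obtain y where "y \<in> A" "S a b + h (e a) (F b) + h (F a) (e b) + of_int n * h (F a) (F b) = of_int p * y"
      by (rule multiplesE)
    ultimately show ?thesis using multiplesI [of y "n * p"] by (simp add: mult.assoc)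
  qed
  then have "orthonormal (n * p) e'"
    unfolding orthonormal_def using L F by (auto simp: e'_def L_add L_svec)
  then show ?thesis using F by (auto simp: e'_def)
qed

lemma orthonormal_lift_prime:
  assumes p: "prime p" and n: "n > 0" and e: "orthonormal n e"
  shows "\<exists>e'. orthonormal (n * p) e' \<and> (\<forall>a. \<exists>v\<in>L. e' a = e a + svec n v)"
proof (cases "p dvd n")
  case True
  then show ?thesis using orthonormal_lift_dvd p n e by blast
next
  case False
  then have "coprime n p" using p by (metis coprime_commute prime_imp_coprime)
  then show ?thesis using orthonormal_lift_coprime p e by blast
qed

lemma orthonormal_lift:
  assumes "m > 0" "n > 0" "orthonormal n e"
  shows "\<exists>e'. orthonormal (n * int m) e' \<and> (\<forall>a. \<exists>v\<in>L. e' a = e a + svec n v)"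
  using assms
proof (induction m arbitrary: n e rule: less_induct)
  case (less m)
  show ?case
  proof (cases "m = 1")
    case True
    have "e a = e a + svec n 0" for a by (simp add: vec_eq_iff)
    then show ?thesis using less.prems True L_0 by (intro exI [of _ e]) auto
  next
    case False
    then obtain q where q: "prime q" "q dvd m" using prime_factor_nat by blast
    then obtain m' where m': "m = q * m'" by blast
    have m'0: "m' > 0" "m' < m" using less.prems(1) prime_gt_1_nat [OF q(1)] by (auto simp: m')
    have pq: "prime (int q)" using q(1) by simp
    obtain e1 where e1: "orthonormal (n * int q) e1" "\<And>a. \<exists>v\<in>L. e1 a = e a + svec n v"
      using orthonormal_lift_prime [OF pq less.prems(2,3)] by blast
    have nq: "n * int q > 0" using less.prems(2) prime_gt_0_nat [OF q(1)] by simp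
    obtain e2 where e2: "orthonormal (n * int q * int m') e2" "\<And>a. \<exists>v\<in>L. e2 a = e1 a + svec (n * int q) v"
      using less.IH [OF m'0(2,1) nq e1(1)] by blast
    have "\<exists>v\<in>L. e2 a = e a + svec n v" for a
    proof -
      obtain v w where "v \<in> L" "e1 a = e a + svec n v" "w \<in> L" "e2 a = e1 a + svec (n * int q) w"
        using e1(2) e2(2) by meson
      then show ?thesis
        by (intro bexI [of _ "v + svec (int q) w"])
          (simp_all add: vec_eq_iff distrib_left mult.assoc add.assoc L_add L_svec)
    qed
    then show ?thesis using e2(1) by (intro exI [of _ e2]) (simp add: m' mult.assoc)
  qed
qed

lemma orthonormal_sequence:
  "\<exists>E. \<forall>n. orthonormal (fact n) (E n) \<and> (\<forall>a. \<exists>v\<in>L. E (Suc n) a = E n a + svec (fact n) v)"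
proof (rule dependent_nat_choice)
    \<comment> \<open>Modulo 0! = 1 every family is orthonormal, and the zero family starts the
      recursion.\<close>
    have "x \<in> multiples 1" if "x \<in> A" for x using multiplesI [OF that, of 1] by simp
    then have "orthonormal 1 (\<lambda>_. 0)" by (simp add: orthonormal_def L_0 h_A A_diff)
    then show "\<exists>e. orthonormal (fact 0) e" by auto
  next
    fix e n assume "orthonormal (fact n) e"
    then have "\<exists>e'. orthonormal (fact n * int (Suc n)) e' \<and> (\<forall>a. \<exists>v\<in>L. e' a = e a + svec (fact n) v)"
      by (intro orthonormal_lift) simp_all
    then show "\<exists>e'. orthonormal (fact (Suc n)) e' \<and> (\<forall>a. \<exists>v\<in>L. e' a = e a + svec (fact n) v)"
      by (simp add: mult.commute)
qed

end

section \<open>The similitude of a polarized lattice\<close>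

lemma fact_dvd_of_int: "n > 0 \<Longrightarrow> n dvd (fact (nat n) :: int)"
proof -
  assume "n > 0"
  then have "int (nat n) dvd int (fact (nat n))"
    by (simp only: int_dvd_int_iff) (rule dvd_fact, auto)
  then show ?thesis using \<open>n > 0\<close> by simp
qed

context quaternion_algebra
begin

lemma hdot_add_left: "hdot (x + y) z = hdot x z + hdot y z"
  by (simp add: hdot_def hc_add distrib_right sum.distrib)

lemma hdot_svec_right: "hdot x (svec n y) = of_int n * hdot x y"
proof -
  have "hc (x $ k) * (of_int n * y $ k) = of_int n * (hc (x $ k) * y $ k)" for k
    by (simp only: mult.assoc [symmetric] mult_of_int_commute [of n "hc (x $ k)"])
  then show ?thesis by (simp add: hdot_def sum_distrib_left)
qed

lemma hdot_svec_left: "hdot (svec n x) y = of_int n * hdot x y"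
proof -
  have "hc (of_int n * x $ k) * y $ k = of_int n * (hc (x $ k) * y $ k)" for k
    by (simp add: hc_mult mult.assoc [symmetric] mult_of_int_commute [of n "hc (x $ k)"])
  then show ?thesis by (simp add: hdot_def sum_distrib_left)
qed

end

context polarized_lattice
begin

definition C :: "'h hat" where "C = tens (of_Q c) 1"

definition hhat :: "'h hat ^ 'g \<Rightarrow> 'h hat ^ 'g \<Rightarrow> 'h hat" where "hhat x y = C * hdot x y"

lemma hc_C: "hc C = C"
  by (simp add: C_def)

lemma hhat_add_left: "hhat (x + y) z = hhat x z + hhat y z"
  and hhat_add_right: "hhat z (x + y) = hhat z x + hhat z y"
  by (simp_all add: hhat_def hdot_add_left hdot_add_right distrib_left)

lemma hhat_svec_left: "hhat (svec n x) y = of_int n * hhat x y"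
  and hhat_svec_right: "hhat x (svec n y) = of_int n * hhat x y"
  by (simp_all only: hhat_def hdot_svec_left hdot_svec_right mult.assoc [symmetric] mult_of_int_commute [of n C])

lemma hhat_hat_vec: "hhat (hat_vec x) (hat_vec y) = tens (h x y) 1"
  by (simp add: hhat_def hdot_hat_vec C_def h_def tens_mult)

text \<open>The bound is uniform in x and y; a denominator depending on them could not be carried
  through the limit.\<close>

lemma hhat_denominator:
  "\<exists>m>0. \<forall>x y. svec D x \<in> OV \<longrightarrow> svec D y \<in> OV \<longrightarrow> of_int m * (of_int (D * D) * hhat x y) \<in> OH"
proof -
  obtain m where m: "m > 0" "of_int m * C \<in> OH" using hat_denominator by blast
  have "of_int m * (of_int (D * D) * hhat x y) \<in> OH" if "svec D x \<in> OV" "svec D y \<in> OV" for x y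
  proof -
    have "of_int (D * D) * hhat x y = hhat (svec D x) (svec D y)"
      by (simp add: hhat_svec_left hhat_svec_right mult.assoc)
    then have "of_int m * (of_int (D * D) * hhat x y) = of_int m * C * hdot (svec D x) (svec D y)"
      by (simp add: hhat_def mult.assoc)
    moreover have "hdot (svec D x) (svec D y) \<in> OH"
      using that unfolding hdot_def OV_iff by (intro OH_sum OH_mult OH_hc) auto
    ultimately show ?thesis using m(2) OH_mult by simp
  qed
  then show ?thesis using m(1) by blast
qed

lemma adelic_orthonormal_basis:
  "\<exists>w. (\<forall>a b. hhat (w a) (w b) = tens (delta a b) 1) \<and> (\<forall>a. \<forall>y\<in>L. hhat (w a) (hat_vec y) \<in> OH)"
proof -
  obtain E where E: "\<And>n. orthonormal (fact n) (E n)"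
    "\<And>n a. \<exists>v\<in>L. E (Suc n) a = E n a + svec (fact n) v"
    using orthonormal_sequence by blast
  have EL: "E n a \<in> L" for n a using E(1) by (simp add: orthonormal_def)
  obtain D where D: "D > 0" "\<And>v k. v \<in> L \<Longrightarrow> of_int D * v $ k \<in> A" using bounded by blast
  \<comment> \<open>Limits are available for sequences in A, so the coordinates are scaled by
    \<open>D\<close> before passing to the limit and divided by it afterwards.\<close>
  have "\<exists>t\<in>OH. \<forall>n. \<exists>s\<in>OH. t = tens (of_int D * E n a $ k) 1 + of_int (fact n) * s" for a k
  proof (rule OH_limit)
    show "of_int D * E 0 a $ k \<in> A" using D(2) EL by blast
    fix n
    obtain v where v: "v \<in> L" "E (Suc n) a = E n a + svec (fact n) v" using E(2) by blast
    have "of_int D * (of_int (fact n) * v $ k) = of_int (fact n) * (of_int D * v $ k)"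
      by (simp only: mult.assoc [symmetric] mult_of_int_commute [of D "of_int (fact n)"])
    then have "of_int D * E (Suc n) a $ k - of_int D * E n a $ k = of_int (fact n) * (of_int D * v $ k)"
      by (simp only: v(2) vector_add_component svec_component distrib_left add_diff_cancel_left')
    then show "of_int D * E (Suc n) a $ k - of_int D * E n a $ k \<in> multiples (fact n)"
      using multiplesI [OF D(2) [OF v(1)], of "fact n" k] by (simp only:)
  qed
  then obtain T where T: "\<And>a k n. \<exists>s\<in>OH. T a k = tens (of_int D * E n a $ k) 1 + of_int (fact n) * s"
    by metis
  define Di :: "'h hat" where "Di = tens (inverse (of_int D)) 1"
  have Di: "of_int D * (Di * t) = t" "Di * (of_int D * t) = t" for t
    using D(1) by (simp_all add: Di_def hat_of_int_inverse)
  define w where "w = (\<lambda>a. \<chi> k. Di * T a k)"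
  have approx: "\<exists>x. svec D x \<in> OV \<and> w a = hat_vec (E n a) + svec (fact n) x" for n a
  proof -
    have "\<forall>k. \<exists>s. s \<in> OH \<and> T a k = tens (of_int D * E n a $ k) 1 + of_int (fact n) * s"
      using T by blast
    then obtain s where s: "\<And>k. s k \<in> OH"
      "\<And>k. T a k = tens (of_int D * E n a $ k) 1 + of_int (fact n) * s k" by metis
    have "w a $ k = tens (E n a $ k) 1 + of_int (fact n) * (Di * s k)" for k
    proof -
      have "w a $ k = Di * (of_int D * tens (E n a $ k) 1) + Di * (of_int (fact n) * s k)"
        by (simp only: w_def vec_lambda_beta s(2) distrib_left of_int_mult_tens(1))
      also have "Di * (of_int (fact n) * s k) = of_int (fact n) * (Di * s k)"
        by (simp only: mult.assoc [symmetric] mult_of_int_commute [of "fact n" Di])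
      finally show ?thesis by (simp only: Di)
    qed
    then show ?thesis
      using s(1)
      by (intro exI [of _ "\<chi> k. Di * s k"])
        (simp add: vec_eq_iff hat_vec_component OV_iff Di)
  qed
  have hatL: "svec D (hat_vec y) \<in> OV" if "y \<in> L" for y
    using D(2) [OF that] by (simp add: OV_iff hat_vec_component of_int_mult_tens(1) OH_tens)
  obtain m where m: "m > 0" "\<And>x y. svec D x \<in> OV \<Longrightarrow> svec D y \<in> OV \<Longrightarrow> of_int m * (of_int (D * D) * hhat x y) \<in> OH"
    using hhat_denominator by blast
  \<comment> \<open>Clears the denominators of all pairings among lattice vectors and error vectors,
    both of which have denominator \<open>D\<close>.\<close>
  define M where "M = m * (D * D)"
  have M: "M > 0" using m(1) D(1) by (simp add: M_def)
  have MOH: "of_int M * hhat x y \<in> OH" if "svec D x \<in> OV" "svec D y \<in> OV" for x y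
    using m(2) [OF that] by (simp add: M_def mult.assoc)
  have "hhat (w a) (w b) = tens (delta a b) 1" for a b
  proof -
    have "infinitely_divisible (of_int M * (hhat (w a) (w b) - tens (delta a b) 1))"
      unfolding infinitely_divisible_def
    proof (intro allI impI)
      fix N :: int assume N: "N > 0"
      define n where "n = nat N"
      have "N dvd fact n" using N unfolding n_def by (rule fact_dvd_of_int)
      then obtain r where r: "fact n = N * r" ..
      obtain x where x: "svec D x \<in> OV" "w a = hat_vec (E n a) + svec (fact n) x" using approx by blast
      obtain y where y: "svec D y \<in> OV" "w b = hat_vec (E n b) + svec (fact n) y" using approx by blast
      have "h (E n a) (E n b) - delta a b \<in> multiples (fact n)" using E(1) by (simp add: orthonormal_def)
      then obtain d where d: "d \<in> A" "h (E n a) (E n b) - delta a b = of_int (fact n) * d" by (rule multiplesE)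
      define Y where "Y = hhat (hat_vec (E n a)) y + hhat x (hat_vec (E n b)) + of_int (fact n) * hhat x y"
      have "tens (h (E n a) (E n b)) 1 - tens (delta a b) 1 = of_int (fact n) * tens d (1 :: zhat)"
        by (simp only: tens_diff_left [symmetric] d(2) of_int_mult_tens(1))
      moreover have "hhat (w a) (w b) = tens (h (E n a) (E n b)) 1 + of_int (fact n) * Y"
        by (simp only: x(2) y(2) hhat_add_left hhat_svec_left)
          (simp only: hhat_add_right hhat_svec_right hhat_hat_vec Y_def distrib_left add.assoc)
      ultimately have "hhat (w a) (w b) - tens (delta a b) 1 = of_int (fact n) * (tens d 1 + Y)"
        by (simp only: distrib_left) (simp add: algebra_simps)
      then have "of_int M * (hhat (w a) (w b) - tens (delta a b) 1) = of_int (fact n) * (of_int M * (tens d 1 + Y))"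
        by (simp only: mult.assoc [symmetric] mult_of_int_commute [of M "of_int (fact n)"])
      then have "of_int M * (hhat (w a) (w b) - tens (delta a b) 1) = of_int N * (of_int r * (of_int M * (tens d 1 + Y)))"
        by (simp only: r of_int_mult mult.assoc)
      moreover have "of_int M * Y \<in> OH"
      proof -
        have "of_int M * Y = of_int M * hhat (hat_vec (E n a)) y + of_int M * hhat x (hat_vec (E n b))
            + of_int (fact n) * (of_int M * hhat x y)"
          by (simp only: Y_def distrib_left) (simp only: mult.assoc [symmetric] mult_of_int_commute [of M "of_int (fact n)"])
        then show ?thesis
          using MOH x(1) y(1) hatL EL by (simp only:) (intro OH_add OH_of_int_mult MOH, auto)
      qed
      then have "of_int M * (tens d 1 + Y) \<in> OH"
        unfolding distrib_left using OH_of_int_mult [OF OH_tens [OF d(1)]] by (rule OH_add [rotated])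
      then have "of_int r * (of_int M * (tens d 1 + Y)) \<in> OH" by (rule OH_of_int_mult)
      ultimately show "\<exists>s\<in>OH. of_int M * (hhat (w a) (w b) - tens (delta a b) 1) = of_int N * s" by blast
    qed
    then have "of_int M * (hhat (w a) (w b) - tens (delta a b) 1) = 0" by (rule infinitely_divisible_eq_0)
    then show ?thesis using M by (simp add: hat_of_int_eq_0)
  qed
  moreover have "hhat (w a) (hat_vec y) \<in> OH" if y: "y \<in> L" for a y
  proof -
    \<comment> \<open>At this level n! is a multiple of M, so the error of approximation pairs
      integrally with L.\<close>
    define n where "n = nat M"
    have "M dvd fact n" using M unfolding n_def by (rule fact_dvd_of_int)
    then obtain r where r: "fact n = M * r" ..
    obtain x where x: "svec D x \<in> OV" "w a = hat_vec (E n a) + svec (fact n) x" using approx by blast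
    have "hhat (w a) (hat_vec y) = tens (h (E n a) y) 1 + of_int (fact n) * hhat x (hat_vec y)"
      by (simp only: x(2) hhat_add_left hhat_svec_left hhat_hat_vec)
    also have "of_int (fact n) * hhat x (hat_vec y) = of_int r * (of_int M * hhat x (hat_vec y))"
      by (simp only: r mult.commute [of M r] of_int_mult mult.assoc)
    also have "tens (h (E n a) y) 1 + \<dots> \<in> OH"
      by (intro OH_add OH_tens OH_of_int_mult MOH h_A EL y x(1) hatL)
    finally show ?thesis .
  qed
  ultimately show ?thesis by blast
qed

text \<open>M has the adelic orthonormal basis as columns and multiplier 1/c, and its inverse sends
  a vector to its pairings with the basis. A vector of \<open>gamma A M\<close> pairs integrally
  with L, hence lies in L by unimodularity and nondegeneracy.\<close>

lemma gamma_surjective: "\<exists>M\<in>GU UNIV hc. gamma A M = L"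
proof -
  obtain w where w: "\<And>a b. hhat (w a) (w b) = tens (delta a b) 1" "\<And>a y. y \<in> L \<Longrightarrow> hhat (w a) (hat_vec y) \<in> OH"
    using adelic_orthonormal_basis by blast
  define Ci :: "'h hat" where "Ci = tens (of_Q (inverse c)) 1"
  have CC: "Ci * C = 1" "C * Ci = 1"
    using c by (simp_all add: Ci_def C_def tens_mult one_tensor_def flip: of_Q_mult)
  have hc_Ci: "hc Ci = Ci" by (simp add: Ci_def)
  define M where "M = (\<chi> k a. w a $ k)"
  have "(dagger hc M ** M) $ a $ b = mat Ci $ a $ b" for a b
  proof -
    have "(dagger hc M ** M) $ a $ b = hdot (w a) (w b)"
      by (simp add: matrix_matrix_mult_def hdot_def M_def dagger_component)
    also have "\<dots> = Ci * hhat (w a) (w b)" by (simp add: hhat_def CC flip: mult.assoc)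
    also have "\<dots> = mat Ci $ a $ b"
      unfolding w(1) by (simp add: delta_def mat_def flip: one_tensor_def)
    finally show ?thesis .
  qed
  then have M: "dagger hc M ** M = mat Ci" by (simp add: vec_eq_iff)
  define N where "N = mat C ** dagger hc M"
  have N: "N ** M = mat 1" "M ** N = mat 1"
    using similitude_inverse [OF hc_Ci hc_C CC(1) M] by (simp_all add: N_def)
  have N_component: "(N *v x) $ a = hhat (w a) x" for x a
  proof -
    have "(N *v x) $ a = C * (dagger hc M *v x) $ a"
      by (simp add: N_def mat_vector flip: matrix_vector_mul_assoc)
    also have "\<dots> = hhat (w a) x"
      by (simp add: hhat_def hdot_def matrix_vector_mult_def M_def dagger_component)
    finally show ?thesis .
  qed
  have "gamma A M = L"
  proof
    show "L \<subseteq> gamma A M"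
      using w(2) gamma_inverse_iff [OF N] by (auto simp: OV_iff N_component)
    show "gamma A M \<subseteq> L"
    proof
      fix v assume "v \<in> gamma A M"
      then obtain x where x: "x \<in> OV" "hat_vec v = M *v x" by (auto simp: gamma_iff)
      have vA: "h v y \<in> A" if y: "y \<in> L" for y
      proof -
        have "tens (h v y) 1 = C * hdot (M *v x) (hat_vec y)"
          by (simp add: x(2) hhat_def flip: hhat_hat_vec)
        also have "\<dots> = hdot x (N *v hat_vec y)"
          by (simp add: hdot_adjoint N_def hdot_mat [OF hc_C] flip: matrix_vector_mul_assoc)
        also have "\<dots> \<in> OH"
          using x(1) w(2) [OF y] unfolding hdot_def N_component OV_iff by (intro OH_sum OH_mult OH_hc) auto
        finally show ?thesis by (simp add: OH_Int_H)
      qed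
      have "\<exists>u\<in>L. \<forall>y\<in>L. h v y = h u y"
        using vA by (intro representable) (simp_all add: h_add_right h_rmul_right)
      then obtain u where u: "u \<in> L" "\<And>y. y \<in> L \<Longrightarrow> h v y = h u y" by blast
      have "v = u" using u(2) by (rule h_nondegenerate)
      then show "v \<in> L" using u(1) by simp
    qed
  qed
  moreover have "M \<in> GU UNIV hc" using hc_Ci hc_C CC(1) M by (rule GU_UNIV_I)
  ultimately show ?thesis by blast
qed

end

section \<open>Principally polarized modules and the bijection\<close>

context maximal_quaternion_order
begin

lemma principally_polarized_lattice:
  fixes L :: "('h ^ 'g::finite) set"
  assumes "principally_polarized i j A L"
  shows "\<exists>c. polarized_lattice i j A L c"
proof -
  obtain S c where S: "finite S" "L = right_submodule A hull S" and span: "rat_vec.span L = UNIV"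
    and c: "c \<noteq> 0" "\<And>x y. x \<in> L \<Longrightarrow> y \<in> L \<Longrightarrow> scaleQ c (h0 x y) \<in> A"
      "unimodular_on A L (\<lambda>x y. scaleQ c (h0 x y))"
    using assms unfolding principally_polarized_def by blast
  have sub: "right_submodule A L" unfolding S(2) by (rule right_submodule_hull)
  have "polarized_lattice i j A L c"
  proof unfold_locales
    show "right_submodule A L" by (rule sub)
    have "\<exists>n>0. of_int n * s $ k \<in> A" for s :: "'h ^ 'g" and k by (rule A_denominator)
    then obtain n where n: "\<And>s k. n s k > 0" "\<And>(s :: 'h ^ 'g) k. of_int (n s k) * s $ k \<in> A" by metis
    define D where "D = (\<Prod>(s, k) \<in> S \<times> UNIV. n s k)"
    have D: "D > 0" unfolding D_def by (rule prod_pos) (auto simp: n(1))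
    have DS: "of_int D * s $ k \<in> A" if "s \<in> S" for s k
    proof -
      have "n s k dvd D"
        unfolding D_def using that S(1)
        by (intro dvd_trans [OF _ dvd_prodI [of _ "(s, k)"]]) auto
      then obtain r where "D = r * n s k" by (metis dvdE mult.commute)
      then show ?thesis using A_of_int_mult [OF n(2) [of s k], of r] by (simp add: mult.assoc)
    qed
    have "right_submodule A hull S \<subseteq> {v. \<forall>k. of_int D * v $ k \<in> A}"
    proof (rule hull_minimal)
      show "S \<subseteq> {v. \<forall>k. of_int D * v $ k \<in> A}" using DS by blast
      show "right_submodule A {v :: 'h ^ 'g. \<forall>k. of_int D * v $ k \<in> A}"
        by (auto simp: right_submodule_def distrib_left A_add A_mult simp flip: mult.assoc)
    qed
    then show "\<exists>D>0. \<forall>v\<in>L. \<forall>k. of_int D * v $ k \<in> A" using D S(2) by blast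
    show "\<exists>n>0. svec n v \<in> L" for v
    proof -
      have "v \<in> rat_vec.span L" by (simp add: span)
      then show ?thesis
      proof (induction rule: rat_vec.span_induct_alt)
        case base
        have "svec 1 0 = (0 :: 'h ^ 'g)" by (simp add: vec_eq_iff)
        then show ?case using submodule_0 [OF sub] by (intro exI [of _ 1]) simp
      next
        case (step q x y)
        then obtain n where n: "n > 0" "svec n y \<in> L" by blast
        obtain a b where "quotient_of q = (a, b)" by (cases "quotient_of q")
        then have b: "b > 0" and q: "q = of_int a / of_int b"
          using quotient_of_denom_pos quotient_of_div by auto
        have "of_int (n * b) * of_Q q = (of_int (n * a) :: 'h)"
        proof -
          have "of_int (n * b) * q = of_int (n * a)" using b by (simp add: q)
          then show ?thesis by (metis of_Q_mult of_Q_of_int)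
        qed
        then have "of_int (n * b) * (of_Q q * x $ k) = of_int (n * a) * x $ k" for k
          by (simp only: mult.assoc [symmetric])
        then have "svec (n * b) (vscaleQ q x + y) = svec (n * a) x + svec b (svec n y)"
          by (simp add: vec_eq_iff vscaleQ_def scaleQ_def distrib_left mult.commute [of n b] mult.assoc del: of_int_mult)
            (simp add: mult.assoc)
        moreover have "svec k z \<in> L" if "z \<in> L" for k z
          using submodule_of_int [OF sub that] by (simp add: svec_def)
        ultimately have "svec (n * b) (vscaleQ q x + y) \<in> L"
          using step(1) n(2) by (simp add: submodule_add [OF sub])
        then show ?case using n(1) b by (intro exI [of _ "n * b"]) simp
      qed
    qed
  qed (use c in auto)
  then show ?thesis by blast
qed

lemma gamma_image:
  "gamma A ` (GU UNIV hc :: ('h hat ^ 'g::finite ^ 'g) set) = {L. principally_polarized i j A L}"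
proof
  show "gamma A ` (GU UNIV hc :: ('h hat ^ 'g ^ 'g) set) \<subseteq> {L. principally_polarized i j A L}"
    using gamma_principally_polarized by blast
  show "{L. principally_polarized i j A L} \<subseteq> gamma A ` (GU UNIV hc :: ('h hat ^ 'g ^ 'g) set)"
  proof
    fix L :: "('h ^ 'g) set" assume "L \<in> {L. principally_polarized i j A L}"
    then obtain c where "polarized_lattice i j A L c" using principally_polarized_lattice by blast
    then interpret polarized_lattice i j A L c .
    show "L \<in> gamma A ` GU UNIV hc" using gamma_surjective by blast
  qed
qed

end

theorem theorem2p6:
  fixes i j :: "'h::{division_ring, ring_char_0}" and A :: "'h set"
  assumes "quaternion_basis i j"
    and "definite_algebra TYPE('h)"
    and "maximal_order A"
  defines "G \<equiv> (GU_group UNIV (hat_conj i j) :: ('h hat ^ 'g::finite ^ 'g) monoid)"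
    and "K \<equiv> (GU (hat_order A) (hat_conj i j) :: ('h hat ^ 'g ^ 'g) set)"
  shows "\<exists>\<Gamma>. (\<forall>M \<in> carrier G. \<Gamma> (M <#\<^bsub>G\<^esub> K) = gamma A M) \<and>
    bij_betw \<Gamma> (lcosets\<^bsub>G\<^esub> K) {L :: ('h ^ 'g) set. principally_polarized i j A L}"
proof -
  interpret maximal_quaternion_order i j A
    using assms(1,3) by unfold_locales
  have carrier: "carrier G = GU UNIV hc" and coset: "M <#\<^bsub>G\<^esub> K = (**) M ` K" for M
    by (auto simp: G_def GU_group_def l_coset_def)
  have one: "mat 1 \<in> K"
  proof -
    have "(mat 1 :: 'h hat ^ 'g ^ 'g) \<in> OM" by (simp add: OM_iff mat_def)
    then show ?thesis
      unfolding K_def GU_OH_iff by (intro conjI bexI [of _ 1]) (simp_all add: dagger_mat)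
  qed
  \<comment> \<open>One direction makes the map on cosets well defined, the other makes it
    injective.\<close>
  have eq_iff: "M <#\<^bsub>G\<^esub> K = M' <#\<^bsub>G\<^esub> K \<longleftrightarrow> gamma A M = gamma A M'"
    if "M \<in> carrier G" "M' \<in> carrier G" for M M'
  proof
    assume "M <#\<^bsub>G\<^esub> K = M' <#\<^bsub>G\<^esub> K"
    moreover have "M ** mat 1 \<in> M <#\<^bsub>G\<^esub> K" unfolding coset using one by (rule imageI)
    ultimately obtain P where "P \<in> K" "M = M' ** P" by (auto simp: coset)
    then show "gamma A M = gamma A M'" by (simp add: K_def gamma_mult_GU_OH)
  next
    have sub: "N' <#\<^bsub>G\<^esub> K \<subseteq> N <#\<^bsub>G\<^esub> K"
      if N: "N \<in> GU UNIV hc" "N' \<in> GU UNIV hc" "gamma A N = gamma A N'" for N N'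
    proof
      fix Q assume "Q \<in> N' <#\<^bsub>G\<^esub> K"
      then obtain P where P: "P \<in> K" "Q = N' ** P" by (auto simp: coset)
      have "Q \<in> GU UNIV hc" using GU_mult [OF N(2) GU_OH_subset] P by (simp add: K_def)
      moreover have "gamma A N = gamma A Q" using P N(3) by (simp add: K_def gamma_mult_GU_OH)
      ultimately obtain P' where "P' \<in> GU OH hc" "Q = N ** P'" using gamma_eq_imp N(1) by blast
      then show "Q \<in> N <#\<^bsub>G\<^esub> K" unfolding coset by (simp add: K_def)
    qed
    assume "gamma A M = gamma A M'"
    then show "M <#\<^bsub>G\<^esub> K = M' <#\<^bsub>G\<^esub> K"
      using sub [of M M'] sub [of M' M] that by (simp add: carrier)
  qed
  \<comment> \<open>The lattice of an arbitrarily chosen representative; \<open>eq_iff\<close>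
    removes the dependence on the choice.\<close>
  define \<Gamma> where "\<Gamma> = (\<lambda>X. gamma A (SOME M. M \<in> carrier G \<and> M <#\<^bsub>G\<^esub> K = X))"
  have \<Gamma>: "\<Gamma> (M <#\<^bsub>G\<^esub> K) = gamma A M" if "M \<in> carrier G" for M
  proof -
    let ?M = "SOME M'. M' \<in> carrier G \<and> M' <#\<^bsub>G\<^esub> K = M <#\<^bsub>G\<^esub> K"
    have M: "?M \<in> carrier G \<and> ?M <#\<^bsub>G\<^esub> K = M <#\<^bsub>G\<^esub> K"
      by (rule someI [of _ M]) (use that in simp)
    show ?thesis
      unfolding \<Gamma>_def using eq_iff [OF conjunct1 [OF M] that] conjunct2 [OF M] by (rule iffD1)
  qed
  have "lcosets\<^bsub>G\<^esub> K = (\<lambda>M. M <#\<^bsub>G\<^esub> K) ` carrier G" by (auto simp: LCOSETS_def)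
  moreover have "inj_on \<Gamma> ((\<lambda>M. M <#\<^bsub>G\<^esub> K) ` carrier G)"
    by (rule inj_onI) (elim imageE, metis \<Gamma> eq_iff)
  moreover have "\<Gamma> ` ((\<lambda>M. M <#\<^bsub>G\<^esub> K) ` carrier G) = gamma A ` carrier G"
    using \<Gamma> by (force simp: image_image)
  ultimately show ?thesis
    using \<Gamma> gamma_image by (intro exI [of _ \<Gamma>]) (simp add: bij_betw_def carrier)
qed

end
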